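(* Let $0<\alpha<1$ and let $G_\alpha$ be the intrinsic square function on $\mathbb R^n$. For $1\le p<\infty$ there is a constant $C=C(n,p,\alpha)$ such that for every weight $w\in A_p$ on $\mathbb R^n$ and every $f\in L^p(w)$, $$\|G_\alpha f\|_{L^{p,\infty}(w)}\le C\,C_p(w)\,\|f\|_{L^p(w)},$$ where $$C_p(w)=\begin{cases}[w]_{A_p}^{1/p}, & 1\le p<2,\\[2pt] [w]_{A_p}^{1/2}\,(\log_1[w]_{A_\infty})^{1/2}, & 2\le p<\infty.\end{cases}$$
   Context: Intrinsic square function. For $0<\alpha<1$ let $C_\alpha$ be the collection of functions $\gamma:\mathbb R^n\to\mathbb R$ supported in the unit ball, with mean zero, and such that $|\gamma(x)-\gamma(y)|\le|x-y|^\alpha$ for all $x,y$. Put $\gamma_t(x)=t^{-n}\gamma(x/t)$, $A_\alpha f(y,t)=\sup_{\gamma\in C_\alpha}|f*\gamma_t(y)|$, and $$G_\alpha f(x)^2=\int_{\Gamma(x)}A_\alpha f(y,t)^2\,\frac{dy\,dt}{t^{n+1}},\qquad \Gamma(x)=\{(y,t)\in\mathbb R^{n+1}_+:|x-y|<t\}.$$ Weights. A weight is a non-negative locally integrable function $w$ on $\mathbb R^n$; $w(E)=\int_Ew\,dx$; $\|f\|_{L^p(w)}=(\int|f|^pw\,dx)^{1/p}$; $\|g\|_{L^{p,\infty}(w)}=\sup_{\lambda>0}\lambda\,w(\{|g|>\lambda\})^{1/p}$. $M$ is the Hardy–Littlewood maximal operator. For $1<p<\infty$, $$[w]_{A_p}=\sup_Q\frac1{|Q|}\int_Qw\,dx\cdot\Bigl(\frac1{|Q|}\int_Qw^{-\frac1{p-1}}dx\Bigr)^{p-1},$$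 $[w]_{A_1}=\sup_x Mw(x)/w(x)$ (essential supremum), and $[w]_{A_\infty}=\sup_Q\frac{\int_QM(w\mathbf 1_Q)\,dx}{w(Q)}$, the suprema in $Q$ being over cubes. $w\in A_p$ means $[w]_{A_p}<\infty$. Finally $\log_1(x)=1+\log_+(x)$, with $\log_+(x)=\max(\log x,0)$. *)

theory Defs
  imports "HOL-Analysis.Analysis" "HOL-Probability.Essential_Supremum"
begin

text \<open>
  Norms, averages and weight characteristics take values in \<^typ>\<open>ennreal\<close>, so that suprema and
  integrals may be infinite; there \<^term>\<open>0 * (\<infinity>::ennreal) = 0\<close> and \<^term>\<open>0 / (0::ennreal) = 0\<close>.
  These conventions matter only for weights vanishing almost everywhere.

  Since \<open>0 powr a = 0\<close> for every real \<open>a\<close>, also for negative \<open>a\<close>, real powers of extended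
  numbers are defined so that a negative power of \<open>0\<close> is \<open>\<infinity>\<close>.
\<close>

definition ennpowr :: "ennreal \<Rightarrow> real \<Rightarrow> ennreal" where
  "ennpowr x a =
     (if a = 0 then 1
      else if a > 0 then (if x = \<infinity> then \<infinity> else ennreal (enn2real x powr a))
      else (if x = \<infinity> then 0 else inverse (ennreal (enn2real x powr (- a)))))"

definition log1 :: "ennreal \<Rightarrow> ennreal" where
  "log1 x = (if x = \<infinity> then \<infinity> else ennreal (1 + max (ln (enn2real x)) 0))"


section \<open>The intrinsic square function\<close>

definition holder_class :: "real \<Rightarrow> (real^'n \<Rightarrow> real) set" where
  "holder_class \<alpha> =
     {\<gamma>. (\<forall>x. norm x > 1 \<longrightarrow> \<gamma> x = 0) \<and> (\<integral>x. \<gamma> x \<partial>lebesgue) = 0 \<and>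
         (\<forall>x y. \<bar>\<gamma> x - \<gamma> y\<bar> \<le> norm (x - y) powr \<alpha>)}"

definition dilate :: "real \<Rightarrow> (real^'n \<Rightarrow> real) \<Rightarrow> real^'n \<Rightarrow> real" where
  "dilate t \<gamma> x = \<gamma> (x /\<^sub>R t) / t ^ CARD('n)"

definition convolve :: "(real^'n \<Rightarrow> real) \<Rightarrow> (real^'n \<Rightarrow> real) \<Rightarrow> real^'n \<Rightarrow> real" where
  "convolve f g y = (\<integral>z. f z * g (y - z) \<partial>lebesgue)"

definition intrinsic_sup :: "real \<Rightarrow> (real^'n \<Rightarrow> real) \<Rightarrow> real^'n \<Rightarrow> real \<Rightarrow> ennreal" where
  "intrinsic_sup \<alpha> f y t = (SUP \<gamma>\<in>holder_class \<alpha>. ennreal \<bar>convolve f (dilate t \<gamma>) y\<bar>)"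

definition cone :: "real^'n \<Rightarrow> ((real^'n) \<times> real) set" where
  "cone x = {(y, t). t > 0 \<and> norm (x - y) < t}"

definition intrinsic_square :: "real \<Rightarrow> (real^'n \<Rightarrow> real) \<Rightarrow> real^'n \<Rightarrow> ennreal" where
  "intrinsic_square \<alpha> f x =
     ennpowr (\<integral>\<^sup>+ (y, t) \<in> cone x. (intrinsic_sup \<alpha> f y t)\<^sup>2 / ennreal (t ^ (CARD('n) + 1)) \<partial>lebesgue)
       (1/2)"


section \<open>Weights and weighted spaces\<close>

definition weight :: "(real^'n \<Rightarrow> real) \<Rightarrow> bool" where
  "weight w \<longleftrightarrow> (\<forall>x. w x \<ge> 0) \<and> (\<forall>K. compact K \<longrightarrow> set_integrable lebesgue K w)"

definition wmeasure :: "(real^'n \<Rightarrow> real) \<Rightarrow> (real^'n) set \<Rightarrow> ennreal" where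
  "wmeasure w E = (\<integral>\<^sup>+ x\<in>E. ennreal (w x) \<partial>lebesgue)"

definition Lp_norm :: "real \<Rightarrow> (real^'n \<Rightarrow> real) \<Rightarrow> (real^'n \<Rightarrow> real) \<Rightarrow> ennreal" where
  "Lp_norm p w f = ennpowr (\<integral>\<^sup>+ x. ennreal (\<bar>f x\<bar> powr p * w x) \<partial>lebesgue) (1/p)"

definition Lp :: "real \<Rightarrow> (real^'n \<Rightarrow> real) \<Rightarrow> (real^'n \<Rightarrow> real) set" where
  "Lp p w = {f \<in> borel_measurable lebesgue. Lp_norm p w f < \<infinity>}"

definition weak_Lp_norm :: "real \<Rightarrow> (real^'n \<Rightarrow> real) \<Rightarrow> (real^'n \<Rightarrow> ennreal) \<Rightarrow> ennreal" where
  "weak_Lp_norm p w g =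
     (SUP s\<in>{0<..}. ennreal s * ennpowr (wmeasure w {x. g x > ennreal s}) (1/p))"

definition cubes :: "(real^'n) set set" where
  "cubes = {cbox a (\<chi> i. a $ i + l) | a l. l > 0}"

definition average :: "(real^'n) set \<Rightarrow> (real^'n \<Rightarrow> ennreal) \<Rightarrow> ennreal" where
  "average Q g = (\<integral>\<^sup>+ x\<in>Q. g x \<partial>lebesgue) / emeasure lebesgue Q"

definition maximal :: "(real^'n \<Rightarrow> real) \<Rightarrow> real^'n \<Rightarrow> ennreal" where
  "maximal f x = (SUP Q\<in>{Q \<in> cubes. x \<in> Q}. average Q (\<lambda>y. ennreal \<bar>f y\<bar>))"

text \<open>The characteristic for \<open>1 \<le> p\<close>; the defining formula for \<open>p > 1\<close> does not apply at \<open>p = 1\<close>.\<close>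

definition Ap_const :: "real \<Rightarrow> (real^'n \<Rightarrow> real) \<Rightarrow> ennreal" where
  "Ap_const p w =
     (if p = 1 then esssup lebesgue (\<lambda>x. maximal w x / ennreal (w x))
      else (SUP Q\<in>cubes. average Q (\<lambda>x. ennreal (w x)) *
              ennpowr (average Q (\<lambda>x. ennpowr (ennreal (w x)) (- 1 / (p - 1)))) (p - 1)))"

definition Ainf_const :: "(real^'n \<Rightarrow> real) \<Rightarrow> ennreal" where
  "Ainf_const w =
     (SUP Q\<in>cubes. (\<integral>\<^sup>+ x\<in>Q. maximal (\<lambda>y. w y * indicator Q y) x \<partial>lebesgue) / wmeasure w Q)"

definition Ap :: "real \<Rightarrow> (real^'n \<Rightarrow> real) set" where
  "Ap p = {w. weight w \<and> Ap_const p w < \<infinity>}"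

definition weight_factor :: "real \<Rightarrow> (real^'n \<Rightarrow> real) \<Rightarrow> ennreal" where
  "weight_factor p w =
     (if p < 2 then ennpowr (Ap_const p w) (1/p)
      else ennpowr (Ap_const p w) (1/2) * ennpowr (log1 (Ainf_const w)) (1/2))"

end

theory Submission
  imports Defs
begin

text \<open>
  For a cube \<open>P\<close> of a dyadic grid let \<open>osc(P)\<close> be the sum over the dyadic descendants \<open>Q\<close> of \<open>P\<close>
  of the mean oscillation of \<open>f\<close> between \<open>Q\<close> and its children, damped by the factor
  \<open>(l(Q) / l(P))\<^sup>\<alpha> |Q| / |P|\<close>. It dominates the pairing of \<open>f\<close> with every normalised Hoelder function
  of mean zero supported in \<open>P\<close>, and every ball lies in a comparable cube of one of \<open>2\<^sup>n\<close> shifted grids.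
  Hence the square of the intrinsic square function is at most a constant times the sum over the grids
  of \<open>S(x)\<^sup>2\<close>, the sum of \<open>osc(P)\<^sup>2\<close> over all cubes \<open>P\<close> containing \<open>x\<close>.

  Let \<open>c(P) = osc(P)\<^sup>2 / \<tau>\<^sup>2\<close> for the cubes on which the mean of \<open>|f|\<close> lies between \<open>\<tau> / 2\<close> and \<open>\<tau>\<close>.
  These numbers form a Carleson sequence with respect to Lebesgue measure, uniformly in \<open>\<tau>\<close>. By
  Chebyshev's inequality the part of \<open>P\<close> where the sum of \<open>c\<close> over the cubes below \<open>P\<close> stays bounded
  carries a fixed share of \<open>|P|\<close> and of the integral of \<open>|f|\<close>. Testing the \<open>A\<^sub>p\<close> condition (or
  the \<open>A\<^sub>\<infinity>\<close> condition) on that part bounds the sum of \<open>c(P) w(P)\<close> by \<open>[w] \<tau>\<^sup>-\<^sup>p\<close> times the integral of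
  \<open>|f|\<^sup>p w\<close>, and also turns \<open>c\<close> into a Carleson sequence for \<open>w\<close> with constant \<open>\<Lambda>\<close> at most a multiple
  of \<open>[w]\<close> and of \<open>[w]\<^sub>\<infinity>\<close>.

  The level set \<open>S > 1\<close> is split along \<open>\<tau> = 2\<^sup>-\<^sup>m\<close>. For \<open>p < 2\<close> the Markov inequality on each scale gives
  a convergent geometric series. For \<open>p \<ge> 2\<close> it is used for the first \<open>O(1 + log \<Lambda>)\<close> scales, which
  produces the logarithm; the remaining scales are summed with high moments, available because \<open>c\<close> is
  a Carleson sequence for \<open>w\<close>.
\<close>

section \<open>The oscillation functional on a tree of averages\<close>

text \<open>The exponents come from one count. At scale \<open>\<tau> = 2^-m\<close> the level 1 of
  \<open>S^2\<close> is the level \<open>4^m\<close> of the Carleson sum, whose first moment is at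
  most a multiple of \<open>[w] 2^(pm)\<close> times the integral of \<open>|f|^p w\<close>.
  Markov's inequality thus costs \<open>[w] 2^((p-2)m)\<close>. This decays for
  \<open>p < 2\<close>. For \<open>p \<ge> 2\<close> it does not, but once \<open>4^m\<close>
  exceeds \<open>\<Lambda>\<close> high moments take over, so a scale costs at most about
  \<open>[w] \<Lambda>^((p-2)/2)\<close>. As \<open>\<Lambda>\<close> is at most a multiple of
  \<open>[w]\<close>, the p-th root is \<open>[w]^(1/2)\<close>; the number of costly scales, about
  \<open>log \<Lambda>\<close>, is measured by the A-infinity constant instead. Cubes on which the
  mean of \<open>|f|\<close> exceeds 1 belong to none of these scales. They are removed beforehand
  by the weak-type bound of the dyadic maximal function. All trees are finite, with bounds that do
  not depend on the depth. A leaf carries the mean of \<open>|f|\<close> in place of the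
  oscillations below it. A function in the weighted space may fail to be integrable on a cube, but
  testing shows that such a cube has weight 0.\<close>

datatype 'n node = Node (corner: "real^'n") (side: real)

text \<open>\<open>s\<close> is the set of coordinates in which the child occupies the upper half,
  so the children are indexed by the finite type \<open>'n set\<close>.\<close>

definition child :: "'n::finite node \<Rightarrow> 'n set \<Rightarrow> 'n node" where
  "child Q s = Node (\<chi> i. corner Q $ i + (if i \<in> s then side Q / 2 else 0)) (side Q / 2)"

definition child_mean :: "('n::finite node \<Rightarrow> real) \<Rightarrow> 'n node \<Rightarrow> real" where
  "child_mean g Q = (\<Sum>s\<in>UNIV. g (child Q s)) / 2 ^ CARD('n)"

lemma card_UNIV_set_finite: "card (UNIV :: 'n::finite set set) = 2 ^ CARD('n)"
  using card_Pow[of "UNIV :: 'n set"] by simp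

lemma child_mean_mono: "(\<And>s. g (child Q s) \<le> h (child Q s)) \<Longrightarrow> child_mean g Q \<le> child_mean h Q"
  unfolding child_mean_def by (intro divide_right_mono sum_mono) auto

lemma child_mean_nonneg: "(\<And>s. 0 \<le> g (child Q s)) \<Longrightarrow> 0 \<le> child_mean g Q"
  unfolding child_mean_def by (intro divide_nonneg_nonneg sum_nonneg) auto

lemma child_mean_add: "child_mean (\<lambda>R. g R + h R) Q = child_mean g Q + child_mean h Q"
  by (simp add: child_mean_def sum.distrib add_divide_distrib)

lemma child_mean_diff: "child_mean (\<lambda>R. g R - h R) Q = child_mean g Q - child_mean h Q"
  by (simp add: child_mean_def sum_subtractf diff_divide_distrib)

lemma child_mean_cmult: "child_mean (\<lambda>R. c * g R) Q = c * child_mean g Q"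
  by (simp add: child_mean_def sum_distrib_left)

lemma child_mean_const [simp]: "child_mean (\<lambda>R. c) (Q :: 'n::finite node) = c"
  by (simp add: child_mean_def card_UNIV_set_finite)

text \<open>Source of the factor \<open>\<kappa>\<close> in \<open>low_energy_aux\<close>: a single
  child may carry the whole mean.\<close>

lemma child_le_child_mean:
  fixes Q :: "'n::finite node"
  assumes "\<And>R. 0 \<le> g R"
  shows "g (child Q s) \<le> 2 ^ CARD('n) * child_mean g Q"
  using member_le_sum[of s UNIV "\<lambda>s. g (child Q s)"] assms by (simp add: child_mean_def)

text \<open>Jensen's inequality, read off from a nonnegative variance.\<close>

lemma child_mean_square:
  fixes Q :: "'n::finite node"
  shows "(child_mean g Q)\<^sup>2 \<le> child_mean (\<lambda>R. (g R)\<^sup>2) Q"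
proof -
  have "0 \<le> child_mean (\<lambda>R. (g R - child_mean g Q)\<^sup>2) Q"
    by (rule child_mean_nonneg) simp
  also have "child_mean (\<lambda>R. (g R - child_mean g Q)\<^sup>2) Q
      = child_mean (\<lambda>R. (g R)\<^sup>2 + (- 2 * child_mean g Q) * g R + (child_mean g Q)\<^sup>2) Q"
    by (rule arg_cong[where f="\<lambda>z. child_mean z Q"]) (auto simp: power2_eq_square algebra_simps)
  also have "\<dots> = child_mean (\<lambda>R. (g R)\<^sup>2) Q - (child_mean g Q)\<^sup>2"
    by (simp only: child_mean_add child_mean_cmult child_mean_const) (simp add: power2_eq_square)
  finally show ?thesis by simp
qed

text \<open>The argument \<open>h\<close> of \<open>osc\<close>, \<open>tree_mean\<close> and \<open>tree_sum\<close> counts the generations below the node.\<close>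

primrec osc :: "real \<Rightarrow> ('n::finite node \<Rightarrow> real) \<Rightarrow> ('n node \<Rightarrow> real) \<Rightarrow> nat \<Rightarrow> 'n node \<Rightarrow> real" where
  "osc \<theta> F A 0 = A"
| "osc \<theta> F A (Suc h) = (\<lambda>Q. child_mean (\<lambda>R. \<bar>F R - F Q\<bar>) Q + \<theta> * child_mean (osc \<theta> F A h) Q)"

primrec tree_mean :: "(nat \<Rightarrow> 'n::finite node \<Rightarrow> real) \<Rightarrow> nat \<Rightarrow> 'n node \<Rightarrow> real" where
  "tree_mean c 0 = c 0"
| "tree_mean c (Suc h) = (\<lambda>Q. c (Suc h) Q + child_mean (tree_mean c h) Q)"

lemma tree_mean_mono: "(\<And>h Q. c h Q \<le> d h Q) \<Longrightarrow> tree_mean c h Q \<le> tree_mean d h Q"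
  by (induction h arbitrary: Q) (auto intro!: add_mono child_mean_mono)

lemma tree_mean_cmult: "tree_mean (\<lambda>h Q. r * c h Q) h Q = r * tree_mean c h Q"
proof (induction h arbitrary: Q)
  case (Suc h)
  then have "tree_mean (\<lambda>h Q. r * c h Q) h = (\<lambda>Q. r * tree_mean c h Q)" by blast
  then show ?case by (simp add: child_mean_cmult distrib_left)
qed simp

text \<open>The cutoff is one-sided, which suits the induction over generations. The coefficients of
  the band between \<open>\<tau> / 2\<close> and \<open>\<tau>\<close> used later are dominated by
  this function divided by \<open>\<tau>\<^sup>2\<close>.\<close>

definition low_energy ::
  "real \<Rightarrow> ('n::finite node \<Rightarrow> real) \<Rightarrow> ('n node \<Rightarrow> real) \<Rightarrow> real \<Rightarrow> nat \<Rightarrow> 'n node \<Rightarrow> real" where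
  "low_energy \<theta> F A \<tau> h Q = (if A Q \<le> \<tau> then (osc \<theta> F A h Q)\<^sup>2 else 0)"

context
  fixes F A :: "'n::finite node \<Rightarrow> real" and \<theta> :: real
  assumes F_mean: "\<And>Q. F Q = child_mean F Q"
    and A_mean: "\<And>Q. A Q = child_mean A Q"
    and F_le_A: "\<And>Q. \<bar>F Q\<bar> \<le> A Q"
    and \<theta>: "0 < \<theta>" "\<theta> < 1"
begin

lemma osc_nonneg: "0 \<le> osc \<theta> F A h Q"
proof (induction h arbitrary: Q)
  case 0
  then show ?case using F_le_A[of Q] by auto
next
  case (Suc h)
  show ?case using Suc \<theta> unfolding osc.simps
    by (intro add_nonneg_nonneg mult_nonneg_nonneg child_mean_nonneg) auto
qed

lemma mean_osc_le: "child_mean (\<lambda>R. \<bar>F R - F Q\<bar>) Q \<le> 2 * A Q"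
proof -
  have "child_mean (\<lambda>R. \<bar>F R - F Q\<bar>) Q \<le> child_mean (\<lambda>R. A R + A Q) Q"
  proof (rule child_mean_mono)
    fix s show "\<bar>F (child Q s) - F Q\<bar> \<le> A (child Q s) + A Q"
      using F_le_A[of "child Q s"] F_le_A[of Q] by linarith
  qed
  also have "\<dots> = 2 * A Q"
    unfolding child_mean_add using A_mean[of Q] by simp
  finally show ?thesis .
qed

text \<open>Every generation contributes a mean oscillation of at most \<open>2 * A Q\<close>,
  because averaging \<open>A\<close> over descendants returns \<open>A Q\<close>; the damping turns
  this into the geometric series with sum \<open>2 / (1 - \<theta>)\<close>.\<close>

lemma osc_le: "osc \<theta> F A h Q \<le> 2 / (1 - \<theta>) * A Q"
proof (induction h arbitrary: Q)
  case 0
  have "0 \<le> A Q" using F_le_A[of Q] by linarith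
  moreover have "1 \<le> 2 / (1 - \<theta>)" using \<theta> by simp
  ultimately show ?case using mult_right_mono[of 1 "2 / (1 - \<theta>)" "A Q"] by simp
next
  case (Suc h)
  have "osc \<theta> F A (Suc h) Q \<le> 2 * A Q + \<theta> * child_mean (\<lambda>R. 2 / (1 - \<theta>) * A R) Q"
    using mean_osc_le[of Q] \<theta> Suc by (auto intro!: add_mono mult_left_mono child_mean_mono)
  also have "\<dots> = 2 * A Q + \<theta> * (2 / (1 - \<theta>) * A Q)"
    unfolding child_mean_cmult using A_mean[of Q] by simp
  also have "\<dots> = 2 / (1 - \<theta>) * A Q" using \<theta> by (simp add: field_simps)
  finally show ?case .
qed

text \<open>The right-hand side is the variance of \<open>F\<close> over the children, a martingale
  increment that telescopes along the tree.\<close>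

lemma mean_osc_square:
  "(child_mean (\<lambda>R. \<bar>F R - F Q\<bar>) Q)\<^sup>2 \<le> child_mean (\<lambda>R. (F R)\<^sup>2) Q - (F Q)\<^sup>2"
proof -
  have "(child_mean (\<lambda>R. \<bar>F R - F Q\<bar>) Q)\<^sup>2 \<le> child_mean (\<lambda>R. \<bar>F R - F Q\<bar>\<^sup>2) Q"
    by (rule child_mean_square)
  also have "\<dots> = child_mean (\<lambda>R. (F R)\<^sup>2 + (- 2 * F Q) * F R + (F Q)\<^sup>2) Q"
    by (rule arg_cong[where f="\<lambda>z. child_mean z Q"]) (auto simp: power2_eq_square algebra_simps)
  also have "\<dots> = child_mean (\<lambda>R. (F R)\<^sup>2) Q - (F Q)\<^sup>2"
    unfolding child_mean_add child_mean_cmult child_mean_const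
    using F_mean[of Q] by (simp add: power2_eq_square)
  finally show ?thesis .
qed

text \<open>The second claim is a Bellman inequality. As long as the mean of \<open>|f|\<close> is at most \<open>2 * \<tau>\<close>, the
  concave term \<open>- C * (F Q)\<^sup>2\<close> absorbs the oscillation; beyond that, the linear term is large enough to
  pay for falling back on the first claim.\<close>

lemma low_energy_aux:
  fixes \<tau> :: real
  defines "\<kappa> \<equiv> 2 ^ CARD('n)" and "l \<equiv> \<theta> / (1 - \<theta>)" and "C \<equiv> 1 / (1 - \<theta>)\<^sup>2"
  assumes \<tau>: "0 < \<tau>"
    and G1: "2 * \<kappa> * (1 + l + C) \<le> \<Gamma>" and G2: "16 * l * \<kappa>\<^sup>2 / (1 - \<theta>)\<^sup>2 + 4 * C * \<kappa>\<^sup>2 \<le> \<Gamma>"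
  shows "tree_mean (low_energy \<theta> F A \<tau>) h Q \<le> \<Gamma> * \<tau>\<^sup>2 \<and>
    (A Q \<le> 2 * \<kappa> * \<tau> \<longrightarrow>
      tree_mean (low_energy \<theta> F A \<tau>) h Q + l * (osc \<theta> F A h Q)\<^sup>2 \<le> \<Gamma> * \<tau> * A Q - C * (F Q)\<^sup>2)"
proof -
  have \<kappa>: "1 \<le> \<kappa>" unfolding \<kappa>_def by simp
  have l: "0 < l" and C: "0 < C" unfolding l_def C_def using \<theta> by auto
  \<comment> \<open>The choice of \<open>l\<close> and \<open>C\<close> means
    \<open>(1 + l) * \<theta> = l\<close> and \<open>(1 + l) / (1 - \<theta>) = C\<close>. One copy
    of the squared oscillation joins the sum, \<open>l\<close> copies are stored in the inequality,
    and the recursion hands exactly \<open>l\<close> copies on to the children.\<close>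
  have l1: "1 + l = 1 / (1 - \<theta>)" unfolding l_def using \<theta> by (simp add: field_simps)
  have A0: "0 \<le> A R" for R using F_le_A[of R] by linarith
  have FA: "(F R)\<^sup>2 \<le> (A R)\<^sup>2" for R using F_le_A[of R] by (metis abs_le_square_iff abs_of_nonneg A0)
  have Gpos: "0 < \<Gamma>" using G1 \<kappa> l C by (smt (verit) mult_pos_pos)
  have from_L: "\<Gamma> * \<tau> * A Q - C * (F Q)\<^sup>2 \<le> \<Gamma> * \<tau>\<^sup>2" if "A Q \<le> \<tau>" for Q
  proof -
    have "\<Gamma> * \<tau> * A Q \<le> \<Gamma> * \<tau> * \<tau>" using that Gpos \<tau> by (intro mult_left_mono) auto
    moreover have "0 \<le> C * (F Q)\<^sup>2" using C by simp
    ultimately show ?thesis by (simp add: power2_eq_square)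
  qed
  have \<tau>\<kappa>: "\<tau> \<le> 2 * \<kappa> * \<tau>" using \<kappa> \<tau> mult_right_mono[of 1 "2*\<kappa>" \<tau>] by simp
  show ?thesis
  proof (induction h arbitrary: Q)
    case 0
    have L: "tree_mean (low_energy \<theta> F A \<tau>) 0 Q + l * (osc \<theta> F A 0 Q)\<^sup>2 \<le> \<Gamma> * \<tau> * A Q - C * (F Q)\<^sup>2"
      if a: "A Q \<le> 2 * \<kappa> * \<tau>" for Q
    proof -
      have "tree_mean (low_energy \<theta> F A \<tau>) 0 Q + l * (osc \<theta> F A 0 Q)\<^sup>2 + C * (F Q)\<^sup>2
          \<le> (A Q)\<^sup>2 + l * (A Q)\<^sup>2 + C * (A Q)\<^sup>2"
        using FA[of Q] C l by (intro add_mono mult_left_mono) (auto simp: low_energy_def)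
      also have "\<dots> = (1 + l + C) * A Q * A Q" by (simp add: power2_eq_square algebra_simps)
      also have "\<dots> \<le> (1 + l + C) * (2 * \<kappa> * \<tau>) * A Q"
        using a A0[of Q] l C by (intro mult_right_mono mult_left_mono) auto
      also have "\<dots> = (2 * \<kappa> * (1 + l + C)) * (\<tau> * A Q)" by simp
      also have "\<dots> \<le> \<Gamma> * (\<tau> * A Q)" using G1 \<tau> A0[of Q] by (intro mult_right_mono) auto
      finally show ?thesis by simp
    qed
    have H: "tree_mean (low_energy \<theta> F A \<tau>) 0 Q \<le> \<Gamma> * \<tau>\<^sup>2"
    proof (cases "A Q \<le> \<tau>")
      case True
      then show ?thesis using L[of Q] from_L[of Q] \<tau>\<kappa> l by (smt (verit) mult_nonneg_nonneg zero_le_power2)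
    next
      case False
      then show ?thesis using Gpos by (simp add: low_energy_def)
    qed
    show ?case using L H by blast
  next
    case (Suc h)
    let ?X = "tree_mean (low_energy \<theta> F A \<tau>)" and ?b = "osc \<theta> F A"
    have mX: "child_mean (?X h) Q \<le> \<Gamma> * \<tau>\<^sup>2" for Q
    proof -
      have "child_mean (?X h) Q \<le> child_mean (\<lambda>_. \<Gamma> * \<tau>\<^sup>2) Q" using Suc by (intro child_mean_mono) blast
      then show ?thesis by simp
    qed
    have L: "?X (Suc h) Q + l * (?b (Suc h) Q)\<^sup>2 \<le> \<Gamma> * \<tau> * A Q - C * (F Q)\<^sup>2"
      if a: "A Q \<le> 2 * \<kappa> * \<tau>" for Q
    proof (cases "A Q \<le> 2 * \<tau>")
      case False
      then have "\<not> A Q \<le> \<tau>" using \<tau> by linarith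
      then have "?X (Suc h) Q \<le> \<Gamma> * \<tau>\<^sup>2" using mX by (simp add: low_energy_def)
      moreover have "(?b (Suc h) Q)\<^sup>2 \<le> (2 / (1 - \<theta>) * (2 * \<kappa> * \<tau>))\<^sup>2"
        using osc_le[of "Suc h" Q] osc_nonneg[of "Suc h" Q] a \<theta>
        by (intro power_mono order.trans[OF osc_le] mult_left_mono) auto
      then have "l * (?b (Suc h) Q)\<^sup>2 \<le> l * (2 / (1 - \<theta>) * (2 * \<kappa> * \<tau>))\<^sup>2"
        using l by (intro mult_left_mono) auto
      moreover have "l * (2 / (1 - \<theta>) * (2 * \<kappa> * \<tau>))\<^sup>2 = 16 * l * \<kappa>\<^sup>2 / (1 - \<theta>)\<^sup>2 * \<tau>\<^sup>2"
        by (simp add: power_mult_distrib power_divide)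
      moreover have "(F Q)\<^sup>2 \<le> (2 * \<kappa> * \<tau>)\<^sup>2" using FA[of Q] power_mono[OF a A0, of 2] by linarith
      then have "C * (F Q)\<^sup>2 \<le> C * (2 * \<kappa> * \<tau>)\<^sup>2" using C by (intro mult_left_mono) auto
      moreover have "C * (2 * \<kappa> * \<tau>)\<^sup>2 = 4 * C * \<kappa>\<^sup>2 * \<tau>\<^sup>2" by (simp add: power_mult_distrib)
      moreover have "(16 * l * \<kappa>\<^sup>2 / (1 - \<theta>)\<^sup>2 + 4 * C * \<kappa>\<^sup>2) * \<tau>\<^sup>2 \<le> \<Gamma> * \<tau>\<^sup>2"
        using G2 by (intro mult_right_mono) auto
      then have "16 * l * \<kappa>\<^sup>2 / (1 - \<theta>)\<^sup>2 * \<tau>\<^sup>2 + 4 * C * \<kappa>\<^sup>2 * \<tau>\<^sup>2 \<le> \<Gamma> * \<tau>\<^sup>2"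
        by (simp add: distrib_right)
      moreover have "\<Gamma> * \<tau> * (2 * \<tau>) \<le> \<Gamma> * \<tau> * A Q" using False Gpos \<tau> by (intro mult_left_mono) auto
      then have "2 * (\<Gamma> * \<tau>\<^sup>2) \<le> \<Gamma> * \<tau> * A Q" by (simp add: power2_eq_square mult_ac)
      ultimately show ?thesis by linarith
    next
      case True
      let ?e = "child_mean (\<lambda>R. \<bar>F R - F Q\<bar>) Q" and ?y = "child_mean (?b h) Q"
      have kids: "A (child Q s) \<le> 2 * \<kappa> * \<tau>" for s
      proof -
        have "A (child Q s) \<le> \<kappa> * A Q" using child_le_child_mean[of A Q s] A0 A_mean[of Q] by (simp add: \<kappa>_def)
        also have "\<dots> \<le> \<kappa> * (2 * \<tau>)" using True \<kappa> by (intro mult_left_mono) auto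
        finally show ?thesis by simp
      qed
      \<comment> \<open>Convexity of the square with weights \<open>1 - \<theta>\<close> and
        \<open>\<theta>\<close>, at the points \<open>?e / (1 - \<theta>)\<close> and
        \<open>?y\<close>.\<close>
      have conv: "(?e + \<theta> * ?y)\<^sup>2 \<le> ?e\<^sup>2 / (1 - \<theta>) + \<theta> * ?y\<^sup>2"
      proof -
        have "?e\<^sup>2 / (1 - \<theta>) + \<theta> * ?y\<^sup>2 - (?e + \<theta> * ?y)\<^sup>2 = \<theta> * (?e - (1 - \<theta>) * ?y)\<^sup>2 / (1 - \<theta>)"
          using \<theta> by (simp add: field_simps power2_eq_square)
        moreover have "0 \<le> \<theta> * (?e - (1 - \<theta>) * ?y)\<^sup>2 / (1 - \<theta>)" using \<theta> by simp
        ultimately show ?thesis by linarith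
      qed
      have "?b (Suc h) Q ^ 2 \<le> ?e\<^sup>2 / (1 - \<theta>) + \<theta> * child_mean (\<lambda>R. (?b h R)\<^sup>2) Q"
        using conv mult_left_mono[OF child_mean_square[of "?b h" Q], of \<theta>] \<theta> unfolding osc.simps by linarith
      then have "(1 + l) * (?b (Suc h) Q)\<^sup>2 \<le> (1 + l) * (?e\<^sup>2 / (1 - \<theta>) + \<theta> * child_mean (\<lambda>R. (?b h R)\<^sup>2) Q)"
        using l by (intro mult_left_mono) auto
      also have "\<dots> = C * ?e\<^sup>2 + l * child_mean (\<lambda>R. (?b h R)\<^sup>2) Q"
        unfolding l1 unfolding l_def C_def by (simp add: add_divide_distrib power2_eq_square)
      finally have 1: "(1 + l) * (?b (Suc h) Q)\<^sup>2 \<le> C * ?e\<^sup>2 + l * child_mean (\<lambda>R. (?b h R)\<^sup>2) Q" .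
      have "?X (Suc h) Q \<le> (?b (Suc h) Q)\<^sup>2 + child_mean (?X h) Q"
        by (simp add: low_energy_def)
      then have "?X (Suc h) Q + l * (?b (Suc h) Q)\<^sup>2
          \<le> C * ?e\<^sup>2 + (child_mean (?X h) Q + l * child_mean (\<lambda>R. (?b h R)\<^sup>2) Q)"
        using 1 unfolding distrib_right by linarith
      also have "child_mean (?X h) Q + l * child_mean (\<lambda>R. (?b h R)\<^sup>2) Q
          = child_mean (\<lambda>R. ?X h R + l * (?b h R)\<^sup>2) Q"
        by (simp add: child_mean_add child_mean_cmult)
      also have "\<dots> \<le> child_mean (\<lambda>R. \<Gamma> * \<tau> * A R - C * (F R)\<^sup>2) Q"
        using Suc kids by (intro child_mean_mono) blast
      also have "\<dots> = \<Gamma> * \<tau> * A Q - C * child_mean (\<lambda>R. (F R)\<^sup>2) Q"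
        unfolding child_mean_diff child_mean_cmult using A_mean[of Q] by simp
      also have "C * ?e\<^sup>2 + \<dots> \<le> \<Gamma> * \<tau> * A Q - C * (F Q)\<^sup>2"
        using mult_left_mono[OF mean_osc_square[of Q], of C] C by (simp add: right_diff_distrib)
      finally show ?thesis by simp
    qed
    have H: "?X (Suc h) Q \<le> \<Gamma> * \<tau>\<^sup>2"
    proof (cases "A Q \<le> \<tau>")
      case True
      then show ?thesis using L[of Q] from_L[of Q] \<tau>\<kappa> l by (smt (verit) mult_nonneg_nonneg zero_le_power2)
    next
      case False
      then show ?thesis using mX by (simp add: low_energy_def)
    qed
    show ?case using L H by blast
  qed
qed

end

text \<open>The sum of the two lower bounds demanded of \<open>\<Gamma>\<close> in
  \<open>low_energy_aux\<close>; both are nonnegative, so it meets both.\<close>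

definition energy_const :: "nat \<Rightarrow> real \<Rightarrow> real" where
  "energy_const n \<theta> = 2 * 2 ^ n * (1 + \<theta> / (1 - \<theta>) + 1 / (1 - \<theta>)\<^sup>2)
     + (16 * (\<theta> / (1 - \<theta>)) * (2 ^ n)\<^sup>2 / (1 - \<theta>)\<^sup>2 + 4 * (1 / (1 - \<theta>)\<^sup>2) * (2 ^ n)\<^sup>2)"

lemma energy_const_ge_1:
  assumes "0 < \<theta>" "\<theta> < 1"
  shows "1 \<le> energy_const n \<theta>"
proof -
  have "1 * 1 * 1 \<le> 2 * 2 ^ n * (1 + \<theta> / (1 - \<theta>) + 1 / (1 - \<theta>)\<^sup>2)"
    using assms one_le_power[of "2::real" n] by (intro mult_mono) (auto intro!: add_nonneg_nonneg add_increasing2)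
  then show ?thesis unfolding energy_const_def using assms by (smt (verit) divide_nonneg_nonneg mult_nonneg_nonneg zero_le_power2)
qed

lemma low_energy_le:
  fixes F A :: "'n::finite node \<Rightarrow> real"
  assumes "\<And>Q. F Q = child_mean F Q" "\<And>Q. A Q = child_mean A Q" "\<And>Q. \<bar>F Q\<bar> \<le> A Q"
    and \<theta>: "0 < \<theta>" "\<theta> < 1" and \<tau>: "0 < \<tau>"
  shows "tree_mean (low_energy \<theta> F A \<tau>) h Q \<le> energy_const CARD('n) \<theta> * \<tau>\<^sup>2"
proof -
  have "0 \<le> 2 * 2 ^ CARD('n) * (1 + \<theta> / (1 - \<theta>) + 1 / (1 - \<theta>)\<^sup>2)"
    "0 \<le> 16 * (\<theta> / (1 - \<theta>)) * (2 ^ CARD('n))\<^sup>2 / (1 - \<theta>)\<^sup>2 + 4 * (1 / (1 - \<theta>)\<^sup>2) * (2 ^ CARD('n))\<^sup>2"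
    using \<theta> by auto
  then show ?thesis
    using low_energy_aux[OF assms(1-5) \<tau>, where \<Gamma>="energy_const CARD('n) \<theta>" and h=h and Q=Q]
    by (simp add: energy_const_def)
qed

section \<open>Dyadic cubes and pairings with Hoelder functions\<close>

text \<open>Half-open, so that the children partition their parent pointwise and no null sets have
  to be discarded in the recursions.\<close>

definition cube :: "'n::finite node \<Rightarrow> (real^'n) set" where
  "cube Q = {x. \<forall>i. corner Q $ i \<le> x $ i \<and> x $ i < corner Q $ i + side Q}"

lemma side_child [simp]: "side (child Q s) = side Q / 2"
  by (simp add: child_def)

lemma cube_child_iff:
  "x \<in> cube (child Q s) \<longleftrightarrow> x \<in> cube Q \<and> s = {i. corner Q $ i + side Q / 2 \<le> x $ i}"
proof -
  have *: "(corner Q $ i + (if i \<in> s then side Q / 2 else 0) \<le> x $ i \<and>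
      x $ i < corner Q $ i + (if i \<in> s then side Q / 2 else 0) + side Q / 2) \<longleftrightarrow>
    (corner Q $ i \<le> x $ i \<and> x $ i < corner Q $ i + side Q) \<and> (i \<in> s \<longleftrightarrow> corner Q $ i + side Q / 2 \<le> x $ i)" for i
    by (cases "i \<in> s") auto
  show ?thesis unfolding cube_def child_def mem_Collect_eq node.sel vec_lambda_beta *
    by (auto simp: set_eq_iff)
qed

lemma indicator_cube:
  "(indicator (cube Q) x :: 'b::semiring_1) = (\<Sum>s\<in>UNIV. indicator (cube (child Q s)) x)"
proof -
  let ?s = "{i. corner Q $ i + side Q / 2 \<le> x $ i}"
  have "(\<Sum>s\<in>UNIV. indicator (cube (child Q s)) x :: 'b)
      = (\<Sum>s\<in>UNIV. if s = ?s then indicator (cube Q) x else 0)"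
    by (intro sum.cong refl) (auto simp: indicator_def cube_child_iff)
  then show ?thesis by simp
qed

lemma cube_empty: "side Q \<le> 0 \<Longrightarrow> cube Q = {}"
  by (force simp: cube_def)

lemma cube_child_subset: "cube (child Q s) \<subseteq> cube Q"
  by (auto simp: cube_child_iff)

abbreviation closed_cube :: "'n::finite node \<Rightarrow> (real^'n) set" where
  "closed_cube Q \<equiv> cbox (corner Q) (\<chi> i. corner Q $ i + side Q)"

lemma cube_subset_cbox: "cube Q \<subseteq> closed_cube Q"
  using less_imp_le by (fastforce simp: cube_def mem_box_cart)

lemma box_subset_cube: "box (corner Q) (\<chi> i. corner Q $ i + side Q) \<subseteq> cube Q"
  by (auto simp: cube_def mem_box_cart intro: less_imp_le)

lemma cube_borel [measurable]: "cube Q \<in> sets borel"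
  unfolding cube_def by measurable

lemma cube_lebesgue [measurable]: "cube Q \<in> sets lebesgue"
  using cube_borel by (simp add: sets_completionI_sets)

lemma sets_cube_Collect:
  assumes [measurable]: "Measurable.pred lebesgue P"
  shows "{x \<in> cube Q. P x} \<in> sets lebesgue"
proof -
  have "{x \<in> cube Q. P x} = cube Q \<inter> {x \<in> space lebesgue. P x}" by auto
  also have "\<dots> \<in> sets lebesgue" by measurable
  finally show ?thesis .
qed

lemma emeasure_cbox_side:
  fixes Q :: "'n::finite node"
  assumes "0 \<le> side Q"
  shows "emeasure lborel (closed_cube Q) = ennreal (side Q ^ CARD('n))"
    and "emeasure lborel (box (corner Q) (\<chi> i. corner Q $ i + side Q)) = ennreal (side Q ^ CARD('n))"
proof -
  have "(\<Prod>b\<in>(Basis :: (real^'n) set). ((\<chi> i. corner Q $ i + side Q) - corner Q) \<bullet> b) = side Q ^ CARD('n)"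
  proof -
    have "(\<Prod>b\<in>(Basis :: (real^'n) set). ((\<chi> i. corner Q $ i + side Q) - corner Q) \<bullet> b)
        = (\<Prod>b\<in>(Basis :: (real^'n) set). side Q)"
      by (intro prod.cong refl) (auto simp: Basis_vec_def inner_axis)
    then show ?thesis by simp
  qed
  moreover have "\<And>b. b \<in> (Basis :: (real^'n) set) \<Longrightarrow> corner Q \<bullet> b \<le> (\<chi> i. corner Q $ i + side Q) \<bullet> b"
    using assms by (auto simp: Basis_vec_def inner_axis)
  ultimately show "emeasure lborel (closed_cube Q) = ennreal (side Q ^ CARD('n))"
    "emeasure lborel (box (corner Q) (\<chi> i. corner Q $ i + side Q)) = ennreal (side Q ^ CARD('n))"
    by (simp_all add: emeasure_lborel_cbox emeasure_lborel_box)
qed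

lemma emeasure_cube [simp]:
  fixes Q :: "'n::finite node"
  assumes "0 \<le> side Q"
  shows "emeasure lebesgue (cube Q) = ennreal (side Q ^ CARD('n))"
proof -
  have "emeasure lborel (cube Q) = ennreal (side Q ^ CARD('n))"
    using emeasure_mono[OF cube_subset_cbox[of Q], of lborel] emeasure_mono[OF box_subset_cube[of Q], of lborel]
      emeasure_cbox_side[OF assms] by simp
  then show ?thesis by simp
qed

abbreviation cube_integral :: "(real^'n \<Rightarrow> real) \<Rightarrow> 'n::finite node \<Rightarrow> real" where
  "cube_integral f Q \<equiv> \<integral>x. indicator (cube Q) x * f x \<partial>lebesgue"

lemma integrable_indicator_cube:
  fixes Q :: "'n::finite node"
  shows "0 \<le> side Q \<Longrightarrow> integrable lebesgue (indicator (cube Q) :: _ \<Rightarrow> real)"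
  by (intro integrable_real_indicator) (simp_all del: emeasure_completion)

lemma measure_cube:
  fixes Q :: "'n::finite node"
  shows "0 \<le> side Q \<Longrightarrow> measure lebesgue (cube Q) = side Q ^ CARD('n)"
  unfolding measure_def by (simp del: emeasure_completion)

lemma ennreal_mult_assoc: "0 \<le> r \<Longrightarrow> ennreal r * (ennreal t * x) = ennreal (r * t) * x"
  by (simp add: ennreal_mult' mult.assoc)

section \<open>Additivity over children and the martingale of averages\<close>

lemma nn_integral_cube_child:
  assumes [measurable]: "g \<in> borel_measurable N" and "\<And>Q. cube Q \<in> sets N"
  shows "(\<integral>\<^sup>+x\<in>cube Q. g x \<partial>N) = (\<Sum>s\<in>UNIV. \<integral>\<^sup>+x\<in>cube (child Q s). g x \<partial>N)"
proof -
  have [measurable]: "cube Q \<in> sets N" for Q using assms(2) .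
  have "(\<lambda>x. g x * indicator (cube Q) x) = (\<lambda>x. \<Sum>s\<in>UNIV. g x * indicator (cube (child Q s)) x)"
    by (rule ext, subst indicator_cube) (rule sum_distrib_left)
  then show ?thesis by (simp only:) (rule nn_integral_sum, measurable)
qed

lemma emeasure_cube_child:
  assumes "\<And>Q. cube Q \<in> sets N"
  shows "emeasure N (cube Q) = (\<Sum>s\<in>UNIV. emeasure N (cube (child Q s)))"
  using nn_integral_cube_child[of "\<lambda>_. 1" N Q] assms by simp

lemma integral_abs_le:
  fixes f g :: "'a \<Rightarrow> real"
  assumes "integrable M f" "integrable M g" "\<And>x. \<bar>f x\<bar> \<le> g x"
  shows "\<bar>\<integral>x. f x \<partial>M\<bar> \<le> (\<integral>x. g x \<partial>M)"
  using assms by (intro order.trans[OF integral_abs_bound Bochner_Integration.integral_mono]) auto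

lemma integrable_cube:
  fixes f :: "real^'n \<Rightarrow> real"
  shows "integrable lebesgue f \<Longrightarrow> integrable lebesgue (\<lambda>x. indicator (cube Q) x * f x)"
  using integrable_mult_indicator[OF cube_lebesgue, of f Q] by simp

definition cube_avg :: "(real^'n \<Rightarrow> real) \<Rightarrow> 'n::finite node \<Rightarrow> real" where
  "cube_avg f Q = cube_integral f Q / side Q ^ CARD('n)"

lemma integral_cube_child:
  fixes f :: "real^'n \<Rightarrow> real"
  assumes "\<And>s. integrable lebesgue (\<lambda>x. indicator (cube (child Q s)) x * f x)"
  shows "cube_integral f Q = (\<Sum>s\<in>UNIV. cube_integral f (child Q s))"
proof -
  have "(\<lambda>x. indicator (cube Q) x * f x) = (\<lambda>x. \<Sum>s\<in>UNIV. indicator (cube (child Q s)) x * f x)"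
    by (rule ext, subst indicator_cube) (rule sum_distrib_right)
  then show ?thesis using assms by (simp only:) (rule Bochner_Integration.integral_sum)
qed

text \<open>The martingale property. The tree estimates ask for it at every node; where the side is
  not positive the cubes are empty and both sides are 0.\<close>

lemma cube_avg_child:
  fixes f :: "real^'n \<Rightarrow> real"
  assumes "integrable lebesgue f"
  shows "cube_avg f Q = child_mean (cube_avg f) Q"
  unfolding cube_avg_def child_mean_def
  by (subst integral_cube_child) (auto simp: integrable_cube[OF assms] sum_divide_distrib power_divide)

lemma cube_avg_abs: "\<bar>cube_avg f Q\<bar> \<le> cube_avg (\<lambda>x. \<bar>f x\<bar>) Q"
proof (cases "0 \<le> side Q")
  case True
  have "\<bar>cube_integral f Q\<bar> \<le> (\<integral>x. \<bar>indicator (cube Q) x * f x\<bar> \<partial>lebesgue)"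
    by (rule integral_abs_bound)
  then show ?thesis using True by (simp add: cube_avg_def abs_mult divide_right_mono)
qed (simp add: cube_empty cube_avg_def)

lemma dist_cube:
  fixes x y :: "real^'n"
  assumes "x \<in> cube Q" "y \<in> cube Q"
  shows "norm (x - y) \<le> sqrt CARD('n) * side Q"
proof -
  have "norm (x - y) \<le> sqrt (\<Sum>i\<in>(UNIV::'n set). (side Q)\<^sup>2)"
    unfolding norm_vec_def L2_set_def
  proof (intro real_sqrt_le_mono sum_mono)
    fix i
    have "corner Q $ i \<le> x $ i \<and> x $ i < corner Q $ i + side Q" "corner Q $ i \<le> y $ i \<and> y $ i < corner Q $ i + side Q"
      using assms by (auto simp: cube_def)
    then have "\<bar>(x - y) $ i\<bar> \<le> side Q" by auto
    then show "(norm ((x - y) $ i))\<^sup>2 \<le> (side Q)\<^sup>2" by (intro power_mono) auto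
  qed
  moreover have "0 \<le> side Q"
  proof -
    fix i :: 'n
    have "corner Q $ i \<le> x $ i \<and> x $ i < corner Q $ i + side Q" using assms by (auto simp: cube_def)
    then show ?thesis by linarith
  qed
  ultimately show ?thesis by (simp add: real_sqrt_mult)
qed

lemma cube_nonempty: "0 < side Q \<Longrightarrow> corner Q \<in> cube Q"
  by (simp add: cube_def)

lemma integrable_cube_bounded:
  fixes \<phi> :: "real^'n \<Rightarrow> real"
  assumes [measurable]: "\<phi> \<in> borel_measurable lebesgue" and "0 < side Q"
    and "\<And>x. x \<in> cube Q \<Longrightarrow> \<bar>\<phi> x\<bar> \<le> B"
  shows "integrable lebesgue (\<lambda>x. indicator (cube Q) x * \<phi> x)"
proof (rule Bochner_Integration.integrable_bound)
  show "integrable lebesgue (\<lambda>x. B * indicator (cube Q) x)"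
    using assms(2) by (intro integrable_mult_right integrable_indicator_cube) auto
  show "AE x in lebesgue. norm (indicator (cube Q) x * \<phi> x) \<le> norm (B * indicator (cube Q) x)"
    using assms(3) by (intro always_eventually) (auto simp: indicator_def intro: order.trans[OF _ abs_ge_self])
qed measurable

lemma integral_cube_near_const:
  fixes \<phi> :: "real^'n \<Rightarrow> real"
  assumes "integrable lebesgue (\<lambda>x. indicator (cube Q) x * \<phi> x)" and "0 < side Q"
    and "\<And>x. x \<in> cube Q \<Longrightarrow> \<bar>\<phi> x - c\<bar> \<le> B"
  shows "\<bar>cube_integral \<phi> Q - side Q ^ CARD('n) * c\<bar> \<le> B * side Q ^ CARD('n)"
proof -
  have i: "integrable lebesgue (indicator (cube Q) :: _ \<Rightarrow> real)"
    using assms(2) by (intro integrable_indicator_cube) auto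
  have m: "measure lebesgue (cube Q) = side Q ^ CARD('n)"
    using assms(2) by (intro measure_cube) auto
  have "cube_integral \<phi> Q - side Q ^ CARD('n) * c
      = (\<integral>x. indicator (cube Q) x * \<phi> x - c * indicator (cube Q) x \<partial>lebesgue)"
    using assms(1) i m by (subst Bochner_Integration.integral_diff) auto
  also have "\<bar>\<dots>\<bar> \<le> (\<integral>x. B * indicator (cube Q) x \<partial>lebesgue)"
  proof (rule integral_abs_le)
    show "integrable lebesgue (\<lambda>x. indicator (cube Q) x * \<phi> x - c * indicator (cube Q) x)"
      using assms(1) i by (intro Bochner_Integration.integrable_diff) auto
    show "integrable lebesgue (\<lambda>x. B * indicator (cube Q) x)" using i by auto
  qed (use assms(3) in \<open>auto simp: indicator_def\<close>)
  also have "\<dots> = B * side Q ^ CARD('n)" using m by simp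
  finally show ?thesis .
qed

text \<open>Induction over generations. The defect of \<open>Q\<close> is the sum of the defects of
  its children plus the products of \<open>cube_avg f (child Q s) - cube_avg f Q\<close> with the
  integral of \<open>\<phi>\<close> over the child. From that integral its expected value
  \<open>v * c\<close> may be subtracted, since the deviations of the averages sum to 0; Hoelder
  continuity then bounds the rest by \<open>D Q * v\<close>. Halving the side turns \<open>D\<close>
  into \<open>2 powr - \<alpha> * D\<close>, which is the damping factor of
  \<open>osc\<close>.\<close>

lemma osc_controls_pairing:
  fixes f \<phi> :: "real^'n \<Rightarrow> real"
  assumes f: "integrable lebesgue f" and \<phi>[measurable]: "\<phi> \<in> borel_measurable lebesgue"
    and \<alpha>: "0 < \<alpha>" and H: "0 \<le> H"
    and hol: "\<And>x y. \<bar>\<phi> x - \<phi> y\<bar> \<le> H * norm (x - y) powr \<alpha>"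
    and Q: "0 < side Q"
  shows "\<bar>cube_integral (\<lambda>x. f x * \<phi> x) Q - cube_avg f Q * cube_integral \<phi> Q\<bar>
     \<le> H * (sqrt CARD('n) * side Q) powr \<alpha> * side Q ^ CARD('n)
         * osc (2 powr - \<alpha>) (cube_avg f) (cube_avg (\<lambda>x. \<bar>f x\<bar>)) h Q"
proof -
  define I where "I Q = cube_integral (\<lambda>x. f x * \<phi> x) Q" for Q
  define J where "J Q = cube_integral \<phi> Q" for Q
  define D where "D Q = H * (sqrt CARD('n) * side Q) powr \<alpha>" for Q :: "'n node"
  have D0: "0 \<le> D Q" for Q using H by (simp add: D_def)
  have hol_Q: "\<bar>\<phi> x - \<phi> y\<bar> \<le> D Q" if "x \<in> cube Q" "y \<in> cube Q" for x y Q
  proof -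
    have "norm (x - y) powr \<alpha> \<le> (sqrt CARD('n) * side Q) powr \<alpha>"
      using dist_cube[OF that] \<alpha> by (intro powr_mono2) auto
    then show ?thesis using hol[of x y] H by (auto simp: D_def intro: order.trans mult_left_mono)
  qed
  have bdd: "\<bar>\<phi> x\<bar> \<le> D Q + \<bar>\<phi> (corner Q)\<bar>" if "x \<in> cube Q" "0 < side Q" for x Q
    using hol_Q[OF that(1) cube_nonempty[OF that(2)]] by linarith
  have iJ: "integrable lebesgue (\<lambda>x. indicator (cube Q) x * \<phi> x)" if "0 < side Q" for Q
    using bdd that by (intro integrable_cube_bounded) auto
  have iI: "integrable lebesgue (\<lambda>x. indicator (cube Q) x * (f x * \<phi> x))" if "0 < side Q" for Q
  proof (rule Bochner_Integration.integrable_bound)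
    show "integrable lebesgue (\<lambda>x. (D Q + \<bar>\<phi> (corner Q)\<bar>) * \<bar>f x\<bar>)" using f by simp
    show "(\<lambda>x. indicator (cube Q) x * (f x * \<phi> x)) \<in> borel_measurable lebesgue"
      using f by measurable
    show "AE x in lebesgue. norm (indicator (cube Q) x * (f x * \<phi> x)) \<le> norm ((D Q + \<bar>\<phi> (corner Q)\<bar>) * \<bar>f x\<bar>)"
    proof (rule always_eventually, rule allI)
      fix x
      show "norm (indicator (cube Q) x * (f x * \<phi> x)) \<le> norm ((D Q + \<bar>\<phi> (corner Q)\<bar>) * \<bar>f x\<bar>)"
        using bdd[of x Q] that D0[of Q] mult_right_mono[of "\<bar>\<phi> x\<bar>" "D Q + \<bar>\<phi> (corner Q)\<bar>" "\<bar>f x\<bar>"]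
        by (auto simp: indicator_def abs_mult mult_ac)
    qed
  qed
  have Javg: "\<bar>\<phi> y - J Q / side Q ^ CARD('n)\<bar> \<le> D Q" if "0 < side Q" "y \<in> cube Q" for y Q
  proof -
    have "\<bar>J Q - side Q ^ CARD('n) * \<phi> y\<bar> \<le> D Q * side Q ^ CARD('n)"
      unfolding J_def using iJ that hol_Q by (intro integral_cube_near_const) auto
    then have "\<bar>J Q - side Q ^ CARD('n) * \<phi> y\<bar> / side Q ^ CARD('n) \<le> D Q"
      using that by (simp add: field_simps)
    moreover have "\<bar>J Q - side Q ^ CARD('n) * \<phi> y\<bar> / side Q ^ CARD('n) = \<bar>J Q / side Q ^ CARD('n) - \<phi> y\<bar>"
      proof -
      have "\<bar>J Q - side Q ^ CARD('n) * \<phi> y\<bar> / side Q ^ CARD('n) = \<bar>(J Q - side Q ^ CARD('n) * \<phi> y) / side Q ^ CARD('n)\<bar>"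
        using that by simp
      then show ?thesis using that by (simp add: diff_divide_distrib)
    qed
    ultimately show ?thesis by linarith
  qed
  let ?A = "cube_avg (\<lambda>x. \<bar>f x\<bar>)"
  let ?b = "osc (2 powr - \<alpha>) (cube_avg f) ?A"
  have "\<bar>I Q - cube_avg f Q * J Q\<bar> \<le> D Q * side Q ^ CARD('n) * ?b h Q" using Q
  proof (induction h arbitrary: Q)
    \<comment> \<open>At a leaf only \<open>\<phi>\<close> is compared with its mean, and
      \<open>f\<close> enters through \<open>|f|\<close>; hence the value \<open>A\<close> of
      \<open>osc\<close> at depth 0.\<close>
    case (0 Q)
    define c where "c = J Q / side Q ^ CARD('n)"
    have "I Q - cube_avg f Q * J Q = I Q - cube_integral f Q * c"
      by (simp add: c_def cube_avg_def)
    also have "\<dots> = (\<integral>x. indicator (cube Q) x * (f x * \<phi> x) - indicator (cube Q) x * f x * c \<partial>lebesgue)"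
      unfolding I_def using iI[OF 0] integrable_cube[OF f, of Q] by simp
    also have "\<bar>\<dots>\<bar> \<le> (\<integral>x. D Q * (indicator (cube Q) x * \<bar>f x\<bar>) \<partial>lebesgue)"
    proof (rule integral_abs_le)
      show "integrable lebesgue (\<lambda>x. D Q * (indicator (cube Q) x * \<bar>f x\<bar>))"
        using integrable_cube[of "\<lambda>x. \<bar>f x\<bar>" Q] f by simp
      fix x
      show "\<bar>indicator (cube Q) x * (f x * \<phi> x) - indicator (cube Q) x * f x * c\<bar> \<le> D Q * (indicator (cube Q) x * \<bar>f x\<bar>)"
      proof (cases "x \<in> cube Q")
        case True
        have "f x * \<phi> x - f x * c = (\<phi> x - c) * f x" by (simp add: algebra_simps)
        then have "\<bar>f x * \<phi> x - f x * c\<bar> = \<bar>\<phi> x - c\<bar> * \<bar>f x\<bar>" by (simp only: abs_mult)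
        then show ?thesis using True mult_right_mono[OF Javg[OF 0 True], of "\<bar>f x\<bar>"] by (simp add: c_def)
      qed simp
    qed (use iI[OF 0] integrable_cube[OF f, of Q] in auto)
    also have "\<dots> = D Q * side Q ^ CARD('n) * ?A Q"
      using 0 by (simp add: cube_avg_def)
    finally show ?case by simp
  next
    case (Suc h Q)
    define v where "v = side Q ^ CARD('n) / 2 ^ CARD('n)"
    define c where "c = J Q / side Q ^ CARD('n)"
    let ?f = "cube_avg f"
    have v: "0 < v" "side (child Q s) ^ CARD('n) = v" for s using Suc.prems by (auto simp: v_def power_divide)
    have pos: "0 < side (child Q s)" for s using Suc.prems by simp
    have IQ: "I Q = (\<Sum>s\<in>UNIV. I (child Q s))" and JQ: "J Q = (\<Sum>s\<in>UNIV. J (child Q s))"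
      unfolding I_def J_def using iI[OF pos] iJ[OF pos] by (auto intro: integral_cube_child)
    have zero: "(\<Sum>s\<in>UNIV. ?f (child Q s) - ?f Q) = 0"
    proof -
      have "(\<Sum>s\<in>UNIV. ?f (child Q s) - ?f Q) = 2 ^ CARD('n) * (child_mean ?f Q - child_mean (\<lambda>_. ?f Q) Q)"
        unfolding child_mean_def by (simp add: sum_subtractf diff_divide_distrib right_diff_distrib)
      then show ?thesis using cube_avg_child[OF f, of Q] by simp
    qed
    have split: "I Q - ?f Q * J Q = (\<Sum>s\<in>UNIV. I (child Q s) - ?f (child Q s) * J (child Q s))
        + (\<Sum>s\<in>UNIV. (?f (child Q s) - ?f Q) * (J (child Q s) - v * c))"
    proof -
      have "(\<Sum>s\<in>UNIV. (?f (child Q s) - ?f Q) * (J (child Q s) - v * c))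
          = (\<Sum>s\<in>UNIV. (?f (child Q s) - ?f Q) * J (child Q s)) - (\<Sum>s\<in>UNIV. ?f (child Q s) - ?f Q) * (v * c)"
        unfolding sum_distrib_right sum_subtractf[symmetric] by (simp only: right_diff_distrib)
      then show ?thesis unfolding IQ JQ zero
        by (simp add: left_diff_distrib sum_subtractf sum_distrib_left)
    qed
    have 1: "\<bar>I (child Q s) - ?f (child Q s) * J (child Q s)\<bar> \<le> D Q * v * (2 powr - \<alpha> * ?b h (child Q s))" for s
    proof -
      have "(sqrt CARD('n) * side (child Q s)) powr \<alpha> = (sqrt CARD('n) * side Q) powr \<alpha> * 2 powr - \<alpha>"
        using Suc.prems powr_divide[of "sqrt CARD('n) * side Q" 2 \<alpha>] by (simp add: powr_minus_divide)
      then have "D (child Q s) = D Q * 2 powr - \<alpha>" by (simp add: D_def)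
      then show ?thesis using Suc.IH[OF pos[of s]] v by (simp add: mult_ac)
    qed
    have 2: "\<bar>(?f (child Q s) - ?f Q) * (J (child Q s) - v * c)\<bar> \<le> D Q * v * \<bar>?f (child Q s) - ?f Q\<bar>" for s
    proof -
      have "\<bar>J (child Q s) - side (child Q s) ^ CARD('n) * c\<bar> \<le> D Q * side (child Q s) ^ CARD('n)"
        unfolding J_def using iJ[OF pos] pos[of s] Javg[OF Suc.prems] cube_child_subset[of Q s]
        by (intro integral_cube_near_const) (auto simp: c_def)
      then have "\<bar>J (child Q s) - v * c\<bar> \<le> D Q * v" unfolding v .
      from mult_right_mono[OF this abs_ge_zero[of "?f (child Q s) - ?f Q"]] show ?thesis
        by (simp add: abs_mult mult_ac)
    qed
    have "\<bar>I Q - ?f Q * J Q\<bar> \<le> (\<Sum>s\<in>UNIV. \<bar>I (child Q s) - ?f (child Q s) * J (child Q s)\<bar>)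
        + (\<Sum>s\<in>UNIV. \<bar>(?f (child Q s) - ?f Q) * (J (child Q s) - v * c)\<bar>)"
      unfolding split by (intro order.trans[OF abs_triangle_ineq] add_mono sum_abs)
    also have "\<dots> \<le> (\<Sum>s\<in>UNIV. D Q * v * (2 powr - \<alpha> * ?b h (child Q s))) + (\<Sum>s\<in>UNIV. D Q * v * \<bar>?f (child Q s) - ?f Q\<bar>)"
      using 1 2 by (intro add_mono sum_mono) auto
    also have "\<dots> = D Q * side Q ^ CARD('n) * ?b (Suc h) Q"
      by (simp only: sum_distrib_left[symmetric]) (simp add: v_def child_mean_def field_simps)
    finally show ?case .
  qed
  then show ?thesis by (simp add: I_def J_def D_def)
qed

section \<open>Sums over dyadic trees\<close>

primrec tree_sum :: "(nat \<Rightarrow> 'n::finite node \<Rightarrow> real) \<Rightarrow> nat \<Rightarrow> 'n node \<Rightarrow> real^'n \<Rightarrow> real" where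
  "tree_sum c 0 = (\<lambda>Q x. c 0 Q * indicator (cube Q) x)"
| "tree_sum c (Suc h) = (\<lambda>Q x. c (Suc h) Q * indicator (cube Q) x + (\<Sum>s\<in>UNIV. tree_sum c h (child Q s) x))"

lemma tree_sum_outside: "x \<notin> cube Q \<Longrightarrow> tree_sum c h Q x = 0"
  by (induction h arbitrary: Q) (auto simp: cube_child_iff)

lemma tree_sum_step:
  assumes x: "x \<in> cube (child Q s)"
  shows "tree_sum c (Suc h) Q x = c (Suc h) Q + tree_sum c h (child Q s) x"
proof -
  have "(\<Sum>t\<in>UNIV. tree_sum c h (child Q t) x) = (\<Sum>t\<in>{s}. tree_sum c h (child Q t) x)"
    using x by (intro sum.mono_neutral_right) (auto simp: cube_child_iff intro!: tree_sum_outside)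
  then show ?thesis using x by (simp add: cube_child_iff)
qed

lemma tree_sum_nonneg:
  assumes "\<And>h Q. 0 \<le> c h Q"
  shows "0 \<le> tree_sum c h Q x"
  using assms by (induction h arbitrary: Q) (auto intro!: add_nonneg_nonneg sum_nonneg)

lemma tree_sum_borel [measurable]: "tree_sum c h Q \<in> borel_measurable borel"
  by (induction h arbitrary: Q) (simp_all, measurable)

lemma tree_sum_measurable:
  assumes "sets N = sets lebesgue"
  shows "tree_sum c h Q \<in> borel_measurable N"
proof -
  have "tree_sum c h Q \<in> borel_measurable lebesgue"
    by (intro measurable_completion) simp
  then show ?thesis by (simp only: measurable_cong_sets[OF assms refl])
qed

lemma tree_sum_lebesgue [measurable]: "tree_sum c h Q \<in> borel_measurable lebesgue"
  by (rule tree_sum_measurable[OF refl])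

abbreviation tree_int ::
  "(real^'n) measure \<Rightarrow> (nat \<Rightarrow> 'n::finite node \<Rightarrow> real) \<Rightarrow> nat \<Rightarrow> 'n node \<Rightarrow> ennreal" where
  "tree_int N c h Q \<equiv> \<integral>\<^sup>+x\<in>cube Q. ennreal (tree_sum c h Q x) \<partial>N"

text \<open>On a child the coefficient of the parent is a constant. The free function
  \<open>G\<close> serves for powers, truncations and cutoffs alike.\<close>

lemma nn_integral_tree_sum_Suc:
  assumes c: "\<And>h Q. 0 \<le> c h Q" and N: "sets N = sets lebesgue"
    and G: "\<And>h Q. (\<lambda>x. G (tree_sum c h Q x)) \<in> borel_measurable N"
  shows "(\<integral>\<^sup>+x\<in>cube Q. G (tree_sum c (Suc h) Q x) \<partial>N)
    = (\<Sum>s\<in>UNIV. \<integral>\<^sup>+x\<in>cube (child Q s). G (c (Suc h) Q + tree_sum c h (child Q s) x) \<partial>N)"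
proof -
  have "(\<integral>\<^sup>+x\<in>cube Q. G (tree_sum c (Suc h) Q x) \<partial>N)
    = (\<Sum>s\<in>UNIV. \<integral>\<^sup>+x\<in>cube (child Q s). G (tree_sum c (Suc h) Q x) \<partial>N)"
    using G cube_lebesgue N by (intro nn_integral_cube_child) (auto simp del: tree_sum.simps)
  also have "\<dots> = (\<Sum>s\<in>UNIV. \<integral>\<^sup>+x\<in>cube (child Q s). G (c (Suc h) Q + tree_sum c h (child Q s) x) \<partial>N)"
    by (intro sum.cong refl nn_integral_cong) (auto simp: indicator_def tree_sum_step simp del: tree_sum.simps)
  finally show ?thesis .
qed

lemma nn_integral_tree_sum_linear:
  assumes c: "\<And>h Q. 0 \<le> c h Q" and N: "sets N = sets lebesgue"
  shows "tree_int N c 0 Q = ennreal (c 0 Q) * emeasure N (cube Q)"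
    and "tree_int N c (Suc h) Q = ennreal (c (Suc h) Q) * emeasure N (cube Q)
        + (\<Sum>s\<in>UNIV. tree_int N c h (child Q s))"
proof -
  have mN[measurable]: "tree_sum c h Q \<in> borel_measurable N" for h Q using N by (rule tree_sum_measurable)
  have cN[measurable]: "cube Q \<in> sets N" for Q :: "'a node" using N cube_lebesgue by simp
  show "tree_int N c 0 Q = ennreal (c 0 Q) * emeasure N (cube Q)"
    by (subst nn_integral_cmult_indicator[symmetric]) (auto intro!: nn_integral_cong simp: indicator_def)
  let ?c = "c (Suc h) Q"
  have "tree_int N c (Suc h) Q
      = (\<Sum>s\<in>UNIV. \<integral>\<^sup>+x\<in>cube (child Q s). ennreal (?c + tree_sum c h (child Q s) x) \<partial>N)"
    using c N by (rule nn_integral_tree_sum_Suc) measurable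
  also have "\<dots> = (\<Sum>s\<in>UNIV. ennreal ?c * emeasure N (cube (child Q s))
        + tree_int N c h (child Q s))"
  proof (intro sum.cong refl)
    fix s
    have "(\<integral>\<^sup>+x\<in>cube (child Q s). ennreal (?c + tree_sum c h (child Q s) x) \<partial>N)
        = (\<integral>\<^sup>+x. ennreal ?c * indicator (cube (child Q s)) x + ennreal (tree_sum c h (child Q s) x) * indicator (cube (child Q s)) x \<partial>N)"
      using c by (intro nn_integral_cong) (simp add: tree_sum_nonneg distrib_right)
    then show "(\<integral>\<^sup>+x\<in>cube (child Q s). ennreal (?c + tree_sum c h (child Q s) x) \<partial>N)
        = ennreal ?c * emeasure N (cube (child Q s)) + tree_int N c h (child Q s)"
      by (simp add: nn_integral_add nn_integral_cmult)
  qed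
  also have "\<dots> = ennreal ?c * emeasure N (cube Q)
      + (\<Sum>s\<in>UNIV. tree_int N c h (child Q s))"
    using emeasure_cube_child[of N Q] by (simp add: sum.distrib sum_distrib_left)
  finally show "tree_int N c (Suc h) Q = ennreal (c (Suc h) Q) * emeasure N (cube Q)
        + (\<Sum>s\<in>UNIV. tree_int N c h (child Q s))" .
qed

text \<open>Among the cubes containing \<open>x\<close>, those with \<open>tree_sum \<le> K\<close> at \<open>x\<close> are the smallest ones, and their
  coefficients add up to at most \<open>K\<close>.\<close>

lemma tree_sum_truncation:
  fixes K :: real
  assumes c: "\<And>h Q. 0 \<le> c h Q" and N: "sets N = sets lebesgue" and R: "sets R = sets lebesgue"
    and good_child: "\<And>P s. good P \<Longrightarrow> good (child P s)"
    and main: "\<And>h P. good P \<Longrightarrow> 0 < c h P \<Longrightarrow>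
       emeasure N (cube P) \<le> emeasure R {x \<in> cube P. tree_sum c h P x \<le> K}"
    and Q: "good Q" and K: "0 \<le> K"
  shows "tree_int N c h Q \<le> (\<integral>\<^sup>+x\<in>cube Q. ennreal (min (tree_sum c h Q x) K) \<partial>R)"
  using Q
proof (induction h arbitrary: Q)
  have mN[measurable]: "tree_sum c h Q \<in> borel_measurable N" for h Q using N by (rule tree_sum_measurable)
  have mR[measurable]: "tree_sum c h Q \<in> borel_measurable R" for h Q using R by (rule tree_sum_measurable)
  have cN[measurable]: "cube Q \<in> sets N" for Q :: "'a node" using N cube_lebesgue by simp
  have cR[measurable]: "cube Q \<in> sets R" for Q :: "'a node" using R cube_lebesgue by simp
  have setR: "{x \<in> cube P. tree_sum c h P x \<le> K} \<in> sets R" for h P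
    unfolding R by (intro sets_cube_Collect) measurable
  have main': "ennreal (c h P) * emeasure N (cube P) \<le> (\<integral>\<^sup>+x\<in>cube P. ennreal (c h P * of_bool (tree_sum c h P x \<le> K)) \<partial>R)"
    if "good P" for h P
  proof (cases "c h P = 0")
    case False
    then have "ennreal (c h P) * emeasure N (cube P) \<le> ennreal (c h P) * emeasure R {x \<in> cube P. tree_sum c h P x \<le> K}"
      using main[OF that, of h] c[of h P] by (intro mult_left_mono) auto
    also have "\<dots> = (\<integral>\<^sup>+x. ennreal (c h P) * indicator {x \<in> cube P. tree_sum c h P x \<le> K} x \<partial>R)"
      using setR by (simp add: nn_integral_cmult)
    also have "\<dots> = (\<integral>\<^sup>+x\<in>cube P. ennreal (c h P * of_bool (tree_sum c h P x \<le> K)) \<partial>R)"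
      by (intro nn_integral_cong) (auto simp: indicator_def)
    finally show ?thesis .
  qed simp
  {
    case (0 Q)
    have "tree_int N c 0 Q = ennreal (c 0 Q) * emeasure N (cube Q)"
      by (rule nn_integral_tree_sum_linear(1)[OF c N])
    also have "\<dots> \<le> (\<integral>\<^sup>+x\<in>cube Q. ennreal (c 0 Q * of_bool (tree_sum c 0 Q x \<le> K)) \<partial>R)"
      using main'[OF 0] .
    also have "\<dots> \<le> (\<integral>\<^sup>+x\<in>cube Q. ennreal (min (tree_sum c 0 Q x) K) \<partial>R)"
      using c K by (intro nn_integral_mono) (auto simp: indicator_def intro!: ennreal_leI)
    finally show ?case .
  next
    case (Suc h Q)
    let ?c = "c (Suc h) Q"
    have "tree_int N c (Suc h) Q = ennreal ?c * emeasure N (cube Q)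
        + (\<Sum>s\<in>UNIV. tree_int N c h (child Q s))"
      by (rule nn_integral_tree_sum_linear(2)[OF c N])
    also have "\<dots> \<le> (\<integral>\<^sup>+x\<in>cube Q. ennreal (?c * of_bool (tree_sum c (Suc h) Q x \<le> K)) \<partial>R)
        + (\<Sum>s\<in>UNIV. \<integral>\<^sup>+x\<in>cube (child Q s). ennreal (min (tree_sum c h (child Q s) x) K) \<partial>R)"
      by (intro add_mono sum_mono main'[OF Suc.prems] Suc.IH good_child[OF Suc.prems])
    also have "(\<integral>\<^sup>+x\<in>cube Q. ennreal (?c * of_bool (tree_sum c (Suc h) Q x \<le> K)) \<partial>R)
        = (\<Sum>s\<in>UNIV. \<integral>\<^sup>+x\<in>cube (child Q s). ennreal (?c * of_bool (?c + tree_sum c h (child Q s) x \<le> K)) \<partial>R)"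
      using c R by (rule nn_integral_tree_sum_Suc[where G="\<lambda>r. ennreal (?c * of_bool (r \<le> K))"]) measurable
    also have "\<dots> + (\<Sum>s\<in>UNIV. \<integral>\<^sup>+x\<in>cube (child Q s). ennreal (min (tree_sum c h (child Q s) x) K) \<partial>R)
        = (\<Sum>s\<in>UNIV. \<integral>\<^sup>+x. (ennreal (?c * of_bool (?c + tree_sum c h (child Q s) x \<le> K)) * indicator (cube (child Q s)) x
             + ennreal (min (tree_sum c h (child Q s) x) K) * indicator (cube (child Q s)) x) \<partial>R)"
      by (simp add: nn_integral_add sum.distrib)
    also have "\<dots> \<le> (\<Sum>s\<in>UNIV. \<integral>\<^sup>+x\<in>cube (child Q s). ennreal (min (?c + tree_sum c h (child Q s) x) K) \<partial>R)"
    proof (intro sum_mono nn_integral_mono)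
      fix s x
      have t: "0 \<le> tree_sum c h (child Q s) x" using c by (rule tree_sum_nonneg)
      \<comment> \<open>If the sum including \<open>?c\<close> exceeds \<open>K\<close>, the new
        coefficient is dropped; otherwise nothing is truncated and both sides agree.\<close>
      have "ennreal (?c * of_bool (?c + tree_sum c h (child Q s) x \<le> K)) + ennreal (min (tree_sum c h (child Q s) x) K)
         = ennreal (?c * of_bool (?c + tree_sum c h (child Q s) x \<le> K) + min (tree_sum c h (child Q s) x) K)"
        using t c K by (simp add: ennreal_plus)
      also have "\<dots> \<le> ennreal (min (?c + tree_sum c h (child Q s) x) K)"
        using t c[of "Suc h" Q] K by (intro ennreal_leI) (auto simp: min_def)
      finally show "ennreal (?c * of_bool (?c + tree_sum c h (child Q s) x \<le> K)) * indicator (cube (child Q s)) x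
             + ennreal (min (tree_sum c h (child Q s) x) K) * indicator (cube (child Q s)) x
          \<le> ennreal (min (?c + tree_sum c h (child Q s) x) K) * indicator (cube (child Q s)) x"
        by (auto simp: indicator_def)
    qed
    also have "\<dots> = (\<integral>\<^sup>+x\<in>cube Q. ennreal (min (tree_sum c (Suc h) Q x) K) \<partial>R)"
      using c R by (rule nn_integral_tree_sum_Suc[where G="\<lambda>r. ennreal (min r K)", symmetric]) measurable
    finally show ?case .
  }
qed

text \<open>In the applications \<open>N\<close> is the weight and \<open>R\<close> a testing
  measure: if the part of each cube with small sum carries enough \<open>R\<close>-mass, the
  coefficients obey a Carleson estimate of \<open>N\<close> against \<open>R\<close>.\<close>

lemma tree_sum_embedding:
  fixes K :: real
  assumes c: "\<And>h Q. 0 \<le> c h Q" and N: "sets N = sets lebesgue" and R: "sets R = sets lebesgue"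
    and good_child: "\<And>P s. good P \<Longrightarrow> good (child P s)"
    and main: "\<And>h P. good P \<Longrightarrow> 0 < c h P \<Longrightarrow>
       emeasure N (cube P) \<le> emeasure R {x \<in> cube P. tree_sum c h P x \<le> K}"
    and Q: "good Q" and K: "0 \<le> K"
  shows "tree_int N c h Q \<le> ennreal K * emeasure R (cube Q)"
proof -
  have cR: "cube Q \<in> sets R" using R cube_lebesgue by simp
  have "tree_int N c h Q \<le> (\<integral>\<^sup>+x\<in>cube Q. ennreal (min (tree_sum c h Q x) K) \<partial>R)"
    using assms by (rule tree_sum_truncation)
  also have "\<dots> \<le> (\<integral>\<^sup>+x\<in>cube Q. ennreal K \<partial>R)"
    by (intro nn_integral_mono mult_right_mono ennreal_leI) auto
  also have "\<dots> = ennreal K * emeasure R (cube Q)" using cR by (simp add: nn_integral_cmult_indicator)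
  finally show ?thesis .
qed

text \<open>A John-Nirenberg type bound. In the power of a sum along a path, each coefficient meets
  a lower power of the sum over smaller cubes, which the previous moment and the Carleson condition
  bound by a constant times the mass of the cube. So each further moment costs a factor
  \<open>L\<close> and a factor from the factorial. One first moment is kept on the right, since it
  is the one that is later compared with the integral of \<open>|f|^p w\<close>.\<close>

lemma tree_sum_moment:
  assumes c: "\<And>h Q. 0 \<le> c h Q" and N: "sets N = sets lebesgue"
    and L: "0 \<le> L"
    and car: "\<And>h P. tree_int N c h P \<le> ennreal L * emeasure N (cube P)"
  shows "(\<integral>\<^sup>+x\<in>cube Q. ennreal (tree_sum c h Q x ^ Suc M) \<partial>N)
     \<le> ennreal (fact (Suc M) * L ^ M) * tree_int N c h Q"
proof (induction M arbitrary: h Q)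
  case 0
  then show ?case by simp
next
  case (Suc M)
  note IHM = Suc
  have mN[measurable]: "tree_sum c h Q \<in> borel_measurable N" for h Q using N by (rule tree_sum_measurable)
  have cN[measurable]: "cube Q \<in> sets N" for Q :: "'a node" using N cube_lebesgue by simp
  let ?F = "fact (Suc (Suc M)) * L ^ Suc M"
  have tn: "0 \<le> tree_sum c h Q x" for h Q x using c by (rule tree_sum_nonneg)
  have low: "ennreal (c h Q) * ennreal (Suc (Suc M)) * (\<integral>\<^sup>+x\<in>cube Q. ennreal (tree_sum c h Q x ^ Suc M) \<partial>N)
      \<le> ennreal ?F * (ennreal (c h Q) * emeasure N (cube Q))" for h Q
  proof -
    have "(\<integral>\<^sup>+x\<in>cube Q. ennreal (tree_sum c h Q x ^ Suc M) \<partial>N)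
        \<le> ennreal (fact (Suc M) * L ^ M) * (ennreal L * emeasure N (cube Q))"
      by (rule order.trans[OF IHM]) (intro mult_left_mono car zero_le)
    then have "ennreal (c h Q) * ennreal (Suc (Suc M)) * (\<integral>\<^sup>+x\<in>cube Q. ennreal (tree_sum c h Q x ^ Suc M) \<partial>N)
        \<le> ennreal (c h Q) * ennreal (Suc (Suc M)) * (ennreal (fact (Suc M) * L ^ M) * (ennreal L * emeasure N (cube Q)))"
      by (intro mult_left_mono zero_le)
    also have "\<dots> = (ennreal (Suc (Suc M)) * ennreal (fact (Suc M) * L ^ M) * ennreal L) * (ennreal (c h Q) * emeasure N (cube Q))"
      by (simp only: mult_ac)
    also have "ennreal (Suc (Suc M)) * ennreal (fact (Suc M) * L ^ M) * ennreal L = ennreal ?F"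
    proof -
      have "ennreal (Suc (Suc M)) * ennreal (fact (Suc M) * L ^ M) * ennreal L
          = ennreal (real (Suc (Suc M)) * (fact (Suc M) * L ^ M) * L)"
      proof -
        have n1: "0 \<le> fact (Suc M) * L ^ M" using L by simp
        show ?thesis
          unfolding ennreal_mult[OF mult_nonneg_nonneg[OF of_nat_0_le_iff n1] L] ennreal_mult[OF of_nat_0_le_iff n1] ..
      qed
      also have "real (Suc (Suc M)) * (fact (Suc M) * L ^ M) * L = ?F"
        by (simp only: fact_Suc[of "Suc M"] power_Suc) simp
      finally show ?thesis .
    qed
    finally show ?thesis .
  qed
  show ?case
  proof (induction h arbitrary: Q)
    case (0 Q)
    have "(\<integral>\<^sup>+x\<in>cube Q. ennreal (tree_sum c 0 Q x ^ Suc (Suc M)) \<partial>N)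
        = ennreal (c 0 Q) * (\<integral>\<^sup>+x\<in>cube Q. ennreal (tree_sum c 0 Q x ^ Suc M) \<partial>N)"
      using c by (subst nn_integral_cmult[symmetric]) (auto intro!: nn_integral_cong simp: indicator_def ennreal_mult' mult_ac)
    also have "\<dots> \<le> ennreal (c 0 Q) * ennreal (Suc (Suc M)) * (\<integral>\<^sup>+x\<in>cube Q. ennreal (tree_sum c 0 Q x ^ Suc M) \<partial>N)"
    proof -
      have "1 \<le> ennreal (Suc (Suc M))"
        by (rule order.trans[OF eq_refl[OF ennreal_1[symmetric]] ennreal_leI]) simp
      then have "ennreal (c 0 Q) * 1 \<le> ennreal (c 0 Q) * ennreal (Suc (Suc M))" by (intro mult_left_mono) auto
      then show ?thesis by (intro mult_right_mono) auto
    qed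
    also have "\<dots> \<le> ennreal ?F * (ennreal (c 0 Q) * emeasure N (cube Q))" by (rule low)
    also have "ennreal (c 0 Q) * emeasure N (cube Q) = tree_int N c 0 Q"
      by (rule nn_integral_tree_sum_linear(1)[OF c N, symmetric])
    finally show ?case .
  next
    case (Suc h Q)
    let ?c = "c (Suc h) Q"
    \<comment> \<open>The mean value bound for \<open>b \<mapsto> b ^ Suc n\<close> between
      \<open>b\<close> and \<open>a + b\<close>.\<close>
    have pw: "(a + b) ^ Suc n \<le> real (Suc n) * a * (a + b) ^ n + b ^ Suc n" if "0 \<le> a" "0 \<le> b" for a b :: real and n
    proof (induction n)
      case (Suc n)
      have "(a + b) ^ Suc (Suc n) = a * (a + b) ^ Suc n + b * (a + b) ^ Suc n" by (simp add: algebra_simps)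
      also have "b * (a + b) ^ Suc n \<le> b * (real (Suc n) * a * (a + b) ^ n + b ^ Suc n)"
        using Suc that by (intro mult_left_mono)
      also have "\<dots> = real (Suc n) * a * (b * (a + b) ^ n) + b ^ Suc (Suc n)" by (simp add: algebra_simps)
      also have "b * (a + b) ^ n \<le> (a + b) ^ Suc n" using that by (simp add: distrib_right)
      then have "real (Suc n) * a * (b * (a + b) ^ n) \<le> real (Suc n) * a * (a + b) ^ Suc n"
        using that by (intro mult_left_mono) auto
      finally show ?case by (simp add: algebra_simps)
    qed simp
    have "(\<integral>\<^sup>+x\<in>cube Q. ennreal (tree_sum c (Suc h) Q x ^ Suc (Suc M)) \<partial>N)
        = (\<Sum>s\<in>UNIV. \<integral>\<^sup>+x\<in>cube (child Q s). ennreal ((?c + tree_sum c h (child Q s) x) ^ Suc (Suc M)) \<partial>N)"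
      using c N by (rule nn_integral_tree_sum_Suc[where G="\<lambda>r. ennreal (r ^ Suc (Suc M))"]) measurable
    also have "\<dots> \<le> (\<Sum>s\<in>UNIV. \<integral>\<^sup>+x. (ennreal ?c * ennreal (Suc (Suc M))) * (ennreal ((?c + tree_sum c h (child Q s) x) ^ Suc M) * indicator (cube (child Q s)) x)
          + ennreal (tree_sum c h (child Q s) x ^ Suc (Suc M)) * indicator (cube (child Q s)) x \<partial>N)"
    proof (intro sum_mono nn_integral_mono)
      fix s x
      let ?t = "tree_sum c h (child Q s) x"
      have "ennreal ((?c + ?t) ^ Suc (Suc M)) \<le> ennreal (?c * real (Suc (Suc M)) * (?c + ?t) ^ Suc M + ?t ^ Suc (Suc M))"
        using pw[of ?c ?t "Suc M"] c tn by (intro ennreal_leI) (simp add: mult_ac)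
      also have "\<dots> = ennreal ?c * ennreal (Suc (Suc M)) * ennreal ((?c + ?t) ^ Suc M) + ennreal (?t ^ Suc (Suc M))"
        using c[of "Suc h" Q] tn[of h "child Q s" x] by (simp add: ennreal_plus ennreal_mult' mult.assoc)
      finally show "ennreal ((?c + ?t) ^ Suc (Suc M)) * indicator (cube (child Q s)) x
          \<le> ennreal ?c * ennreal (Suc (Suc M)) * (ennreal ((?c + ?t) ^ Suc M) * indicator (cube (child Q s)) x)
            + ennreal (?t ^ Suc (Suc M)) * indicator (cube (child Q s)) x"
        by (cases "x \<in> cube (child Q s)") simp_all
    qed
    also have "\<dots> = ennreal ?c * ennreal (Suc (Suc M)) * (\<Sum>s\<in>UNIV. \<integral>\<^sup>+x\<in>cube (child Q s). ennreal ((?c + tree_sum c h (child Q s) x) ^ Suc M) \<partial>N)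
          + (\<Sum>s\<in>UNIV. \<integral>\<^sup>+x\<in>cube (child Q s). ennreal (tree_sum c h (child Q s) x ^ Suc (Suc M)) \<partial>N)"
      by (simp add: nn_integral_add nn_integral_cmult sum.distrib sum_distrib_left del: power_Suc)
    also have "(\<Sum>s\<in>UNIV. \<integral>\<^sup>+x\<in>cube (child Q s). ennreal ((?c + tree_sum c h (child Q s) x) ^ Suc M) \<partial>N)
        = (\<integral>\<^sup>+x\<in>cube Q. ennreal (tree_sum c (Suc h) Q x ^ Suc M) \<partial>N)"
      using c N by (rule nn_integral_tree_sum_Suc[where G="\<lambda>r. ennreal (r ^ Suc M)", symmetric]) measurable
    also have "ennreal ?c * ennreal (Suc (Suc M)) * \<dots> + (\<Sum>s\<in>UNIV. \<integral>\<^sup>+x\<in>cube (child Q s). ennreal (tree_sum c h (child Q s) x ^ Suc (Suc M)) \<partial>N)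
        \<le> ennreal ?F * (ennreal ?c * emeasure N (cube Q))
          + (\<Sum>s\<in>UNIV. ennreal ?F * tree_int N c h (child Q s))"
      by (intro add_mono low sum_mono Suc.IH)
    also have "\<dots> = ennreal ?F * tree_int N c (Suc h) Q"
      unfolding nn_integral_tree_sum_linear(2)[OF c N] sum_distrib_left[symmetric] by (rule distrib_left[symmetric])
    finally show ?case .
  qed
qed

text \<open>The link between the combinatorial means of \<open>low_energy_le\<close> and integrals
  over cubes.\<close>

lemma nn_integral_tree_sum_lebesgue:
  fixes Q :: "'n::finite node"
  assumes c: "\<And>h Q. 0 \<le> c h Q" and Q: "0 \<le> side Q"
  shows "tree_int lebesgue c h Q = ennreal (side Q ^ CARD('n) * tree_mean c h Q)"
  using Q
proof (induction h arbitrary: Q)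
  case (0 Q)
  show ?case
    unfolding nn_integral_tree_sum_linear(1)[OF c refl] emeasure_cube[OF 0]
    using 0 c by (simp add: ennreal_mult' mult.commute)
next
  case (Suc h Q)
  have tm: "0 \<le> tree_mean c h Q" for h Q
    using c by (induction h arbitrary: Q) (auto intro!: add_nonneg_nonneg child_mean_nonneg)
  define v where "v = side Q ^ CARD('n) / 2 ^ CARD('n)"
  have v: "0 \<le> v" "side (child Q s) ^ CARD('n) = v" for s using Suc.prems by (auto simp: v_def power_divide)
  have "tree_int lebesgue c (Suc h) Q
      = ennreal (c (Suc h) Q) * ennreal (side Q ^ CARD('n)) + (\<Sum>s\<in>UNIV. ennreal (v * tree_mean c h (child Q s)))"
    unfolding nn_integral_tree_sum_linear(2)[OF c refl] emeasure_cube[OF Suc.prems]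
    using Suc.prems Suc.IH v by simp
  also have "(\<Sum>s\<in>UNIV. ennreal (v * tree_mean c h (child Q s))) = ennreal (\<Sum>s\<in>UNIV. v * tree_mean c h (child Q s))"
    using v tm by (intro sum_ennreal) auto
  also have "(\<Sum>s\<in>UNIV. v * tree_mean c h (child Q s)) = side Q ^ CARD('n) * child_mean (tree_mean c h) Q"
    unfolding child_mean_def sum_distrib_left[symmetric] by (simp add: v_def)
  also have "ennreal (c (Suc h) Q) * ennreal (side Q ^ CARD('n)) + ennreal (side Q ^ CARD('n) * child_mean (tree_mean c h) Q)
      = ennreal (side Q ^ CARD('n) * tree_mean c (Suc h) Q)"
  proof -
    have "ennreal a * ennreal r + ennreal (r * t) = ennreal (r * (a + t))" if "0 \<le> a" "0 \<le> t" "0 \<le> r" for a t r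
      using that by (simp add: distrib_left ennreal_plus ennreal_mult' mult.commute)
    then show ?thesis using c tm Suc.prems by (simp add: child_mean_nonneg)
  qed
  finally show ?case .
qed

section \<open>Testing the \<open>A\<^sub>p\<close> condition\<close>

lemma ennreal_le_mult_of_divide_le:
  fixes a b c :: ennreal
  assumes "a / b \<le> c" "c < \<infinity>" "b < \<infinity>"
  shows "a \<le> c * b"
proof (cases "b = 0")
  case True
  then have "a = 0" using assms by (auto split: if_splits)
  then show ?thesis by simp
next
  case False
  have "a = (a / b) * b" using False assms(3) by (simp add: ennreal_divide_times)
  also have "\<dots> \<le> c * b" using assms(1) by (rule mult_right_mono) simp
  finally show ?thesis .
qed

text \<open>Young's inequality for \<open>t / s\<close> and \<open>u powr (p - 1)\<close>,
  multiplied by the dual weight \<open>s = w powr (- 1 / (p - 1))\<close>; equality holds for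
  \<open>t = u * s\<close>. Integrated with a well-chosen \<open>u\<close> it plays the role of
  Hoelder's inequality.\<close>

lemma Young_tangent:
  fixes p t w u :: real
  assumes p: "1 < p" and "0 \<le> t" and w: "0 < w" and u: "0 < u"
  shows "p * u powr (p - 1) * t \<le> t powr p * w + (p - 1) * u powr p * w powr (- 1 / (p - 1))"
proof -
  define s where "s = w powr (- 1 / (p - 1))"
  have s: "0 < s" using w by (simp add: s_def)
  define a where "a = t / s"
  have a: "0 \<le> a" using assms s by (simp add: a_def)
  define q where "q = p / (p - 1)"
  have q: "1 < q" "1 / p + 1 / q = 1" "1 / q = (p - 1) / p" using p by (auto simp: q_def field_simps)
  have "a * u powr (p - 1) \<le> a powr p / p + (u powr (p - 1)) powr q / q"
    using p q a by (intro Youngs_inequality) auto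
  also have "(u powr (p - 1)) powr q = u powr p" using p by (simp add: powr_powr q_def)
  finally have "p * (a * u powr (p - 1)) \<le> p * (a powr p / p + u powr p / q)"
    using p by (intro mult_left_mono) auto
  also have "\<dots> = a powr p + p * (1 / q) * u powr p" using p by (simp add: distrib_left)
  also have "\<dots> = a powr p + (p - 1) * u powr p" unfolding q(3) using p by simp
  finally have "p * (a * u powr (p - 1)) * s \<le> (a powr p + (p - 1) * u powr p) * s"
    using s by (intro mult_right_mono) auto
  moreover have "a * s = t" using s by (simp add: a_def)
  then have "p * (a * u powr (p - 1)) * s = p * u powr (p - 1) * t" by (simp add: mult_ac)
  moreover have "a powr p * s = t powr p * w"
  proof -
    have e: "- 1 / (p - 1) * (1 - p) = 1" using p by (simp add: divide_simps)
    have "s powr (1 - p) = w" unfolding s_def powr_powr e using w by simp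
    then have "s / s powr p = w" using s by (simp add: powr_diff)
    moreover have "a powr p * s = t powr p * (s / s powr p)" using assms s by (simp add: a_def powr_divide)
    ultimately show ?thesis by simp
  qed
  ultimately show ?thesis unfolding s_def[symmetric] distrib_right by linarith
qed

abbreviation power_mass :: "real \<Rightarrow> (real^'n \<Rightarrow> real) \<Rightarrow> (real^'n \<Rightarrow> real) \<Rightarrow> (real^'n) set \<Rightarrow> ennreal" where
  "power_mass p w g E \<equiv> \<integral>\<^sup>+x\<in>E. ennreal (\<bar>g x\<bar> powr p * w x) \<partial>lebesgue"

section \<open>Weights and the testing inequality\<close>

lemma weight_measurable:
  assumes "weight w"
  shows "w \<in> borel_measurable lebesgue"
proof -
  have "(\<lambda>x. indicator (cball 0 (real n)) x * w x) \<in> borel_measurable lebesgue" for n :: nat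
    using assms by (auto simp: weight_def set_integrable_def intro: borel_measurable_integrable)
  moreover have "(\<lambda>n. indicator (cball 0 (real n)) x * w x) \<longlonglongrightarrow> w x" for x
  proof (rule tendsto_eventually)
    obtain n0 :: nat where n0: "norm x \<le> real n0" using real_arch_simple by blast
    show "\<forall>\<^sub>F n in sequentially. indicator (cball 0 (real n)) x * w x = w x"
      using eventually_ge_at_top[of n0]
    proof eventually_elim
      case (elim n)
      then have "norm x \<le> real n" using n0 by linarith
      then show ?case by (simp add: dist_norm)
    qed
  qed
  ultimately show ?thesis by (rule borel_measurable_LIMSEQ_real[rotated])
qed

lemma wmeasure_compact_finite:
  assumes "weight w" "compact K"
  shows "wmeasure w K < \<infinity>"
proof -
  have "integrable lebesgue (\<lambda>x. indicator K x * w x)"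
    using assms by (auto simp: weight_def set_integrable_def)
  then have "(\<integral>\<^sup>+x. ennreal (norm (indicator K x * w x)) \<partial>lebesgue) < \<infinity>"
    by (simp add: integrable_iff_bounded)
  moreover have "(\<integral>\<^sup>+x. ennreal (norm (indicator K x * w x)) \<partial>lebesgue) = wmeasure w K"
    unfolding wmeasure_def using assms(1) by (intro nn_integral_cong) (auto simp: indicator_def weight_def)
  ultimately show ?thesis by simp
qed

lemma wmeasure_mono: "E \<subseteq> F \<Longrightarrow> wmeasure w E \<le> wmeasure w F"
  unfolding wmeasure_def by (intro nn_integral_mono mult_left_mono) (auto simp: indicator_def)

text \<open>Hoelder's inequality bounds the integral of \<open>|g|\<close> over \<open>F\<close> by
  the integral of \<open>|g|^p w\<close> over \<open>F\<close> and the dual weight of the whole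
  cube, and the \<open>A_p\<close> condition trades the latter for \<open>w(Q)\<close>. The set
  \<open>F\<close> survives only in the first factor; this is what allows testing on a part of
  \<open>Q\<close>. The characteristic runs over closed cubes, hence the detour through
  \<open>B\<close>.\<close>

lemma Ap_testing_gt1:
  fixes w :: "real^'n \<Rightarrow> real" and Q :: "'n node"
  assumes w: "w \<in> Ap p" and p: "1 < p" and Q: "0 < side Q"
    and F[measurable]: "F \<in> sets lebesgue" and FQ: "F \<subseteq> cube Q"
    and g[measurable]: "g \<in> borel_measurable lebesgue" and c: "0 < c"
    and le: "ennreal (c * side Q ^ CARD('n)) \<le> (\<integral>\<^sup>+x\<in>F. ennreal \<bar>g x\<bar> \<partial>lebesgue)"
  shows "ennreal (c powr p) * wmeasure w (cube Q)
    \<le> Ap_const p w * power_mass p w g F"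
proof -
  let ?n = "CARD('n)"
  define B where "B = closed_cube Q"
  have B_cubes: "B \<in> cubes" using Q by (auto simp: B_def cubes_def)
  have B[measurable]: "B \<in> sets lebesgue" by (simp add: B_def)
  have QB: "cube Q \<subseteq> B" unfolding B_def by (rule cube_subset_cbox)
  have vB: "emeasure lebesgue B = ennreal (side Q ^ ?n)"
    unfolding B_def using emeasure_cbox_side(1)[of Q] Q by simp
  have wt: "weight w" and Afin: "Ap_const p w < \<infinity>" using w by (auto simp: Ap_def)
  have w0: "0 \<le> w x" for x using wt by (simp add: weight_def)
  have wm[measurable]: "w \<in> borel_measurable lebesgue" using wt by (rule weight_measurable)
  have Wfin: "wmeasure w B < \<infinity>" unfolding B_def by (rule wmeasure_compact_finite[OF wt]) simp
  define sg where "sg x = ennpowr (ennreal (w x)) (- 1 / (p - 1))" for x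
  have sg_eq: "sg x = (if w x = 0 then \<infinity> else ennreal (w x powr (- 1 / (p - 1))))" for x
  proof (cases "w x = 0")
    case False
    then have "0 < w x" using w0[of x] by simp
    then show ?thesis using p
      by (simp add: sg_def ennpowr_def inverse_ennreal powr_minus[symmetric])
  qed (use p in \<open>simp add: sg_def ennpowr_def\<close>)
  have sg_m[measurable]: "sg \<in> borel_measurable lebesgue"
  proof -
    have "(\<lambda>x. if w x = 0 then \<infinity> else ennreal (w x powr (- 1 / (p - 1)))) \<in> borel_measurable lebesgue"
      by measurable
    then show ?thesis by (simp add: sg_eq[abs_def])
  qed
  have Ap_le: "average B (\<lambda>x. ennreal (w x)) * ennpowr (average B sg) (p - 1) \<le> Ap_const p w"
    unfolding Ap_const_def sg_def using p B_cubes by (auto intro!: SUP_upper)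
  have avW: "average B (\<lambda>x. ennreal (w x)) = wmeasure w B / ennreal (side Q ^ ?n)"
    by (simp add: average_def wmeasure_def vB del: emeasure_completion)
  show ?thesis
  proof (cases "wmeasure w B = 0")
    case True
    then have "wmeasure w (cube Q) = 0" using wmeasure_mono[OF QB, of w] by simp
    then show ?thesis by simp
  next
    case False
    define W where "W = enn2real (wmeasure w B)"
    have W: "wmeasure w B = ennreal W" "0 < W"
      using Wfin False by (auto simp: W_def enn2real_positive_iff less_top zero_less_iff_neq_zero)
    have avW': "average B (\<lambda>x. ennreal (w x)) = ennreal (W / side Q ^ ?n)"
      unfolding avW W using W Q by (intro divide_ennreal) auto
    \<comment> \<open>\<open>w\<close> has positive mass on \<open>B\<close>, so a non-integrable
      dual weight would make the characteristic infinite.\<close>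
    have av_fin: "average B sg < \<infinity>"
    proof (rule ccontr)
      assume "\<not> average B sg < \<infinity>"
      then have "average B sg = \<infinity>" by (simp add: less_top[symmetric])
      then have "average B (\<lambda>x. ennreal (w x)) * ennpowr (average B sg) (p - 1) = \<infinity>"
        using p W Q unfolding avW' by (simp add: ennpowr_def ennreal_mult_eq_top_iff)
      then show False using Ap_le Afin by (simp add: top_unique)
    qed
    define S where "S = enn2real (average B sg)"
    have S_eq: "average B sg = ennreal S" "0 \<le> S" using av_fin by (auto simp: S_def)
    have int_sg: "(\<integral>\<^sup>+x\<in>B. sg x \<partial>lebesgue) = ennreal (S * side Q ^ ?n)"
    proof -
      have "(\<integral>\<^sup>+x\<in>B. sg x \<partial>lebesgue) = average B sg * ennreal (side Q ^ ?n)"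
        unfolding average_def vB using Q by (simp add: ennreal_divide_times)
      then show ?thesis using S_eq Q by (simp add: ennreal_mult)
    qed
    have Spos: "0 < S"
    proof (rule ccontr)
      assume "\<not> 0 < S"
      then have "(\<integral>\<^sup>+x\<in>B. sg x \<partial>lebesgue) = 0" using int_sg S_eq by simp
      then have "AE x in lebesgue. sg x * indicator B x = 0"
        by (subst (asm) nn_integral_0_iff_AE) auto
      then have "AE x in lebesgue. x \<notin> B"
      proof eventually_elim
        case (elim x)
        moreover have "sg x \<noteq> 0" using w0[of x] by (auto simp: sg_eq ennreal_eq_0_iff)
        ultimately show ?case by (auto simp: indicator_def split: if_splits)
      qed
      then have "emeasure lebesgue B = 0" by (subst (asm) AE_iff_null) (auto simp: null_sets_def)
      then show False using vB Q by (simp del: emeasure_completion)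
    qed
    \<comment> \<open>The dual weight is infinite where \<open>w\<close> vanishes, so its
      integrability on \<open>B\<close> forces \<open>w\<close> to be positive almost everywhere
      there.\<close>
    have AE_pos: "AE x in lebesgue. x \<in> B \<longrightarrow> 0 < w x"
    proof -
      have "AE x in lebesgue. sg x * indicator B x \<noteq> \<infinity>"
        using int_sg by (intro nn_integral_PInf_AE) auto
      then show ?thesis
      proof eventually_elim
        case (elim x)
        then show ?case using w0[of x] by (auto simp: sg_eq indicator_def split: if_splits)
      qed
    qed
    \<comment> \<open>With \<open>c = u * S\<close> the integrated Young inequality has
      \<open>p\<close> copies of \<open>u powr p * S * |Q|\<close> on the left and
      \<open>p - 1\<close> on the right; the remaining copy is bounded by the integral
      \<open>J\<close>.\<close>
    define u where "u = c / S"
    have u: "0 < u" using c Spos by (simp add: u_def)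
    define I where "I = power_mass p w g F"
    have A_low: "ennreal (W / side Q ^ ?n * S powr (p - 1)) \<le> Ap_const p w"
      using Ap_le p W Q Spos unfolding avW' S_eq by (subst ennreal_mult) (auto simp: ennpowr_def)
    have Apos: "0 < Ap_const p w"
      using A_low W Q Spos by (auto intro: order.strict_trans2[rotated])
    show ?thesis
    proof (cases "I = \<infinity>")
      case True
      then show ?thesis using Apos by (simp add: I_def ennreal_mult_top)
    next
      case False
      define J where "J = enn2real I"
      have J: "I = ennreal J" "0 \<le> J" using False by (auto simp: J_def less_top[symmetric])
      have "ennreal (p * u powr (p - 1)) * ennreal (c * side Q ^ ?n)
          \<le> ennreal (p * u powr (p - 1)) * (\<integral>\<^sup>+x\<in>F. ennreal \<bar>g x\<bar> \<partial>lebesgue)"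
        using le by (intro mult_left_mono) auto
      also have "\<dots> = (\<integral>\<^sup>+x\<in>F. ennreal (p * u powr (p - 1) * \<bar>g x\<bar>) \<partial>lebesgue)"
        using p by (subst nn_integral_cmult[symmetric]) (auto intro!: nn_integral_cong simp: ennreal_mult' mult.assoc)
      also have "\<dots> \<le> (\<integral>\<^sup>+x. (ennreal (\<bar>g x\<bar> powr p * w x) * indicator F x
            + ennreal ((p - 1) * u powr p) * (sg x * indicator B x)) \<partial>lebesgue)"
      proof (rule nn_integral_mono_AE)
        show "AE x in lebesgue. ennreal (p * u powr (p - 1) * \<bar>g x\<bar>) * indicator F x
            \<le> ennreal (\<bar>g x\<bar> powr p * w x) * indicator F x + ennreal ((p - 1) * u powr p) * (sg x * indicator B x)"
          using AE_pos
        proof eventually_elim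
          case (elim x)
          show ?case
          proof (cases "x \<in> F")
            case True
            then have xB: "x \<in> B" using FQ QB by auto
            then have wx: "0 < w x" using elim by simp
            have "ennreal (p * u powr (p - 1) * \<bar>g x\<bar>)
                \<le> ennreal (\<bar>g x\<bar> powr p * w x + (p - 1) * u powr p * w x powr (- 1 / (p - 1)))"
              by (intro ennreal_leI Young_tangent p u wx) simp
            also have "\<dots> = ennreal (\<bar>g x\<bar> powr p * w x) + ennreal ((p - 1) * u powr p) * sg x"
              using p wx by (simp add: sg_eq ennreal_plus ennreal_mult')
            finally show ?thesis using True xB by simp
          qed simp
        qed
      qed
      also have "\<dots> = I + ennreal ((p - 1) * u powr p) * ennreal (S * side Q ^ ?n)"
        unfolding I_def int_sg[symmetric] by (simp add: nn_integral_add nn_integral_cmult)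
      also have "\<dots> = ennreal (J + (p - 1) * u powr p * (S * side Q ^ ?n))"
        unfolding J using p J Spos Q by (simp add: ennreal_plus ennreal_mult')
      finally have "ennreal (p * u powr (p - 1) * (c * side Q ^ ?n)) \<le> ennreal (J + (p - 1) * u powr p * (S * side Q ^ ?n))"
        using p c Q by (simp add: ennreal_mult')
      then have *: "p * u powr (p - 1) * (c * side Q ^ ?n) \<le> J + (p - 1) * u powr p * (S * side Q ^ ?n)"
        using p J Spos Q by (subst (asm) ennreal_le_iff) auto
      have cu: "c = u * S" using Spos by (simp add: u_def)
      have "u powr (p - 1) * u = u powr p" using u by (simp add: powr_diff)
      then have "p * u powr (p - 1) * (c * side Q ^ ?n) = p * (u powr p * S * side Q ^ ?n)"
        unfolding cu by (simp add: mult_ac)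
      moreover have "(p - 1) * u powr p * (S * side Q ^ ?n) = (p - 1) * (u powr p * S * side Q ^ ?n)" by simp
      ultimately have Jl: "u powr p * S * side Q ^ ?n \<le> J" using * by (simp only: left_diff_distrib)
      have "c powr p * W = (u powr p * S * side Q ^ ?n) * (W / side Q ^ ?n * S powr (p - 1))"
        unfolding cu using u Spos Q by (simp add: powr_mult powr_diff)
      also have "\<dots> \<le> J * (W / side Q ^ ?n * S powr (p - 1))"
        using Jl W Q by (intro mult_right_mono) auto
      finally have fin: "c powr p * W \<le> J * (W / side Q ^ ?n * S powr (p - 1))" .
      have "ennreal (c powr p) * wmeasure w (cube Q) \<le> ennreal (c powr p) * wmeasure w B"
        by (intro mult_left_mono wmeasure_mono QB) auto
      also have "\<dots> = ennreal (c powr p * W)" unfolding W using W by (simp add: ennreal_mult')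
      also have "\<dots> \<le> ennreal (W / side Q ^ ?n * S powr (p - 1)) * ennreal J"
        using fin J W Q by (subst ennreal_mult[symmetric]) (auto intro!: ennreal_leI simp: mult.commute)
      also have "\<dots> \<le> Ap_const p w * I"
        unfolding J using A_low by (intro mult_right_mono) auto
      finally show ?thesis unfolding I_def .
    qed
  qed
qed

text \<open>For almost every \<open>x\<close> in the cube the average of \<open>w\<close> is at most
  the maximal function at \<open>x\<close>, hence at most \<open>[w] * w x\<close>; multiplying by
  \<open>|g x|\<close> and integrating over \<open>F\<close> gives the claim.\<close>

lemma Ap_testing_1:
  fixes w :: "real^'n \<Rightarrow> real" and Q :: "'n node"
  assumes w: "w \<in> Ap 1" and Q: "0 < side Q"
    and F[measurable]: "F \<in> sets lebesgue" and FQ: "F \<subseteq> cube Q"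
    and g[measurable]: "g \<in> borel_measurable lebesgue" and c: "0 < c"
    and le: "ennreal (c * side Q ^ CARD('n)) \<le> (\<integral>\<^sup>+x\<in>F. ennreal \<bar>g x\<bar> \<partial>lebesgue)"
  shows "ennreal c * wmeasure w (cube Q) \<le> Ap_const 1 w * (\<integral>\<^sup>+x\<in>F. ennreal (\<bar>g x\<bar> * w x) \<partial>lebesgue)"
proof -
  let ?n = "CARD('n)"
  define B where "B = closed_cube Q"
  have B_cubes: "B \<in> cubes" using Q by (auto simp: B_def cubes_def)
  have QB: "cube Q \<subseteq> B" unfolding B_def by (rule cube_subset_cbox)
  have vB: "emeasure lebesgue B = ennreal (side Q ^ ?n)"
    unfolding B_def using emeasure_cbox_side(1)[of Q] Q by simp
  have wt: "weight w" and Afin: "Ap_const 1 w < \<infinity>" using w by (auto simp: Ap_def)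
  have w0: "0 \<le> w x" for x using wt by (simp add: weight_def)
  have wm[measurable]: "w \<in> borel_measurable lebesgue" using wt by (rule weight_measurable)
  define W where "W = wmeasure w B / ennreal (side Q ^ ?n)"
  have "AE x in lebesgue. maximal w x / ennreal (w x) \<le> Ap_const 1 w"
    unfolding Ap_const_def by (simp add: esssup_AE)
  then have AE: "AE x in lebesgue. W * (ennreal \<bar>g x\<bar> * indicator F x)
      \<le> Ap_const 1 w * (ennreal (\<bar>g x\<bar> * w x) * indicator F x)"
  proof eventually_elim
    case (elim x)
    show ?case
    proof (cases "x \<in> F")
      case True
      then have xB: "x \<in> B" using FQ QB by auto
      have "W = average B (\<lambda>y. ennreal \<bar>w y\<bar>)"
        using w0 by (simp add: W_def average_def vB wmeasure_def del: emeasure_completion)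
      also have "\<dots> \<le> maximal w x" unfolding maximal_def using B_cubes xB by (auto intro!: SUP_upper)
      also have "\<dots> \<le> Ap_const 1 w * ennreal (w x)"
        using elim Afin by (intro ennreal_le_mult_of_divide_le) auto
      finally have "W * ennreal \<bar>g x\<bar> \<le> (Ap_const 1 w * ennreal (w x)) * ennreal \<bar>g x\<bar>"
        by (intro mult_right_mono) auto
      then show ?thesis using True w0[of x] by (simp add: ennreal_mult' mult_ac)
    qed simp
  qed
  have "ennreal c * wmeasure w (cube Q) \<le> ennreal c * wmeasure w B"
    by (intro mult_left_mono wmeasure_mono QB) auto
  also have "\<dots> = W * ennreal (c * side Q ^ ?n)"
  proof -
    have "W * ennreal (side Q ^ ?n) = wmeasure w B" unfolding W_def using Q by (simp add: ennreal_divide_times)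
    then show ?thesis using c unfolding \<open>W * _ = _\<close>[symmetric] by (simp add: ennreal_mult' mult.left_commute)
  qed
  also have "\<dots> \<le> W * (\<integral>\<^sup>+x\<in>F. ennreal \<bar>g x\<bar> \<partial>lebesgue)" using le by (intro mult_left_mono) auto
  also have "\<dots> = (\<integral>\<^sup>+x. W * (ennreal \<bar>g x\<bar> * indicator F x) \<partial>lebesgue)" by (simp add: nn_integral_cmult)
  also have "\<dots> \<le> (\<integral>\<^sup>+x. Ap_const 1 w * (ennreal (\<bar>g x\<bar> * w x) * indicator F x) \<partial>lebesgue)"
    using AE by (rule nn_integral_mono_AE)
  also have "\<dots> = Ap_const 1 w * (\<integral>\<^sup>+x\<in>F. ennreal (\<bar>g x\<bar> * w x) \<partial>lebesgue)" by (simp add: nn_integral_cmult)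
  finally show ?thesis .
qed

lemma Ap_testing:
  fixes w :: "real^'n \<Rightarrow> real" and Q :: "'n node"
  assumes w: "w \<in> Ap p" and p: "1 \<le> p" and Q: "0 < side Q"
    and F: "F \<in> sets lebesgue" "F \<subseteq> cube Q"
    and g: "g \<in> borel_measurable lebesgue" and c: "0 < c"
    and le: "ennreal (c * side Q ^ CARD('n)) \<le> (\<integral>\<^sup>+x\<in>F. ennreal \<bar>g x\<bar> \<partial>lebesgue)"
  shows "ennreal (c powr p) * wmeasure w (cube Q)
    \<le> Ap_const p w * power_mass p w g F"
proof (cases "p = 1")
  case True
  have "\<bar>g x\<bar> powr 1 = \<bar>g x\<bar>" for x by simp
  then show ?thesis using Ap_testing_1[of w Q F g c] assms True by simp
next
  case False
  then show ?thesis using assms by (intro Ap_testing_gt1) auto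
qed

section \<open>Weighted Carleson estimates\<close>

text \<open>Both integrals are sums of coefficients times masses of cubes, so comparing the masses
  of the cubes that carry a coefficient is enough.\<close>

lemma tree_sum_compare:
  assumes c: "\<And>h Q. 0 \<le> c h Q" and N: "sets N = sets lebesgue" and R: "sets R = sets lebesgue"
    and good_child: "\<And>P s. good P \<Longrightarrow> good (child P s)"
    and main: "\<And>h P. good P \<Longrightarrow> 0 < c h P \<Longrightarrow> emeasure N (cube P) \<le> emeasure R (cube P)"
    and Q: "good Q"
  shows "tree_int N c h Q \<le> tree_int R c h Q"
proof -
  have main': "ennreal (c h P) * emeasure N (cube P) \<le> ennreal (c h P) * emeasure R (cube P)" if "good P" for h P
    using main[OF that, of h] c[of h P] by (cases "c h P = 0") (auto intro: mult_left_mono)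
  show ?thesis using Q
  proof (induction h arbitrary: Q)
    case 0
    then show ?case
      by (simp only: nn_integral_tree_sum_linear(1)[OF c N] nn_integral_tree_sum_linear(1)[OF c R] main')
  next
    case (Suc h)
    show ?case
      unfolding nn_integral_tree_sum_linear(2)[OF c N] nn_integral_tree_sum_linear(2)[OF c R]
      by (intro add_mono main' sum_mono Suc.IH good_child Suc.prems)
  qed
qed

lemma ennreal_le_add_diff:
  assumes "ennreal e \<le> y + ennreal d" "0 \<le> d"
  shows "ennreal (e - d) \<le> y"
proof (cases y)
  case (real r)
  then have "ennreal e \<le> ennreal (r + d)" using assms by (simp add: ennreal_plus)
  then have "e \<le> r + d" using real assms by (subst (asm) ennreal_le_iff) auto
  then show ?thesis using real by (simp add: ennreal_leI)
qed simp

text \<open>Chebyshev's inequality for the measure with density \<open>g\<close>: the part of the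
  cube where the sum exceeds \<open>K\<close> has mass at most \<open>d\<close>.\<close>

lemma tree_sum_major_part:
  fixes g :: "real^'n \<Rightarrow> ennreal"
  assumes c: "\<And>h Q. 0 \<le> c h Q" and g[measurable]: "g \<in> borel_measurable lebesgue"
    and K: "0 < K" and d: "0 \<le> d"
    and up: "(\<integral>\<^sup>+x\<in>cube P. ennreal (tree_sum c h P x) * g x \<partial>lebesgue) \<le> ennreal (K * d)"
    and low: "ennreal e \<le> (\<integral>\<^sup>+x\<in>cube P. g x \<partial>lebesgue)"
  shows "ennreal (e - d) \<le> (\<integral>\<^sup>+x\<in>{x \<in> cube P. tree_sum c h P x \<le> K}. g x \<partial>lebesgue)"
proof (rule ennreal_le_add_diff[OF order.trans[OF low] d])
  let ?H = "{x \<in> cube P. K < tree_sum c h P x}"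
  have [measurable]: "?H \<in> sets lebesgue" "{x \<in> cube P. tree_sum c h P x \<le> K} \<in> sets lebesgue"
    by (intro sets_cube_Collect, measurable)+
  have "ennreal K * (\<integral>\<^sup>+x\<in>?H. g x \<partial>lebesgue) = (\<integral>\<^sup>+x\<in>?H. ennreal K * g x \<partial>lebesgue)"
    by (subst nn_integral_cmult[symmetric]) (auto intro!: nn_integral_cong simp: mult_ac)
  also have "\<dots> \<le> (\<integral>\<^sup>+x\<in>cube P. ennreal (tree_sum c h P x) * g x \<partial>lebesgue)"
    by (intro nn_integral_mono) (auto simp: indicator_def intro!: mult_right_mono ennreal_leI)
  also have "\<dots> \<le> ennreal K * ennreal d" using up K d by (simp add: ennreal_mult)
  finally have 1: "(\<integral>\<^sup>+x\<in>?H. g x \<partial>lebesgue) \<le> ennreal d"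
    using K by (subst (asm) ennreal_mult_le_mult_iff) (auto simp: ennreal_eq_0_iff)
  have "(\<integral>\<^sup>+x\<in>cube P. g x \<partial>lebesgue)
      = (\<integral>\<^sup>+x. g x * indicator {x \<in> cube P. tree_sum c h P x \<le> K} x + g x * indicator ?H x \<partial>lebesgue)"
    by (intro nn_integral_cong) (auto simp: indicator_def)
  also have "\<dots> = (\<integral>\<^sup>+x\<in>{x \<in> cube P. tree_sum c h P x \<le> K}. g x \<partial>lebesgue) + (\<integral>\<^sup>+x\<in>?H. g x \<partial>lebesgue)"
    by (intro nn_integral_add) measurable
  also have "\<dots> \<le> (\<integral>\<^sup>+x\<in>{x \<in> cube P. tree_sum c h P x \<le> K}. g x \<partial>lebesgue) + ennreal d"
    using 1 by (intro add_left_mono)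
  finally show "(\<integral>\<^sup>+x\<in>cube P. g x \<partial>lebesgue)
      \<le> (\<integral>\<^sup>+x\<in>{x \<in> cube P. tree_sum c h P x \<le> K}. g x \<partial>lebesgue) + ennreal d" .
qed

text \<open>The set where the dyadic maximal function, taken over the first \<open>h\<close>
  generations, exceeds 1, built from its maximal cubes. Off this set only the scales
  \<open>\<tau> = 1 / 2 ^ m\<close> occur.\<close>

primrec hit :: "('n::finite node \<Rightarrow> real) \<Rightarrow> nat \<Rightarrow> 'n node \<Rightarrow> (real^'n) set" where
  "hit a 0 = (\<lambda>Q. if 1 < a Q then cube Q else {})"
| "hit a (Suc h) = (\<lambda>Q. if 1 < a Q then cube Q else (\<Union>s. hit a h (child Q s)))"

lemma hit_lebesgue [measurable]: "hit a h Q \<in> sets lebesgue"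
  by (induction h arbitrary: Q) (auto intro!: sets.countable_UN' simp: countable_finite)

definition scale_coeff ::
  "(nat \<Rightarrow> 'n::finite node \<Rightarrow> real) \<Rightarrow> ('n node \<Rightarrow> real) \<Rightarrow> real \<Rightarrow> nat \<Rightarrow> 'n node \<Rightarrow> real" where
  "scale_coeff b a \<tau> h Q = (if \<tau> / 2 < a Q \<and> a Q \<le> \<tau> then (b h Q / \<tau>)\<^sup>2 else 0)"

lemma scale_coeff_nonneg: "0 \<le> scale_coeff b a \<tau> h Q"
  by (simp add: scale_coeff_def)

lemma ex_dyadic_scale:
  fixes a :: real
  assumes "0 < a" "a \<le> 1"
  obtains m where "1 / 2 ^ m / 2 < a" "a \<le> 1 / 2 ^ m"
proof -
  obtain k where k: "(1/2 :: real) ^ k < a" using real_arch_pow_inv[of a "1/2"] assms by auto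
  define j where "j = (LEAST j. (1/2 :: real) ^ j < a)"
  have j: "(1/2 :: real) ^ j < a" unfolding j_def using k by (rule LeastI)
  have "j \<noteq> 0" using j assms by (cases j) auto
  then obtain m where m: "j = Suc m" by (cases j) auto
  have "\<not> (1/2 :: real) ^ m < a" using not_less_Least[of m "\<lambda>j. (1/2 :: real) ^ j < a"] m by (auto simp: j_def)
  then show ?thesis using that[of m] j m by (simp add: power_divide)
qed

text \<open>Off \<open>hit\<close> each cube at \<open>x\<close> with positive mean lies in the band
  of some \<open>1 / 2 ^ m\<close>, and there its coefficient divided by \<open>4 ^ m\<close> is
  \<open>(b h Q)\<^sup>2\<close>. Cubes with mean 0 lie in no band; they are harmless because
  \<open>b\<close> vanishes on them.\<close>

lemma tree_sum_le_scales:
  assumes b: "\<And>h Q. a Q = 0 \<Longrightarrow> b h Q = 0" and a: "\<And>Q. 0 \<le> a Q"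
    and x: "x \<in> cube Q" "x \<notin> hit a h Q"
  shows "ennreal (tree_sum (\<lambda>h Q. (b h Q)\<^sup>2) h Q x)
    \<le> (\<Sum>m. ennreal (tree_sum (scale_coeff b a (1 / 2 ^ m)) h Q x / 4 ^ m))"
proof -
  have one: "ennreal ((b h Q)\<^sup>2) \<le> (\<Sum>m. ennreal (scale_coeff b a (1 / 2 ^ m) h Q / 4 ^ m))" if le1: "a Q \<le> 1" for h Q
  proof (cases "a Q = 0")
    case True
    then show ?thesis using b by simp
  next
    case False
    then have "0 < a Q" using a[of Q] by simp
    then obtain m where m: "1 / 2 ^ m / 2 < a Q" "a Q \<le> 1 / 2 ^ m"
      using le1 by (rule ex_dyadic_scale)
    have four: "(2 ^ m)\<^sup>2 = (4::real) ^ m"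
      by (simp add: power_mult_distrib[symmetric] power2_eq_square)
    have "scale_coeff b a (1 / 2 ^ m) h Q / 4 ^ m = (b h Q)\<^sup>2"
      using m four by (simp add: scale_coeff_def power_mult_distrib)
    then have "ennreal ((b h Q)\<^sup>2) = (\<Sum>i\<in>{m}. ennreal (scale_coeff b a (1 / 2 ^ i) h Q / 4 ^ i))" by simp
    also have "\<dots> \<le> (\<Sum>i. ennreal (scale_coeff b a (1 / 2 ^ i) h Q / 4 ^ i))"
      by (intro sum_le_suminf) auto
    finally show ?thesis .
  qed
  show ?thesis using x
  proof (induction h arbitrary: Q)
    case 0
    then show ?case using one[of Q 0] by (auto split: if_splits)
  next
    case (Suc h)
    let ?s = "{i. corner Q $ i + side Q / 2 \<le> x $ i}"
    have xs: "x \<in> cube (child Q ?s)" using Suc.prems by (simp add: cube_child_iff)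
    have aQ: "a Q \<le> 1" using Suc.prems by (auto split: if_splits)
    then have "x \<notin> hit a h (child Q ?s)" using Suc.prems by auto
    then have IH: "ennreal (tree_sum (\<lambda>h Q. (b h Q)\<^sup>2) h (child Q ?s) x)
      \<le> (\<Sum>m. ennreal (tree_sum (scale_coeff b a (1 / 2 ^ m)) h (child Q ?s) x / 4 ^ m))"
      using Suc.IH xs by blast
    have "ennreal (tree_sum (\<lambda>h Q. (b h Q)\<^sup>2) (Suc h) Q x)
        = ennreal ((b (Suc h) Q)\<^sup>2) + ennreal (tree_sum (\<lambda>h Q. (b h Q)\<^sup>2) h (child Q ?s) x)"
      unfolding tree_sum_step[OF xs] by (intro ennreal_plus tree_sum_nonneg) auto
    also have "\<dots> \<le> (\<Sum>m. ennreal (scale_coeff b a (1 / 2 ^ m) (Suc h) Q / 4 ^ m))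
        + (\<Sum>m. ennreal (tree_sum (scale_coeff b a (1 / 2 ^ m)) h (child Q ?s) x / 4 ^ m))"
      by (intro add_mono one aQ IH)
    also have "\<dots> = (\<Sum>m. ennreal (scale_coeff b a (1 / 2 ^ m) (Suc h) Q / 4 ^ m)
        + ennreal (tree_sum (scale_coeff b a (1 / 2 ^ m)) h (child Q ?s) x / 4 ^ m))"
      by (rule suminf_add) auto
    also have "\<dots> = (\<Sum>m. ennreal (tree_sum (scale_coeff b a (1 / 2 ^ m)) (Suc h) Q x / 4 ^ m))"
      unfolding tree_sum_step[OF xs]
      by (intro suminf_cong, subst ennreal_plus[symmetric])
        (auto simp: add_divide_distrib intro!: divide_nonneg_nonneg scale_coeff_nonneg tree_sum_nonneg)
    finally show ?case .
  qed
qed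

text \<open>\<open>test\<close> is the form in which the \<open>A_p\<close> condition is used, with
  the real number \<open>A\<close> in place of the characteristic. The bound
  \<open>1 \<le> A\<close> can fail only if every cube has weight 0, a case settled in the final
  proof. Global integrability of \<open>f\<close> is available because \<open>f\<close> will be cut
  off to one top cube.\<close>

locale weighted_tree =
  fixes f w :: "real^'n \<Rightarrow> real" and p \<theta> A :: real
  assumes f_int: "integrable lebesgue f"
    and w_meas [measurable]: "w \<in> borel_measurable lebesgue" and w_nonneg: "\<And>x. 0 \<le> w x"
    and \<theta>: "0 < \<theta>" "\<theta> < 1" and p: "1 \<le> p" and A: "1 \<le> A"
    and test: "\<And>Q F g c. 0 < side Q \<Longrightarrow> F \<in> sets lebesgue \<Longrightarrow> F \<subseteq> cube Q \<Longrightarrow>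
       g \<in> borel_measurable lebesgue \<Longrightarrow> 0 < c \<Longrightarrow>
       ennreal (c * side Q ^ CARD('n)) \<le> (\<integral>\<^sup>+x\<in>F. ennreal \<bar>g x\<bar> \<partial>lebesgue) \<Longrightarrow>
       ennreal (c powr p) * wmeasure w (cube Q)
         \<le> ennreal A * power_mass p w g F"
begin

definition "N = density lebesgue (\<lambda>x. ennreal (w x))"
definition "a = cube_avg (\<lambda>x. \<bar>f x\<bar>)"
definition "b = osc \<theta> (cube_avg f) a"
definition "G = energy_const CARD('n) \<theta>"
definition "I Q = power_mass p w f (cube Q)"

lemma f_meas [measurable]: "f \<in> borel_measurable lebesgue"
  using f_int by (rule borel_measurable_integrable)

lemma sets_N [simp, measurable_cong]: "sets N = sets lebesgue"
  by (simp add: N_def)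

lemma emeasure_N: "E \<in> sets lebesgue \<Longrightarrow> emeasure N E = wmeasure w E"
  by (simp add: N_def emeasure_density wmeasure_def)

lemma G: "1 \<le> G"
  unfolding G_def using \<theta> by (rule energy_const_ge_1)

lemma avg_le_a: "\<bar>cube_avg f Q\<bar> \<le> a Q"
  unfolding a_def by (rule cube_avg_abs)

lemma a_nonneg: "0 \<le> a Q"
  using avg_le_a[of Q] by linarith

lemma a_child: "a Q = child_mean a Q"
  unfolding a_def using f_int by (intro cube_avg_child) auto

lemma b_zero: "a Q = 0 \<Longrightarrow> b h Q = 0"
  using osc_le[OF cube_avg_child[OF f_int] a_child avg_le_a \<theta>, of h Q]
    osc_nonneg[OF cube_avg_child[OF f_int] a_child avg_le_a \<theta>, of h Q] by (simp add: b_def)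

abbreviation "coef \<equiv> scale_coeff b a"

lemma nn_integral_f_cube:
  assumes "0 < side Q"
  shows "(\<integral>\<^sup>+x\<in>cube Q. ennreal \<bar>f x\<bar> \<partial>lebesgue) = ennreal (a Q * side Q ^ CARD('n))"
proof -
  have "integrable lebesgue (\<lambda>x. indicator (cube Q) x * \<bar>f x\<bar>)" using f_int by (intro integrable_cube) auto
  then have "(\<integral>\<^sup>+x. ennreal (indicator (cube Q) x * \<bar>f x\<bar>) \<partial>lebesgue) = ennreal (cube_integral (\<lambda>x. \<bar>f x\<bar>) Q)"
    by (intro nn_integral_eq_integral) auto
  moreover have "(\<integral>\<^sup>+x. ennreal (indicator (cube Q) x * \<bar>f x\<bar>) \<partial>lebesgue) = (\<integral>\<^sup>+x\<in>cube Q. ennreal \<bar>f x\<bar> \<partial>lebesgue)"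
    by (intro nn_integral_cong) (auto simp: indicator_def)
  ultimately show ?thesis using assms by (simp add: a_def cube_avg_def)
qed

lemma carleson_lebesgue:
  assumes \<tau>: "0 < \<tau>" and Q: "0 < side Q"
  shows "tree_int lebesgue (coef \<tau>) h Q \<le> ennreal (G * side Q ^ CARD('n))"
proof -
  have "tree_mean (coef \<tau>) h Q \<le> tree_mean (\<lambda>h Q. (1 / \<tau>\<^sup>2) * low_energy \<theta> (cube_avg f) a \<tau> h Q) h Q"
    by (rule tree_mean_mono) (auto simp: scale_coeff_def low_energy_def b_def power_divide)
  also have "\<dots> = (1 / \<tau>\<^sup>2) * tree_mean (low_energy \<theta> (cube_avg f) a \<tau>) h Q" by (rule tree_mean_cmult)
  also have "\<dots> \<le> (1 / \<tau>\<^sup>2) * (G * \<tau>\<^sup>2)"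
    unfolding G_def using \<theta> \<tau>
    by (intro mult_left_mono low_energy_le cube_avg_child[OF f_int] a_child avg_le_a) auto
  also have "\<dots> = G" using \<tau> by simp
  finally show ?thesis
    using Q by (subst nn_integral_tree_sum_lebesgue) (auto intro!: ennreal_leI scale_coeff_nonneg simp: mult.commute)
qed

text \<open>On every cube that carries a coefficient the mean of \<open>|f|\<close> is at most
  \<open>\<tau>\<close>, so the measure \<open>|f| dx\<close> may be replaced by
  \<open>\<tau> dx\<close> and the Lebesgue estimate applies.\<close>

lemma tree_sum_f_le:
  assumes \<tau>: "0 < \<tau>" and Q: "0 < side Q"
  shows "(\<integral>\<^sup>+x\<in>cube Q. ennreal (tree_sum (coef \<tau>) h Q x) * ennreal \<bar>f x\<bar> \<partial>lebesgue)
     \<le> ennreal (\<tau> * (G * side Q ^ CARD('n)))"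
proof -
  let ?D = "density lebesgue (\<lambda>x. ennreal \<bar>f x\<bar>)" and ?R = "density lebesgue (\<lambda>x. ennreal \<tau>)"
  have "tree_int ?D (coef \<tau>) h Q \<le> tree_int ?R (coef \<tau>) h Q"
  proof (rule tree_sum_compare[where good="\<lambda>Q. 0 < side Q"])
    fix h and P :: "'n node" assume P: "0 < side P" "0 < coef \<tau> h P"
    then have "a P \<le> \<tau>" by (auto simp: scale_coeff_def split: if_splits)
    have "emeasure ?D (cube P) = ennreal (a P * side P ^ CARD('n))"
      using nn_integral_f_cube[OF P(1)] by (simp add: emeasure_density)
    also have "\<dots> \<le> ennreal (\<tau> * side P ^ CARD('n))"
      using P \<open>a P \<le> \<tau>\<close> by (intro ennreal_leI mult_right_mono) auto
    also have "\<dots> = emeasure ?R (cube P)"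
      using P \<tau> by (simp add: emeasure_density nn_integral_cmult_indicator ennreal_mult' del: emeasure_completion)
    finally show "emeasure ?D (cube P) \<le> emeasure ?R (cube P)" .
  qed (use Q in \<open>auto intro: scale_coeff_nonneg\<close>)
  also have "tree_int ?D (coef \<tau>) h Q
      = (\<integral>\<^sup>+x\<in>cube Q. ennreal (tree_sum (coef \<tau>) h Q x) * ennreal \<bar>f x\<bar> \<partial>lebesgue)"
    by (subst nn_integral_density) (auto intro!: nn_integral_cong simp: mult_ac)
  also have "tree_int ?R (coef \<tau>) h Q
      = ennreal \<tau> * tree_int lebesgue (coef \<tau>) h Q"
    by (subst nn_integral_density) (auto simp: nn_integral_cmult)
  also have "\<dots> \<le> ennreal \<tau> * ennreal (G * side Q ^ CARD('n))"
    using carleson_lebesgue[OF assms] by (intro mult_left_mono) auto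
  also have "\<dots> = ennreal (\<tau> * (G * side Q ^ CARD('n)))" using \<tau> by (simp add: ennreal_mult')
  finally show ?thesis .
qed

text \<open>The mass of \<open>|f|\<close> on \<open>P\<close> is more than
  \<open>\<tau> / 2\<close> times the volume. With the threshold \<open>4 * G\<close> at most
  \<open>\<tau> / 4\<close> times the volume is lost.\<close>

lemma major_f:
  assumes \<tau>: "0 < \<tau>" and P: "0 < side P" and c: "0 < coef \<tau> h P"
  shows "ennreal (\<tau> / 4 * side P ^ CARD('n))
    \<le> (\<integral>\<^sup>+x\<in>{x \<in> cube P. tree_sum (coef \<tau>) h P x \<le> 4 * G}. ennreal \<bar>f x\<bar> \<partial>lebesgue)"
proof -
  have "\<tau> / 2 < a P" using c by (auto simp: scale_coeff_def split: if_splits)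
  then have low: "ennreal (\<tau> / 2 * side P ^ CARD('n)) \<le> (\<integral>\<^sup>+x\<in>cube P. ennreal \<bar>f x\<bar> \<partial>lebesgue)"
    unfolding nn_integral_f_cube[OF P] using P by (intro ennreal_leI mult_right_mono) auto
  have up: "(\<integral>\<^sup>+x\<in>cube P. ennreal (tree_sum (coef \<tau>) h P x) * ennreal \<bar>f x\<bar> \<partial>lebesgue)
      \<le> ennreal (4 * G * (\<tau> / 4 * side P ^ CARD('n)))"
    using tree_sum_f_le[OF \<tau> P] by (simp add: mult_ac)
  have "ennreal (\<tau> / 2 * side P ^ CARD('n) - \<tau> / 4 * side P ^ CARD('n))
     \<le> (\<integral>\<^sup>+x\<in>{x \<in> cube P. tree_sum (coef \<tau>) h P x \<le> 4 * G}. ennreal \<bar>f x\<bar> \<partial>lebesgue)"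
    using \<tau> P G by (intro tree_sum_major_part[OF _ _ _ _ up low]) (auto intro: scale_coeff_nonneg)
  moreover have "\<tau> / 2 * side P ^ CARD('n) - \<tau> / 4 * side P ^ CARD('n) = \<tau> / 4 * side P ^ CARD('n)" by simp
  ultimately show ?thesis by simp
qed

text \<open>The analogue for volume: the threshold \<open>4 * G\<close> loses at most a quarter of
  the cube.\<close>

lemma major_1:
  assumes \<tau>: "0 < \<tau>" and P: "0 < side P"
  shows "ennreal (3 / 4 * side P ^ CARD('n))
    \<le> (\<integral>\<^sup>+x\<in>{x \<in> cube P. tree_sum (coef \<tau>) h P x \<le> 4 * G}. 1 \<partial>lebesgue)"
proof -
  have up: "(\<integral>\<^sup>+x\<in>cube P. ennreal (tree_sum (coef \<tau>) h P x) * 1 \<partial>lebesgue) \<le> ennreal (4 * G * (side P ^ CARD('n) / 4))"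
    using carleson_lebesgue[OF \<tau> P] by (simp add: mult_ac)
  have "ennreal (side P ^ CARD('n) - side P ^ CARD('n) / 4)
     \<le> (\<integral>\<^sup>+x\<in>{x \<in> cube P. tree_sum (coef \<tau>) h P x \<le> 4 * G}. 1 \<partial>lebesgue)"
    using P G by (intro tree_sum_major_part[OF _ _ _ _ up]) (auto intro: scale_coeff_nonneg simp del: emeasure_completion)
  then show ?thesis by simp
qed

lemma low_set: "{x \<in> cube P. tree_sum c h P x \<le> K} \<in> sets lebesgue"
  by (intro sets_cube_Collect) measurable

text \<open>Testing on the part where the sum is at most \<open>4 * G\<close> bounds the weight of
  \<open>P\<close> by the mass of that part for the density
  \<open>A * (1 / r) powr p * |g|^p w\<close>, as the embedding requires. The choice
  \<open>g = f\<close>, \<open>r = \<tau> / 4\<close> gives the first moment; \<open>g = 1\<close>,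
  \<open>r = 3 / 4\<close> gives the Carleson condition for the weight.\<close>

lemma tree_int_le_power_mass:
  assumes g[measurable]: "g \<in> borel_measurable lebesgue" and r: "0 < r" and Q: "0 < side Q"
    and major: "\<And>h P. 0 < side P \<Longrightarrow> 0 < coef \<tau> h P \<Longrightarrow> ennreal (r * side P ^ CARD('n))
      \<le> (\<integral>\<^sup>+x\<in>{x \<in> cube P. tree_sum (coef \<tau>) h P x \<le> 4 * G}. ennreal \<bar>g x\<bar> \<partial>lebesgue)"
  shows "tree_int N (coef \<tau>) h Q \<le> ennreal (4 * G * A * (1 / r) powr p) * power_mass p w g (cube Q)"
proof -
  define k where "k = A * (1 / r) powr p"
  have k: "0 \<le> k" using A by (simp add: k_def)
  let ?R = "density lebesgue (\<lambda>x. ennreal k * ennreal (\<bar>g x\<bar> powr p * w x))"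
  have R: "emeasure ?R F = ennreal k * power_mass p w g F" if "F \<in> sets lebesgue" for F
    using that by (simp add: emeasure_density nn_integral_cmult mult.assoc)
  have "tree_int N (coef \<tau>) h Q \<le> ennreal (4 * G) * emeasure ?R (cube Q)"
  proof (rule tree_sum_embedding[where good="\<lambda>Q. 0 < side Q"])
    fix h and P :: "'n node" assume P: "0 < side P" "0 < coef \<tau> h P"
    let ?F = "{x \<in> cube P. tree_sum (coef \<tau>) h P x \<le> 4 * G}"
    have 1: "ennreal (r powr p) * wmeasure w (cube P) \<le> ennreal A * power_mass p w g ?F"
      using P r by (intro test low_set major) auto
    have "emeasure N (cube P) = ennreal ((1 / r) powr p * r powr p) * wmeasure w (cube P)"
      using r by (simp add: emeasure_N powr_mult[symmetric])
    also have "\<dots> = ennreal ((1 / r) powr p) * (ennreal (r powr p) * wmeasure w (cube P))"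
      by (simp add: ennreal_mult' mult.assoc)
    also have "\<dots> \<le> ennreal ((1 / r) powr p) * (ennreal A * power_mass p w g ?F)"
      using 1 by (intro mult_left_mono) auto
    also have "\<dots> = emeasure ?R ?F"
      unfolding R[OF low_set] using A by (simp add: k_def ennreal_mult' mult_ac)
    finally show "emeasure N (cube P) \<le> emeasure ?R ?F" .
  qed (use Q G in \<open>auto intro: scale_coeff_nonneg\<close>)
  also have "\<dots> = ennreal (4 * G * A * (1 / r) powr p) * power_mass p w g (cube Q)"
    unfolding R[OF cube_lebesgue] using A G by (simp add: k_def ennreal_mult' mult_ac)
  finally show ?thesis .
qed

lemma tree_sum_N_le_I:
  assumes \<tau>: "0 < \<tau>" and Q: "0 < side Q"
  shows "tree_int N (coef \<tau>) h Q \<le> ennreal (4 * G * A * (4 / \<tau>) powr p) * I Q"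
  using tree_int_le_power_mass[OF f_meas _ Q major_f[OF \<tau>], of h] \<tau> by (simp add: I_def)

lemma tree_sum_N_le_A:
  assumes \<tau>: "0 < \<tau>" and Q: "0 < side Q"
  shows "tree_int N (coef \<tau>) h Q \<le> ennreal (4 * G * A * (4 / 3) powr p) * emeasure N (cube Q)"
proof -
  have "tree_int N (coef \<tau>) h Q \<le> ennreal (4 * G * A * (1 / (3 / 4)) powr p) * power_mass p w (\<lambda>_. 1) (cube Q)"
    using major_1[OF \<tau>] Q by (intro tree_int_le_power_mass) (simp_all del: emeasure_completion)
  then show ?thesis by (simp add: emeasure_N wmeasure_def)
qed

text \<open>The weak-type bound of the dyadic maximal function at height 1: testing with
  \<open>c = 1\<close> on each maximal cube, which are disjoint.\<close>

lemma hit_le: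
  assumes "0 < side Q"
  shows "emeasure N (hit a h Q) \<le> ennreal A * I Q"
proof -
  have top: "emeasure N (cube Q) \<le> ennreal A * I Q" if "0 < side Q" "1 < a Q" for Q
  proof -
    have "ennreal (1 * side Q ^ CARD('n)) \<le> (\<integral>\<^sup>+x\<in>cube Q. ennreal \<bar>f x\<bar> \<partial>lebesgue)"
      unfolding nn_integral_f_cube[OF that(1)] using that by (intro ennreal_leI mult_right_mono) auto
    then have "ennreal (1 powr p) * wmeasure w (cube Q) \<le> ennreal A * I Q"
      unfolding I_def using that by (intro test) auto
    then show ?thesis by (simp add: emeasure_N)
  qed
  show ?thesis using assms
  proof (induction h arbitrary: Q)
    case 0
    then show ?case using top[of Q] by simp
  next
    case (Suc h Q)
    show ?case
    proof (cases "1 < a Q")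
      case True
      then show ?thesis using top[of Q] Suc.prems by simp
    next
      case False
      then have "emeasure N (hit a (Suc h) Q) \<le> (\<Sum>s\<in>UNIV. emeasure N (hit a h (child Q s)))"
        by (simp, intro emeasure_subadditive_finite) auto
      also have "\<dots> \<le> (\<Sum>s\<in>UNIV. ennreal A * I (child Q s))"
        using Suc by (intro sum_mono Suc.IH) auto
      also have "\<dots> = ennreal A * I Q"
        unfolding I_def sum_distrib_left[symmetric] by (subst nn_integral_cube_child) auto
      finally show ?thesis .
    qed
  qed
qed

end

section \<open>Weak-type estimates on a dyadic tree\<close>

lemma side_foldl_child: "0 < side Q \<Longrightarrow> 0 < side (foldl child Q ss)"
  by (induction ss arbitrary: Q) auto

lemma cube_foldl_child: "cube (foldl child Q ss) \<subseteq> cube Q"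
  by (induction ss arbitrary: Q) (use cube_child_subset in \<open>auto, blast\<close>)

lemma wmeasure_cbox_cube:
  fixes w :: "real^'n \<Rightarrow> real"
  assumes "0 < side Q"
  shows "wmeasure w (closed_cube Q) = wmeasure w (cube Q)"
proof -
  let ?B = "closed_cube Q"
  have "emeasure lebesgue (?B - cube Q) = emeasure lebesgue ?B - emeasure lebesgue (cube Q)"
    using assms by (intro emeasure_Diff cube_subset_cbox) (auto simp del: emeasure_completion)
  also have "\<dots> = 0" using assms emeasure_cbox_side(1)[of Q] emeasure_cube[of Q] by simp
  finally have "?B - cube Q \<in> null_sets lebesgue" by (auto simp: null_sets_def simp del: emeasure_completion)
  then have "AE x in lebesgue. x \<notin> ?B - cube Q" by (rule AE_not_in)
  then have "AE x in lebesgue. ennreal (w x) * indicator ?B x = ennreal (w x) * indicator (cube Q) x"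
  proof eventually_elim
    case (elim x)
    then show ?case using cube_subset_cbox[of Q] by (auto simp: indicator_def)
  qed
  then show ?thesis unfolding wmeasure_def by (rule nn_integral_cong_AE)
qed

lemma wmeasure_cube_finite: "weight w \<Longrightarrow> 0 < side Q \<Longrightarrow> wmeasure w (cube Q) < \<infinity>"
  unfolding wmeasure_cbox_cube[symmetric] by (rule wmeasure_compact_finite) auto

context weighted_tree
begin

text \<open>Testing against the maximal function of the weight. \<open>H\<close> is the dyadic
  maximal function over the descendants of \<open>Q\<close>, a supremum over countably many lists of
  children. Since the average of \<open>w\<close> over \<open>P\<close> is at most \<open>H\<close>
  on \<open>P\<close>, three quarters of \<open>P\<close> suffice to see \<open>w(P)\<close> as at
  most \<open>4 / 3\<close> of the integral of \<open>H\<close> over that part. The constant is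
  \<open>4 * G\<close> times \<open>4 / 3\<close>.\<close>

lemma tree_sum_N_le_Ainf:
  assumes \<tau>: "0 < \<tau>" and Q: "0 < side Q" and wt: "weight w"
    and D: "Ainf_const w \<le> ennreal D" "0 \<le> D"
  shows "tree_int N (coef \<tau>) h Q \<le> ennreal (16 / 3 * G * D) * emeasure N (cube Q)"
proof -
  define av where "av P = wmeasure w (cube P) / emeasure lebesgue (cube P)" for P
  define H where "H x = (SUP ss. av (foldl child Q ss) * indicator (cube (foldl child Q ss)) x)" for x
  have H_meas[measurable]: "H \<in> borel_measurable lebesgue"
    unfolding H_def by measurable
  let ?R = "density lebesgue (\<lambda>x. ennreal (4 / 3) * H x)"
  have R: "emeasure ?R F = ennreal (4 / 3) * (\<integral>\<^sup>+x\<in>F. H x \<partial>lebesgue)" if "F \<in> sets lebesgue" for F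
    using that by (simp add: emeasure_density nn_integral_cmult mult.assoc)
  let ?B = "closed_cube Q"
  let ?M = "maximal (\<lambda>y. w y * indicator ?B y)"
  have H_le: "H x \<le> ?M x" for x
    unfolding H_def
  proof (rule SUP_least)
    fix ss
    let ?P = "foldl child Q ss"
    let ?C = "closed_cube ?P"
    have P: "0 < side ?P" using Q by (rule side_foldl_child)
    show "av ?P * indicator (cube ?P) x \<le> ?M x"
    proof (cases "x \<in> cube ?P")
      case True
      have "?C \<in> cubes" using P by (auto simp: cubes_def)
      moreover have "x \<in> ?C" using True cube_subset_cbox by blast
      moreover have "av ?P \<le> average ?C (\<lambda>y. ennreal \<bar>w y * indicator ?B y\<bar>)"
      proof -
        have le: "wmeasure w (cube ?P) \<le> (\<integral>\<^sup>+y\<in>?C. ennreal \<bar>w y * indicator ?B y\<bar> \<partial>lebesgue)"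
          unfolding wmeasure_def
          using cube_foldl_child[of Q ss] cube_subset_cbox[of Q] cube_subset_cbox[of ?P] w_nonneg
          by (intro nn_integral_mono) (auto simp: indicator_def)
        have eq: "emeasure lebesgue (cube ?P) = emeasure lebesgue ?C"
          using P emeasure_cbox_side(1)[of ?P] emeasure_cube[of ?P] by simp
        show ?thesis unfolding av_def average_def eq by (rule divide_right_mono_ennreal[OF le])
      qed
      ultimately show ?thesis using True unfolding maximal_def by (auto intro!: SUP_upper2[of ?C])
    qed simp
  qed
  have int_H: "(\<integral>\<^sup>+x\<in>cube Q. H x \<partial>lebesgue) \<le> ennreal D * emeasure N (cube Q)"
  proof -
    have "(\<integral>\<^sup>+x\<in>cube Q. H x \<partial>lebesgue) \<le> (\<integral>\<^sup>+x\<in>?B. ?M x \<partial>lebesgue)"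
      using cube_subset_cbox[of Q] by (intro nn_integral_mono mult_mono H_le) (auto simp: indicator_def)
    also have "\<dots> \<le> ennreal D * wmeasure w ?B"
    proof (rule ennreal_le_mult_of_divide_le)
      have "(\<integral>\<^sup>+x\<in>?B. ?M x \<partial>lebesgue) / wmeasure w ?B \<le> Ainf_const w"
        unfolding Ainf_const_def using Q by (intro SUP_upper) (auto simp: cubes_def)
      then show "(\<integral>\<^sup>+x\<in>?B. ?M x \<partial>lebesgue) / wmeasure w ?B \<le> ennreal D" using D(1) by (rule order.trans)
      show "wmeasure w ?B < \<infinity>" using wt by (intro wmeasure_compact_finite) auto
    qed simp
    also have "wmeasure w ?B = emeasure N (cube Q)"
      using wmeasure_cbox_cube[OF Q] by (simp add: emeasure_N)
    finally show ?thesis .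
  qed
  \<comment> \<open>The predicate \<open>good\<close> keeps track of ancestry, because
    \<open>H\<close> dominates the averages of descendants of \<open>Q\<close> only.\<close>
  have "tree_int N (coef \<tau>) h Q \<le> ennreal (4 * G) * emeasure ?R (cube Q)"
  proof (rule tree_sum_embedding[where good="\<lambda>P. 0 < side P \<and> P \<in> range (foldl child Q)"])
    fix P s assume "0 < side P \<and> P \<in> range (foldl child Q)"
    then obtain ss where "P = foldl child Q ss" "0 < side P" by auto
    then have "child P s = foldl child Q (ss @ [s])" "0 < side (child P s)" by auto
    then show "0 < side (child P s) \<and> child P s \<in> range (foldl child Q)" by blast
  next
    fix h and P :: "'n node" assume P: "0 < side P \<and> P \<in> range (foldl child Q)"
    then obtain ss where ss: "P = foldl child Q ss" and sP: "0 < side P" by auto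
    let ?F = "{x \<in> cube P. tree_sum (coef \<tau>) h P x \<le> 4 * G}"
    have major: "ennreal (3 / 4 * side P ^ CARD('n)) \<le> emeasure lebesgue ?F"
      using major_1[OF \<tau> sP, of h] low_set by (simp del: emeasure_completion)
    have eqN: "emeasure N (cube P) = ennreal (4 / 3) * (av P * ennreal (3 / 4 * side P ^ CARD('n)))"
    proof -
      have "emeasure N (cube P) = av P * ennreal (side P ^ CARD('n))"
        unfolding av_def using sP by (simp add: ennreal_divide_times emeasure_N del: emeasure_completion)
      also have "\<dots> = av P * ennreal ((4 / 3) * (3 / 4 * side P ^ CARD('n)))" by simp
      also have "\<dots> = ennreal (4 / 3) * (av P * ennreal (3 / 4 * side P ^ CARD('n)))"
      proof -
        have "ennreal ((4 / 3) * (3 / 4 * side P ^ CARD('n))) = ennreal (4 / 3) * ennreal (3 / 4 * side P ^ CARD('n))"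
          by (intro ennreal_mult') simp
        then show ?thesis by (simp only: mult.left_commute)
      qed
      finally show ?thesis .
    qed
    have "emeasure N (cube P) \<le> ennreal (4 / 3) * (av P * emeasure lebesgue ?F)"
      unfolding eqN by (intro mult_left_mono major zero_le)
    also have "av P * emeasure lebesgue ?F = (\<integral>\<^sup>+x\<in>?F. av P \<partial>lebesgue)"
      using low_set by (simp add: nn_integral_cmult_indicator)
    also have "\<dots> \<le> (\<integral>\<^sup>+x\<in>?F. H x \<partial>lebesgue)"
    proof (intro nn_integral_mono)
      fix x
      have "av P \<le> H x" if "x \<in> cube P"
        unfolding H_def using that ss by (intro SUP_upper2[of ss]) auto
      then show "av P * indicator ?F x \<le> H x * indicator ?F x" by (auto simp: indicator_def)
    qed
    also have "ennreal (4 / 3) * \<dots> = emeasure ?R ?F" by (simp only: R[OF low_set])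
    finally show "emeasure N (cube P) \<le> emeasure ?R ?F" by (simp add: mult_left_mono)
  next
    have "Q = foldl child Q []" by simp
    then show "0 < side Q \<and> Q \<in> range (foldl child Q)" using Q by blast
  qed (use G in \<open>auto intro: scale_coeff_nonneg\<close>)
  also have "\<dots> \<le> ennreal (4 * G) * (ennreal (4 / 3) * (ennreal D * emeasure N (cube Q)))"
    unfolding R[OF cube_lebesgue] by (intro mult_left_mono int_H) auto
  also have "\<dots> = ennreal (4 * G * (4 / 3 * D)) * emeasure N (cube Q)"
    using G by (subst (2) ennreal_mult_assoc, simp, subst ennreal_mult_assoc) auto
  also have "4 * G * (4 / 3 * D) = 16 / 3 * G * D" by simp
  finally show ?thesis .
qed

section \<open>Distribution of the square sum\<close>

lemma Markov_power:
  fixes g :: "real^'n \<Rightarrow> real"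
  assumes [measurable]: "g \<in> borel_measurable lebesgue" and t: "0 < t"
  shows "emeasure N {x \<in> cube Q. t < g x} \<le> ennreal (1 / t ^ k) * (\<integral>\<^sup>+x\<in>cube Q. ennreal (g x ^ k) \<partial>N)"
proof -
  have H: "{x \<in> cube Q. t < g x} \<in> sets lebesgue" by (intro sets_cube_Collect) measurable
  have "emeasure N {x \<in> cube Q. t < g x} = (\<integral>\<^sup>+x. indicator {x \<in> cube Q. t < g x} x \<partial>N)"
    using H by simp
  also have "\<dots> \<le> (\<integral>\<^sup>+x. ennreal (1 / t ^ k) * (ennreal (g x ^ k) * indicator (cube Q) x) \<partial>N)"
  proof (intro nn_integral_mono)
    fix x
    have "1 \<le> ennreal (1 / t ^ k) * ennreal (g x ^ k)" if "t < g x"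
    proof -
      have "1 \<le> 1 / t ^ k * g x ^ k" using that t power_mono[of t "g x" k] by (simp add: field_simps)
      then have "ennreal 1 \<le> ennreal (1 / t ^ k * g x ^ k)" by (rule ennreal_leI)
      also have "\<dots> = ennreal (1 / t ^ k) * ennreal (g x ^ k)" using t by (intro ennreal_mult') simp
      finally show ?thesis by simp
    qed
    then show "indicator {x \<in> cube Q. t < g x} x \<le> ennreal (1 / t ^ k) * (ennreal (g x ^ k) * indicator (cube Q) x)"
      by (auto simp: indicator_def)
  qed
  also have "\<dots> = ennreal (1 / t ^ k) * (\<integral>\<^sup>+x\<in>cube Q. ennreal (g x ^ k) \<partial>N)"
    by (simp add: nn_integral_cmult)
  finally show ?thesis .
qed

abbreviation "\<beta> m \<equiv> tree_sum (coef (1 / 2 ^ m))"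
abbreviation "sq \<equiv> tree_sum (\<lambda>h Q. (b h Q)\<^sup>2)"

lemma \<beta>_nonneg: "0 \<le> \<beta> m h Q x"
  by (rule tree_sum_nonneg) (rule scale_coeff_nonneg)

text \<open>The form in which level sets are split: a point with large square sum lies in
  \<open>hit\<close> or exceeds its share \<open>q m\<close> at some scale.\<close>

lemma sq_le_sums:
  assumes x: "x \<in> cube Q" "x \<notin> hit a h Q" and q: "\<And>m. \<beta> m h Q x / 4 ^ m \<le> q m" "q sums s"
  shows "sq h Q x \<le> s"
proof -
  have q0: "0 \<le> q m" for m using q(1)[of m] \<beta>_nonneg[of m h Q x] by (meson divide_nonneg_nonneg order.trans zero_le_numeral zero_le_power)
  have s0: "0 \<le> s" using q(2) q0 by (metis sums_unique suminf_nonneg sums_summable)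
  have "ennreal (sq h Q x) \<le> (\<Sum>m. ennreal (\<beta> m h Q x / 4 ^ m))"
    using x by (intro tree_sum_le_scales b_zero a_nonneg)
  also have "\<dots> \<le> (\<Sum>m. ennreal (q m))" by (intro suminf_le ennreal_leI q) auto
  also have "\<dots> = ennreal s" using q(2) q0 by (intro suminf_ennreal_eq)
  finally show ?thesis using s0 by simp
qed

lemma \<beta>_integral:
  assumes Q: "0 < side Q"
  shows "tree_int N (coef (1 / 2 ^ m)) h Q \<le> ennreal (4 * G * 4 powr p * A * (2 powr p) ^ m) * I Q"
proof -
  have "(4 / (1 / 2 ^ m)) powr p = 4 powr p * (2 powr p) ^ m"
    by (simp add: powr_mult powr_powr powr_realpow[symmetric] mult.commute)
  then show ?thesis using tree_sum_N_le_I[of "1 / 2 ^ m" Q h] Q by (simp add: mult_ac)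
qed

text \<open>Scale \<open>m\<close> receives the share \<open>(1 - \<rho>) * \<rho> ^ m\<close> of
  the level 1. The Markov inequality costs \<open>2^(pm) / 4^m = \<rho>^(2m)\<close>, up to
  constants, divided by that share: half of the decay pays for the shares and the other half makes
  the series converge.\<close>

lemma weak_type_lt2:
  assumes p2: "p < 2" and Q: "0 < side Q"
  defines "\<rho> \<equiv> 2 powr ((p - 2) / 2)"
  shows "emeasure N {x \<in> cube Q. 1 < sq h Q x} \<le> ennreal ((1 + 4 * G * 4 powr p / (1 - \<rho>)\<^sup>2) * A) * I Q"
proof -
  have \<rho>: "0 < \<rho>" "\<rho> < 1" using p2 powr_less_mono[of "(p - 2) / 2" 0 "2::real"] by (auto simp: \<rho>_def)
  have \<rho>2: "2 powr p = 4 * \<rho>\<^sup>2"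
  proof -
    have "\<rho>\<^sup>2 = 2 powr (p - 2)" by (simp add: \<rho>_def power2_eq_square powr_add[symmetric])
    also have "\<dots> = 2 powr p / 4" by (simp add: powr_diff)
    finally show ?thesis by simp
  qed
  define E where "E m = {x \<in> cube Q. (1 - \<rho>) * \<rho> ^ m * 4 ^ m < \<beta> m h Q x}" for m
  have E[measurable]: "E m \<in> sets lebesgue" for m unfolding E_def by (intro sets_cube_Collect) measurable
  define c where "c = 4 * G * 4 powr p * A / (1 - \<rho>)"
  have c0: "0 \<le> c" using G A \<rho> by (simp add: c_def)
  have NE: "emeasure N (E m) \<le> ennreal (c * \<rho> ^ m) * I Q" for m
  proof -
    define t where "t = (1 - \<rho>) * \<rho> ^ m * 4 ^ m"
    have t: "0 < t" using \<rho> by (simp add: t_def)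
    have "emeasure N (E m) \<le> ennreal (1 / t ^ 1) * (\<integral>\<^sup>+x\<in>cube Q. ennreal (\<beta> m h Q x ^ 1) \<partial>N)"
      unfolding E_def t_def[symmetric] using t by (intro Markov_power) auto
    also have "\<dots> \<le> ennreal (1 / t) * (ennreal (4 * G * 4 powr p * A * (2 powr p) ^ m) * I Q)"
      using \<beta>_integral[OF Q, of m h] by (simp add: mult_left_mono)
    also have "\<dots> = ennreal (1 / t * (4 * G * 4 powr p * A * (2 powr p) ^ m)) * I Q"
      using t by (intro ennreal_mult_assoc) auto
    also have "1 / t * (4 * G * 4 powr p * A * (2 powr p) ^ m) = c * \<rho> ^ m"
    proof -
      have "(2 powr p) ^ m = 4 ^ m * \<rho> ^ m * \<rho> ^ m"
        unfolding \<rho>2 by (simp add: power_mult_distrib power2_eq_square)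
      then show ?thesis using \<rho> by (simp add: t_def c_def)
    qed
    finally show ?thesis .
  qed
  have sub: "{x \<in> cube Q. 1 < sq h Q x} \<subseteq> hit a h Q \<union> (\<Union>m. E m)"
  proof
    fix x assume x: "x \<in> {x \<in> cube Q. 1 < sq h Q x}"
    show "x \<in> hit a h Q \<union> (\<Union>m. E m)"
    proof (rule ccontr)
      assume n: "x \<notin> hit a h Q \<union> (\<Union>m. E m)"
      have "(\<lambda>m. (1 - \<rho>) * \<rho> ^ m) sums ((1 - \<rho>) * (1 / (1 - \<rho>)))"
        using \<rho> by (intro sums_mult geometric_sums) auto
      then have "(\<lambda>m. (1 - \<rho>) * \<rho> ^ m) sums 1" using \<rho> by simp
      moreover have "\<beta> m h Q x / 4 ^ m \<le> (1 - \<rho>) * \<rho> ^ m" for m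
        using n x by (auto simp: E_def not_less field_simps)
      ultimately have "sq h Q x \<le> 1" using x n by (intro sq_le_sums) auto
      then show False using x by simp
    qed
  qed
  have "emeasure N {x \<in> cube Q. 1 < sq h Q x} \<le> emeasure N (hit a h Q \<union> (\<Union>m. E m))"
    using sub by (intro emeasure_mono) auto
  also have "\<dots> \<le> emeasure N (hit a h Q) + emeasure N (\<Union>m. E m)"
    by (intro emeasure_subadditive) auto
  also have "\<dots> \<le> emeasure N (hit a h Q) + (\<Sum>m. emeasure N (E m))"
    by (intro add_left_mono emeasure_subadditive_countably) auto
  also have "\<dots> \<le> ennreal A * I Q + (\<Sum>m. ennreal (c * \<rho> ^ m) * I Q)"
    using hit_le[OF Q] NE by (intro add_mono suminf_le) auto
  also have "(\<Sum>m. ennreal (c * \<rho> ^ m) * I Q) = ennreal (c * (1 / (1 - \<rho>))) * I Q"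
  proof -
    have "(\<lambda>m. c * \<rho> ^ m) sums (c * (1 / (1 - \<rho>)))" using \<rho> by (intro sums_mult geometric_sums) auto
    then have "(\<Sum>m. ennreal (c * \<rho> ^ m)) = ennreal (c * (1 / (1 - \<rho>)))"
      using c0 \<rho> by (intro suminf_ennreal_eq) auto
    then show ?thesis by simp
  qed
  also have "ennreal A * I Q + ennreal (c * (1 / (1 - \<rho>))) * I Q = ennreal (A + c * (1 / (1 - \<rho>))) * I Q"
    using A c0 \<rho> by (subst ennreal_plus) (auto simp: distrib_right)
  also have "A + c * (1 / (1 - \<rho>)) = (1 + 4 * G * 4 powr p / (1 - \<rho>)\<^sup>2) * A"
    by (simp add: c_def distrib_right power2_eq_square)
  finally show ?thesis .
qed

text \<open>The scales below \<open>m0\<close> are treated together by the first moment; each costs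
  at most the value \<open>V\<close> reached at \<open>m0\<close>, and their number produces the
  logarithm. From \<open>m0\<close> on the \<open>k\<close>-th moment is used, with a geometric
  distribution of the remaining level.\<close>

lemma weak_type_ge2:
  assumes p2: "2 \<le> p" and Q: "0 < side Q" and L: "1 \<le> L"
    and car: "\<And>\<tau> h P. 0 < \<tau> \<Longrightarrow> 0 < side P \<Longrightarrow>
      tree_int N (coef \<tau>) h P \<le> ennreal L * emeasure N (cube P)"
  defines "k \<equiv> Suc (nat \<lceil>p\<rceil>)"
  shows "emeasure N {x \<in> cube Q. 1 < sq h Q x}
    \<le> ennreal ((1 + 4 powr ((p - 2) / 2) * (4 * G * 4 powr p) * (2 + 2 * fact k * 4 ^ k)) * A
        * (L powr ((p - 2) / 2) * (1 + ln L))) * I Q"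
proof -
  define M where "M = nat \<lceil>p\<rceil>"
  have kM: "k = Suc M" by (simp add: k_def M_def)
  \<comment> \<open>At scale \<open>m0 + j\<close> the moment contributes
    \<open>2^(pj) / 2^(jk)\<close>, and \<open>k \<ge> p + 1\<close> makes this at most
    \<open>2^-j\<close>.\<close>
  have pk: "p + 1 \<le> real k" unfolding kM M_def using p by linarith
  \<comment> \<open>Thus \<open>X = 4 ^ m0\<close> lies between \<open>L\<close> and
    \<open>4 * L\<close>, and \<open>V = (2 powr p / 4) ^ m0\<close> is comparable to
    \<open>L powr ((p - 2) / 2)\<close>.\<close>
  define m0 where "m0 = nat \<lceil>log 4 L\<rceil>"
  have lnL: "0 \<le> ln L" using L by simp
  have log0: "0 \<le> log 4 L" using L by simp
  have m0_ge: "log 4 L \<le> real m0" and m0_le: "real m0 \<le> log 4 L + 1" unfolding m0_def using log0 by linarith+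
  have "log 4 L \<le> ln L"
  proof -
    have "(1::real) \<le> ln 4" using ln_ge_iff[of 4 1] exp_le by simp
    then have "ln L / ln 4 \<le> ln L / 1" using lnL by (intro divide_left_mono) auto
    then show ?thesis by (simp add: log_def)
  qed
  then have m0_ln: "real m0 \<le> 1 + ln L" using m0_le by linarith
  define X where "X = (4::real) ^ m0"
  have XL: "L \<le> X"
  proof -
    have "L = 4 powr (log 4 L)" using L by simp
    also have "\<dots> \<le> 4 powr real m0" using m0_ge by (intro powr_mono) auto
    finally show ?thesis by (simp add: X_def powr_realpow)
  qed
  have X4L: "X \<le> 4 * L"
  proof -
    have "X = 4 powr real m0" by (simp add: X_def powr_realpow)
    also have "\<dots> \<le> 4 powr (log 4 L + 1)" using m0_le by (intro powr_mono) auto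
    also have "\<dots> = 4 * L" using L by (simp add: powr_add)
    finally show ?thesis .
  qed
  have X1: "1 \<le> X" using XL L by simp
  define V where "V = X powr ((p - 2) / 2)"
  have V1: "1 \<le> V" using X1 p2 by (auto simp: V_def intro!: ge_one_powr_ge_zero)
  have V_eq: "V = (2 powr p / 4) ^ m0"
  proof -
    have "V = (4 powr real m0) powr ((p - 2) / 2)" by (simp add: V_def X_def powr_realpow)
    also have "\<dots> = (2 powr 2) powr (real m0 * ((p - 2) / 2))" by (simp add: powr_powr)
    also have "\<dots> = 2 powr ((p - 2) * real m0)"
    proof -
      have "2 * (real m0 * ((p - 2) / 2)) = (p - 2) * real m0" by simp
      then show ?thesis unfolding powr_powr by (simp only:)
    qed
    also have "\<dots> = (2 powr (p - 2)) ^ m0" by (simp add: powr_powr[symmetric] powr_realpow)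
    also have "2 powr (p - 2) = 2 powr p / 4" by (simp add: powr_diff)
    finally show ?thesis .
  qed
  have V_le: "V \<le> 4 powr ((p - 2) / 2) * L powr ((p - 2) / 2)"
    using X4L X1 p2 L unfolding V_def by (subst powr_mult[symmetric]) (auto intro!: powr_mono2)
  define g where "g = 4 * G * 4 powr p"
  have g0: "0 \<le> g" using G by (simp add: g_def)
  have r1: "1 \<le> 2 powr p / 4"
    using p2 powr_mono[of 2 p "2::real"] by simp
  \<comment> \<open>Half of the level 1 is reserved for these scales.\<close>
  let ?S = "\<lambda>x. \<Sum>m<m0. \<beta> m h Q x / 4 ^ m"
  define E0 where "E0 = {x \<in> cube Q. 1 / 2 < ?S x}"
  have S_meas[measurable]: "?S \<in> borel_measurable lebesgue" by measurable
  have E0[measurable]: "E0 \<in> sets lebesgue" unfolding E0_def by (intro sets_cube_Collect) measurable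
  have NE0: "emeasure N E0 \<le> ennreal (2 * real m0 * g * A * V) * I Q"
  proof -
    have "emeasure N E0 \<le> ennreal (1 / (1 / 2) ^ 1) * (\<integral>\<^sup>+x\<in>cube Q. ennreal (?S x ^ 1) \<partial>N)"
      unfolding E0_def by (intro Markov_power) auto
    also have "(\<integral>\<^sup>+x\<in>cube Q. ennreal (?S x ^ 1) \<partial>N)
        = (\<integral>\<^sup>+x. (\<Sum>m<m0. ennreal (1 / 4 ^ m) * (ennreal (\<beta> m h Q x) * indicator (cube Q) x)) \<partial>N)"
    proof (intro nn_integral_cong)
      fix x
      have "ennreal (?S x ^ 1) = (\<Sum>m<m0. ennreal (\<beta> m h Q x / 4 ^ m))"
        unfolding power_one_right using \<beta>_nonneg by (intro sum_ennreal[symmetric]) simp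
      also have "\<dots> = (\<Sum>m<m0. ennreal (1 / 4 ^ m) * ennreal (\<beta> m h Q x))"
      proof (intro sum.cong refl)
        fix m
        have "ennreal (1 / 4 ^ m * \<beta> m h Q x) = ennreal (1 / 4 ^ m) * ennreal (\<beta> m h Q x)"
          by (intro ennreal_mult') simp
        then show "ennreal (\<beta> m h Q x / 4 ^ m) = ennreal (1 / 4 ^ m) * ennreal (\<beta> m h Q x)" by simp
      qed
      finally show "ennreal (?S x ^ 1) * indicator (cube Q) x
          = (\<Sum>m<m0. ennreal (1 / 4 ^ m) * (ennreal (\<beta> m h Q x) * indicator (cube Q) x))"
        by (simp only: sum_distrib_right mult.assoc)
    qed
    also have "\<dots> = (\<Sum>m<m0. ennreal (1 / 4 ^ m) * tree_int N (coef (1 / 2 ^ m)) h Q)"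
      by (subst nn_integral_sum) (auto simp: nn_integral_cmult)
    also have "\<dots> \<le> (\<Sum>m<m0. ennreal (g * A * V) * I Q)"
    proof (intro sum_mono)
      fix m assume m: "m \<in> {..<m0}"
      have "ennreal (1 / 4 ^ m) * tree_int N (coef (1 / 2 ^ m)) h Q
          \<le> ennreal (1 / 4 ^ m) * (ennreal (g * A * (2 powr p) ^ m) * I Q)"
        unfolding g_def by (intro mult_left_mono \<beta>_integral Q) auto
      also have "\<dots> = ennreal (1 / 4 ^ m * (g * A * (2 powr p) ^ m)) * I Q"
        by (rule ennreal_mult_assoc) simp
      also have "1 / 4 ^ m * (g * A * (2 powr p) ^ m) = g * A * (2 powr p / 4) ^ m"
        by (simp add: power_divide)
      also have "ennreal \<dots> * I Q \<le> ennreal (g * A * V) * I Q"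
        unfolding V_eq using m r1 g0 A by (intro mult_right_mono ennreal_leI mult_left_mono power_increasing) auto
      finally show "ennreal (1 / 4 ^ m) * tree_int N (coef (1 / 2 ^ m)) h Q \<le> ennreal (g * A * V) * I Q" .
    qed
    also have "\<dots> = ennreal (real m0) * (ennreal (g * A * V) * I Q)"
      by (simp add: ennreal_of_nat_eq_real_of_nat)
    also have "ennreal (1 / (1 / 2) ^ 1) * \<dots> = ennreal (2 * real m0 * g * A * V) * I Q"
      by (simp add: ennreal_mult_assoc mult.assoc del: ennreal_numeral)
    finally show ?thesis by (simp add: mult_left_mono)
  qed
  \<comment> \<open>The other half: scale \<open>m0 + j\<close> receives
    \<open>(1 / 4) * (1 / 2) ^ j\<close>, and \<open>X * 2 ^ j / 4\<close> is that share times
    \<open>4 ^ (m0 + j)\<close>.\<close>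
  define E where "E j = {x \<in> cube Q. X * 2 ^ j / 4 < \<beta> (m0 + j) h Q x}" for j
  have E[measurable]: "E j \<in> sets lebesgue" for j unfolding E_def by (intro sets_cube_Collect) measurable
  define c where "c = fact k * 4 ^ k * g * A * V"
  have c0: "0 \<le> c" using g0 A V1 by (simp add: c_def)
  have NE: "emeasure N (E j) \<le> ennreal (c * (1 / 2) ^ j) * I Q" for j
  proof -
    define t where "t = X * 2 ^ j / 4"
    have t: "0 < t" using X1 by (simp add: t_def)
    have L0: "0 \<le> L" using L by simp
    have "emeasure N (E j) \<le> ennreal (1 / t ^ k) * (\<integral>\<^sup>+x\<in>cube Q. ennreal (\<beta> (m0 + j) h Q x ^ k) \<partial>N)"
      unfolding E_def t_def[symmetric] using t by (intro Markov_power) auto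
    also have "\<dots> \<le> ennreal (1 / t ^ k) * (ennreal (fact k * L ^ M) * tree_int N (coef (1 / 2 ^ (m0 + j))) h Q)"
    proof (intro mult_left_mono)
      show "(\<integral>\<^sup>+x\<in>cube Q. ennreal (\<beta> (m0 + j) h Q x ^ k) \<partial>N)
          \<le> ennreal (fact k * L ^ M) * tree_int N (coef (1 / 2 ^ (m0 + j))) h Q"
        unfolding kM
      proof (rule tree_sum_moment[OF scale_coeff_nonneg sets_N L0])
        fix h and P :: "'n node"
        show "tree_int N (coef (1 / 2 ^ (m0 + j))) h P \<le> ennreal L * emeasure N (cube P)"
        proof (cases "0 < side P")
          case True
          then show ?thesis by (intro car) auto
        next
          case False
          then show ?thesis by (simp add: cube_empty)
        qed
      qed
    qed simp
    also have "\<dots> \<le> ennreal (1 / t ^ k) * (ennreal (fact k * L ^ M) * (ennreal (g * A * (2 powr p) ^ (m0 + j)) * I Q))"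
      unfolding g_def by (intro mult_left_mono \<beta>_integral Q) auto
    also have "\<dots> = ennreal (1 / t ^ k * ((fact k * L ^ M) * (g * A * (2 powr p) ^ (m0 + j)))) * I Q"
      using t L0 by (subst (2) ennreal_mult_assoc, simp, subst ennreal_mult_assoc) auto
    also have "\<dots> \<le> ennreal (c * (1 / 2) ^ j) * I Q"
    proof (intro mult_right_mono ennreal_leI)
      have e1: "1 / t ^ k = 4 ^ k / (X ^ k * (2 ^ j) ^ k)" by (simp add: t_def power_divide power_mult_distrib)
      have "(2 powr p) ^ j \<le> (2 ^ j) ^ k * (1 / 2) ^ j"
      proof -
        have "(2 powr p) ^ j \<le> (2 powr (real k - 1)) ^ j" using pk by (intro power_mono powr_mono) auto
        also have "2 powr (real k - 1) = 2 ^ k * (1 / 2)" by (simp add: powr_diff powr_realpow)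
        also have "(2 ^ k * (1 / 2)) ^ j = (2 ^ j) ^ k * (1 / 2 :: real) ^ j"
          by (simp add: power_mult_distrib power_mult[symmetric] mult.commute power_one_over power_divide)
        finally show ?thesis .
      qed
      then have e2: "(2 powr p) ^ j / (2 ^ j) ^ k \<le> (1 / 2) ^ j"
        by (simp add: divide_le_eq mult.commute)
      \<comment> \<open>Since \<open>L \<le> X\<close>, the \<open>M\<close> powers of
        \<open>L\<close> from the moment cancel against all but one of the \<open>k\<close> powers
        of \<open>X\<close>.\<close>
      have e3: "L ^ M * (2 powr p) ^ m0 / X ^ k \<le> V"
      proof -
        have "L ^ M * (2 powr p) ^ m0 / X ^ k \<le> X ^ M * (2 powr p) ^ m0 / X ^ k"
          using XL L0 X1 by (intro divide_right_mono mult_right_mono power_mono) auto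
        also have "\<dots> = (2 powr p) ^ m0 / X" using X1 by (simp add: kM)
        also have "\<dots> = V" by (simp add: V_eq X_def power_divide)
        finally show ?thesis .
      qed
      have "1 / t ^ k * ((fact k * L ^ M) * (g * A * (2 powr p) ^ (m0 + j)))
          = (fact k * 4 ^ k * g * A) * ((L ^ M * (2 powr p) ^ m0 / X ^ k) * ((2 powr p) ^ j / (2 ^ j) ^ k))"
        unfolding e1 by (simp add: power_add)
      also have "\<dots> \<le> (fact k * 4 ^ k * g * A) * (V * (1 / 2) ^ j)"
        using e2 e3 g0 A V1 X1 L0 by (intro mult_left_mono mult_mono) auto
      finally show "1 / t ^ k * ((fact k * L ^ M) * (g * A * (2 powr p) ^ (m0 + j))) \<le> c * (1 / 2) ^ j"
        by (simp add: c_def mult.assoc)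
    qed simp
    finally show ?thesis .
  qed
  have sub: "{x \<in> cube Q. 1 < sq h Q x} \<subseteq> hit a h Q \<union> E0 \<union> (\<Union>j. E j)"
  proof
    fix x assume x: "x \<in> {x \<in> cube Q. 1 < sq h Q x}"
    show "x \<in> hit a h Q \<union> E0 \<union> (\<Union>j. E j)"
    proof (rule ccontr)
      assume n: "x \<notin> hit a h Q \<union> E0 \<union> (\<Union>j. E j)"
      define q where "q m = (if m < m0 then \<beta> m h Q x / 4 ^ m else (1 / 4) * (1 / 2) ^ (m - m0))" for m
      have "(\<lambda>j. (1 / 4) * (1 / 2 :: real) ^ j) sums ((1 / 4) * (1 / (1 - 1 / 2)))"
        by (intro sums_mult geometric_sums) auto
      moreover have "(\<lambda>j. q (j + m0)) = (\<lambda>j. (1 / 4) * (1 / 2) ^ j)" by (simp add: q_def)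
      ultimately have "(\<lambda>j. q (j + m0)) sums ((1 / 4) * (1 / (1 - 1 / 2)))" by (simp only:)
      then have "q sums ((1 / 4) * (1 / (1 - 1 / 2)) + (\<Sum>m<m0. q m))"
        by (subst (asm) sums_iff_shift) auto
      moreover have "\<beta> m h Q x / 4 ^ m \<le> q m" for m
      proof (cases "m < m0")
        case False
        then obtain j where j: "m = m0 + j" using le_Suc_ex not_less by blast
        have "\<beta> m h Q x \<le> X * 2 ^ j / 4" using n x j by (auto simp: E_def not_less)
        then have "\<beta> m h Q x / 4 ^ m \<le> X * 2 ^ j / 4 / 4 ^ m" by (intro divide_right_mono) auto
        also have "\<dots> = q m"
        proof -
          have "(4::real) ^ j = 2 ^ j * 2 ^ j" by (simp flip: power_mult_distrib)
          then show ?thesis using j by (simp add: q_def X_def power_add power_divide)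
        qed
        finally show ?thesis .
      qed (simp add: q_def)
      ultimately have "sq h Q x \<le> (1 / 4) * (1 / (1 - 1 / 2)) + (\<Sum>m<m0. q m)"
        using x n by (intro sq_le_sums) auto
      moreover have "(\<Sum>m<m0. q m) = ?S x" by (simp add: q_def)
      moreover have "?S x \<le> 1 / 2" using n x by (auto simp: E0_def)
      ultimately show False using x by simp
    qed
  qed
  have "emeasure N {x \<in> cube Q. 1 < sq h Q x} \<le> emeasure N (hit a h Q \<union> E0 \<union> (\<Union>j. E j))"
    using sub by (intro emeasure_mono) auto
  also have "\<dots> \<le> emeasure N (hit a h Q) + emeasure N E0 + emeasure N (\<Union>j. E j)"
    by (intro order.trans[OF emeasure_subadditive] add_mono emeasure_subadditive) auto
  also have "\<dots> \<le> emeasure N (hit a h Q) + emeasure N E0 + (\<Sum>j. emeasure N (E j))"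
    by (intro add_left_mono emeasure_subadditive_countably) auto
  also have "\<dots> \<le> ennreal A * I Q + ennreal (2 * real m0 * g * A * V) * I Q + (\<Sum>j. ennreal (c * (1 / 2) ^ j) * I Q)"
    using hit_le[OF Q] NE NE0 by (intro add_mono suminf_le) auto
  also have "(\<Sum>j. ennreal (c * (1 / 2) ^ j) * I Q) = ennreal (c * 2) * I Q"
  proof -
    have "(\<lambda>j. c * (1 / 2) ^ j) sums (c * (1 / (1 - 1 / 2)))" by (intro sums_mult geometric_sums) auto
    then have "(\<Sum>j. ennreal (c * (1 / 2) ^ j)) = ennreal (c * (1 / (1 - 1 / 2)))"
      using c0 by (intro suminf_ennreal_eq) auto
    then show ?thesis by simp
  qed
  also have "ennreal A * I Q + ennreal (2 * real m0 * g * A * V) * I Q + ennreal (c * 2) * I Q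
      = ennreal (A + 2 * real m0 * g * A * V + c * 2) * I Q"
    using A c0 g0 V1 by (simp add: ennreal_plus distrib_right)
  also have "\<dots> \<le> ennreal ((1 + 4 powr ((p - 2) / 2) * g * (2 + 2 * fact k * 4 ^ k)) * A
        * (L powr ((p - 2) / 2) * (1 + ln L))) * I Q"
  proof (intro mult_right_mono ennreal_leI)
    define Y where "Y = L powr ((p - 2) / 2)"
    define e where "e = 4 powr ((p - 2) / 2)"
    have Y1: "1 \<le> Y" using L p2 by (auto simp: Y_def intro!: ge_one_powr_ge_zero)
    have VY: "V \<le> e * Y" using V_le by (simp add: e_def Y_def)
    have e0: "0 \<le> e" by (simp add: e_def)
    have Z1: "1 * 1 \<le> Y * (1 + ln L)" using Y1 lnL by (intro mult_mono) auto
    have "A + 2 * real m0 * g * A * V + c * 2 = A * 1 + (2 * g * A) * (V * real m0) + (2 * fact k * 4 ^ k * g * A) * (V * 1)"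
      by (simp add: c_def)
    also have "\<dots> \<le> A * (Y * (1 + ln L)) + (2 * g * A) * (e * Y * (1 + ln L)) + (2 * fact k * 4 ^ k * g * A) * (e * Y * (1 + ln L))"
      using A g0 Z1 VY V1 m0_ln lnL e0 Y1 by (intro add_mono mult_left_mono mult_mono) auto
    also have "\<dots> = (1 + e * g * (2 + 2 * fact k * 4 ^ k)) * A * (Y * (1 + ln L))"
      by (simp add: algebra_simps)
    finally show "A + 2 * real m0 * g * A * V + c * 2 \<le> (1 + 4 powr ((p - 2) / 2) * g * (2 + 2 * fact k * 4 ^ k)) * A
        * (L powr ((p - 2) / 2) * (1 + ln L))" by (simp add: e_def Y_def)
  qed simp
  finally show ?thesis by (simp add: g_def)
qed

end

section \<open>Shifted grids and the cone integral\<close>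

abbreviation square_sum :: "real \<Rightarrow> (real^'n \<Rightarrow> real) \<Rightarrow> nat \<Rightarrow> 'n::finite node \<Rightarrow> real^'n \<Rightarrow> real" where
  "square_sum \<theta> g \<equiv> tree_sum (\<lambda>h Q. (osc \<theta> (cube_avg g) (cube_avg (\<lambda>z. \<bar>g z\<bar>)) h Q)\<^sup>2)"

abbreviation weight_measure :: "(real^'n::finite \<Rightarrow> real) \<Rightarrow> (real^'n) measure" where
  "weight_measure w \<equiv> density lebesgue (\<lambda>x. ennreal (w x))"

section \<open>Paths of cubes at a point\<close>

definition upper_half :: "'n::finite node \<Rightarrow> real^'n \<Rightarrow> 'n set" where
  "upper_half Q x = {i. corner Q $ i + side Q / 2 \<le> x $ i}"

primrec node_at :: "nat \<Rightarrow> 'n::finite node \<Rightarrow> real^'n \<Rightarrow> 'n node" where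
  "node_at 0 = (\<lambda>Q x. Q)"
| "node_at (Suc j) = (\<lambda>Q x. node_at j (child Q (upper_half Q x)) x)"

lemma side_node_at [simp]: "side (node_at j Q x) = side Q / 2 ^ j"
  by (induction j arbitrary: Q) auto

lemma mem_cube_upper_half: "x \<in> cube Q \<Longrightarrow> x \<in> cube (child Q (upper_half Q x))"
  by (simp add: cube_child_iff upper_half_def)

lemma mem_cube_node_at: "x \<in> cube Q \<Longrightarrow> x \<in> cube (node_at j Q x)"
  by (induction j arbitrary: Q) (auto dest: mem_cube_upper_half)

lemma cube_node_at_subset: "cube (node_at j Q x) \<subseteq> cube Q"
proof (induction j arbitrary: Q)
  case (Suc j)
  then show ?case using cube_child_subset[of Q "upper_half Q x"] by (fastforce simp del: split_paired_All)
qed simp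

text \<open>The cells of one generation lie on a lattice through the top corner; this alone enters
  the comparison of shifted grids.\<close>

lemma corner_node_at: "\<exists>k::int. corner (node_at j Q x) $ i = corner Q $ i + side Q / 2 ^ j * of_int k"
proof (induction j arbitrary: Q)
  case 0
  show ?case by (rule exI[of _ 0]) simp
next
  case (Suc j)
  let ?R = "child Q (upper_half Q x)"
  obtain k where k: "corner (node_at j ?R x) $ i = corner ?R $ i + side ?R / 2 ^ j * of_int k" using Suc by blast
  let ?e = "if i \<in> upper_half Q x then 2 ^ j else 0 :: int"
  have "corner ?R $ i = corner Q $ i + side Q / 2 ^ Suc j * of_int ?e" by (simp add: child_def)
  then have "corner (node_at (Suc j) Q x) $ i = corner Q $ i + side Q / 2 ^ Suc j * of_int (?e + k)"
    using k by (simp only: node_at.simps side_child of_int_add distrib_left) simp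
  then show ?case by blast
qed

text \<open>One summand per generation: the form in which heights in the cone are matched with
  cubes.\<close>

lemma tree_sum_node_at:
  "x \<in> cube Q \<Longrightarrow> tree_sum c h Q x = (\<Sum>j\<le>h. c (h - j) (node_at j Q x))"
proof (induction h arbitrary: Q)
  case (Suc h)
  have "tree_sum c (Suc h) Q x = c (Suc h) Q + tree_sum c h (child Q (upper_half Q x)) x"
    using Suc.prems by (intro tree_sum_step mem_cube_upper_half)
  also have "\<dots> = c (Suc h) Q + (\<Sum>j\<le>h. c (h - j) (node_at (Suc j) Q x))"
    using Suc.IH[OF mem_cube_upper_half[OF Suc.prems]] by simp
  also have "\<dots> = (\<Sum>j\<le>Suc h. c (Suc h - j) (node_at j Q x))"
    by (subst sum.atMost_Suc_shift) simp
  finally show ?case .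
qed simp

text \<open>The one-third trick: each coordinate is or is not translated by a third of the top side,
  whence one grid per subset \<open>s\<close>. The side grows with \<open>N\<close> to exhaust the
  space. A top cube is not a cell of the grid for the next \<open>N\<close>.\<close>

definition top_cube :: "nat \<Rightarrow> 'n::finite set \<Rightarrow> 'n node" where
  "top_cube N s = Node (\<chi> i. - (2 ^ N) / 2 - (if i \<in> s then 2 ^ N / 3 else 0)) (2 ^ N)"

lemma side_top_cube [simp]: "side (top_cube N s) = 2 ^ N"
  by (simp add: top_cube_def)

text \<open>In units of \<open>2 ^ N\<close> the two possible intervals are
  \<open>[-1/2, 1/2)\<close> and \<open>[-5/6, 1/6)\<close>; both contain all numbers of modulus
  below \<open>1/6\<close>.\<close>

lemma mem_top_cube:
  assumes "\<And>i. \<bar>x $ i\<bar> < 2 ^ N / 6"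
  shows "x \<in> cube (top_cube N s)"
  unfolding cube_def mem_Collect_eq
proof
  fix i
  have "- (2 ^ N / 6) < x $ i" "x $ i < 2 ^ N / 6" using assms[of i] by linarith+
  moreover have "(0::real) < 2 ^ N" by simp
  ultimately show "corner (top_cube N s) $ i \<le> x $ i \<and> x $ i < corner (top_cube N s) $ i + side (top_cube N s)"
    unfolding top_cube_def node.sel vec_lambda_beta by (cases "i \<in> s") (simp_all only: if_True if_False, linarith+)
qed

text \<open>The grids of two top cubes differ by a third of the top side. Since 3 does not divide \<open>2 ^ j\<close>, their
  hyperplanes stay a third of the side length apart at every scale.\<close>

lemma one_third:
  fixes c u l r :: real and j :: nat
  assumes r: "0 < r" "2 * r \<le> l / 3" and L: "L = l * 2 ^ j"
    and near1: "\<bar>u - (c + l * of_int k1)\<bar> < r" and near2: "\<bar>u - (c - L / 3 + l * of_int k2)\<bar> < r"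
  shows False
proof -
  have l: "0 < l" using r by linarith
  have "l * \<bar>of_int (3 * (k1 - k2) + 2 ^ j)\<bar> = 3 * \<bar>(c + l * of_int k1) - (c - L / 3 + l * of_int k2)\<bar>"
  proof -
    have "3 * ((c + l * of_int k1) - (c - L / 3 + l * of_int k2)) = l * of_int (3 * (k1 - k2) + 2 ^ j)"
      unfolding L by (simp add: algebra_simps)
    then show ?thesis using l by (metis abs_mult abs_numeral abs_of_pos)
  qed
  also have "\<dots> < 3 * (2 * r)"
  proof -
    have "3 * \<bar>a - b\<bar> < 3 * (2 * r)" if "\<bar>u - a\<bar> < r" "\<bar>u - b\<bar> < r" for a b :: real
    proof -
      have "a - b < 2 * r" "b - a < 2 * r" using that unfolding abs_less_iff by linarith+
      then show ?thesis by (simp add: abs_less_iff)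
    qed
    from this[OF near1 near2] show ?thesis .
  qed
  also have "\<dots> \<le> l * 1" using r by simp
  finally have "\<bar>real_of_int (3 * (k1 - k2) + 2 ^ j)\<bar> < 1" using l by (simp only: mult_less_cancel_left_pos)
  then have "3 * (k1 - k2) + 2 ^ j = 0" by linarith
  then have "(3::int) dvd 2 ^ j" by (metis add.commute add_diff_cancel_left' diff_0 dvd_minus_iff dvd_triv_left)
  then have "(3::int) dvd 2" by (rule prime_dvd_power[rotated]) simp
  then show False by simp
qed

text \<open>Coordinates are treated separately. Shift exactly those in which \<open>x\<close> is
  within \<open>r\<close> of a face of its unshifted cell; by \<open>one_third\<close> it is then
  far from the faces of the shifted one.\<close>

lemma shifted_cube_contains:
  fixes x :: "real^'n"
  assumes r: "0 < r" "2 * r \<le> 2 ^ N / 2 ^ j / 3" and x: "\<And>s. x \<in> cube (top_cube N s :: 'n node)"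
  obtains s where "\<And>z. norm (z - x) < r \<Longrightarrow> z \<in> cube (node_at j (top_cube N s) x)"
proof -
  define l :: real where "l = 2 ^ N / 2 ^ j"
  have l: "0 < l" by (simp add: l_def)
  have Ll: "2 ^ N = l * 2 ^ j" by (simp add: l_def)
  define c where "c s i = corner (node_at j (top_cube N s) x) $ i" for s :: "'n set" and i :: 'n
  define bad where "bad s i = (x $ i - r < c s i \<or> c s i + l < x $ i + r)" for s i
  have c_in: "c s i \<le> x $ i" "x $ i < c s i + l" for s i
    using mem_cube_node_at[OF x[of s], of j] by (auto simp: cube_def c_def l_def)
  have c_int: "\<exists>k::int. c s i = - (2 ^ N) / 2 - (if i \<in> s then 2 ^ N / 3 else 0) + l * of_int k" for s i
    using corner_node_at[of j "top_cube N s" x i] by (simp add: c_def l_def top_cube_def)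
  have near: "\<exists>k::int. \<bar>x $ i - (- (2 ^ N) / 2 - (if i \<in> s then 2 ^ N / 3 else 0) + l * of_int k)\<bar> < r" if b: "bad s i" for s i
  proof -
    obtain k :: int where k: "c s i = - (2 ^ N) / 2 - (if i \<in> s then 2 ^ N / 3 else 0) + l * of_int k" using c_int by blast
    show ?thesis
    proof (cases "x $ i - r < c s i")
      case True
      then have "\<bar>x $ i - c s i\<bar> < r" using c_in[where s=s and i=i] by linarith
      then show ?thesis unfolding k by blast
    next
      case False
      then have "\<bar>x $ i - (c s i + l)\<bar> < r" using c_in[where s=s and i=i] b by (auto simp: bad_def)
      moreover have e: "c s i + l = - (2 ^ N) / 2 - (if i \<in> s then 2 ^ N / 3 else 0) + l * of_int (k + 1)"
        unfolding k by (simp add: distrib_left)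
      ultimately show ?thesis unfolding e by blast
    qed
  qed
  define s where "s = {i. bad {} i}"
  have good: "\<not> bad s i" for i
  proof
    assume b: "bad s i"
    show False
    proof (cases "i \<in> s")
      case True
      then have "bad {} i" by (simp add: s_def)
      from near[OF this] obtain k1 :: int where k1: "\<bar>x $ i - (- (2 ^ N) / 2 + l * of_int k1)\<bar> < r" by auto
      from near[OF b] True obtain k2 :: int
        where k2: "\<bar>x $ i - (- (2 ^ N) / 2 - 2 ^ N / 3 + l * of_int k2)\<bar> < r" by auto
      show False by (rule one_third[OF r(1) r(2)[folded l_def] Ll k1 k2])
    next
      \<comment> \<open>The nodes for \<open>s\<close> and for \<open>{}\<close> are different
        cubes, but in an unshifted coordinate their intervals come from one lattice and both contain
        \<open>x $ i\<close>, so they coincide.\<close>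
      case False
      then have nb: "\<not> bad {} i" by (simp add: s_def)
      obtain k1 k2 :: int where k: "c s i = - (2 ^ N) / 2 + l * of_int k1" "c {} i = - (2 ^ N) / 2 + l * of_int k2"
        using c_int[of s i] c_int[of "{}" i] False by auto
      have "\<bar>c s i - c {} i\<bar> < l" using c_in[where s=s and i=i] c_in[where s="{}" and i=i] by linarith
      then have "\<bar>l * of_int (k1 - k2)\<bar> < l * 1" unfolding k by (simp add: right_diff_distrib)
      then have "\<bar>real_of_int (k1 - k2)\<bar> < 1" using l by (simp only: abs_mult abs_of_pos mult_less_cancel_left_pos)
      then have "k1 = k2" by linarith
      then have "c s i = c {} i" using k by simp
      then show False using b nb by (simp add: bad_def)
    qed
  qed
  show ?thesis
  proof (rule that[of s])
    fix z :: "real^'n" assume z: "norm (z - x) < r"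
    show "z \<in> cube (node_at j (top_cube N s) x)"
      unfolding cube_def
    proof (clarsimp simp flip: c_def l_def)
      fix i
      have "\<bar>(z - x) $ i\<bar> < r" using component_le_norm_cart[of "z - x" i] z by linarith
      then show "c s i \<le> z $ i \<and> z $ i < c s i + l" using good[of i] by (auto simp: bad_def abs_less_iff)
    qed
  qed
qed

section \<open>Convolution with one dilated Hoelder function\<close>

lemma dilate_reflect_integral:
  fixes \<gamma> :: "real^'n \<Rightarrow> real"
  assumes [measurable]: "\<gamma> \<in> borel_measurable borel" and t: "0 < t" and z: "(\<integral>x. \<gamma> x \<partial>lebesgue) = 0"
  shows "(\<integral>z. dilate t \<gamma> (y - z) \<partial>lebesgue) = 0"
proof -
  have \<gamma>0: "(\<integral>x. \<gamma> x \<partial>lborel) = 0" using z by (simp add: integral_completion)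
  have m: "(\<lambda>z. dilate t \<gamma> (y - z)) \<in> borel_measurable borel" unfolding dilate_def by measurable
  have arg: "(y - (y + (- t) *\<^sub>R x)) /\<^sub>R t = x" for x using t by simp
  have "(\<integral>z. dilate t \<gamma> (y - z) \<partial>lborel)
      = (\<integral>z. dilate t \<gamma> (y - z) \<partial>density (distr lborel borel (\<lambda>x. y + (- t) *\<^sub>R x)) (\<lambda>_. \<bar>- t\<bar> ^ DIM(real^'n)))"
    using t lborel_affine[of "- t" y] by simp
  also have "\<dots> = (\<integral>z. \<bar>- t\<bar> ^ DIM(real^'n) * dilate t \<gamma> (y - z) \<partial>distr lborel borel (\<lambda>x. y + (- t) *\<^sub>R x))"
    using m by (subst integral_density) auto
  also have "\<dots> = (\<integral>x. \<bar>- t\<bar> ^ DIM(real^'n) * dilate t \<gamma> (y - (y + (- t) *\<^sub>R x)) \<partial>lborel)"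
    using m by (subst integral_distr) auto
  also have "\<dots> = (\<integral>x. \<bar>- t\<bar> ^ DIM(real^'n) / t ^ CARD('n) * \<gamma> x \<partial>lborel)"
    unfolding dilate_def arg by simp
  also have "\<dots> = 0" using \<gamma>0 by simp
  finally show ?thesis using m by (simp add: integral_completion)
qed

lemma holder_class_borel:
  fixes \<gamma> :: "real^'n \<Rightarrow> real"
  assumes "\<gamma> \<in> holder_class \<alpha>" and \<alpha>: "0 < \<alpha>"
  shows "\<gamma> \<in> borel_measurable borel"
proof (rule borel_measurable_continuous_onI, unfold continuous_on_def, intro ballI)
  fix x :: "real^'n"
  have "((\<lambda>y. norm (y - x) powr \<alpha>) \<longlongrightarrow> 0) (at x)"
  proof -
    have "((\<lambda>y. norm (y - x)) \<longlongrightarrow> 0) (at x)" by (intro tendsto_norm_zero LIM_zero) auto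
    then show ?thesis using \<alpha> by (intro tendsto_zero_powrI[OF _ tendsto_const]) auto
  qed
  then have "((\<lambda>y. \<gamma> y - \<gamma> x) \<longlongrightarrow> 0) (at x)"
  proof (rule Lim_null_comparison[rotated])
    show "\<forall>\<^sub>F y in at x. norm (\<gamma> y - \<gamma> x) \<le> norm (y - x) powr \<alpha>"
      using assms(1) by (intro always_eventually) (simp add: holder_class_def)
  qed
  then show "(\<gamma> \<longlongrightarrow> \<gamma> x) (at x within UNIV)" by (simp add: LIM_zero_iff)
qed

text \<open>The factor \<open>H * (sqrt n * l) powr \<alpha> * l ^ n\<close> of
  \<open>osc_controls_pairing\<close> at \<open>t = l / 32\<close>, where
  \<open>H = t powr - \<alpha> / t ^ n\<close> is the Hoelder constant of the dilate. Larger
  \<open>t\<close> only decreases it.\<close>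

definition pair_const :: "nat \<Rightarrow> real \<Rightarrow> real" where
  "pair_const n \<alpha> = 32 ^ n * 32 powr \<alpha> * sqrt n powr \<alpha>"

text \<open>The function \<open>z \<mapsto> dilate t \<gamma> (y - z)\<close> lives inside
  \<open>R\<close> and has integral 0, so the pairing bound loses its product of means. The function
  \<open>f1\<close> stands for the cut-off and rescaled \<open>f\<close>; the two need to match on
  \<open>R\<close> only.\<close>

lemma intrinsic_sup_le_osc:
  fixes f :: "real^'n \<Rightarrow> real" and x y :: "real^'n"
  assumes \<alpha>: "0 < \<alpha>" and \<sigma>: "0 < \<sigma>"
    and f1: "integrable lebesgue f1" and f_f1: "\<And>z. z \<in> cube R \<Longrightarrow> f z = \<sigma> * f1 z"
    and R: "0 < side R" and sub: "\<And>z. norm (y - z) \<le> t \<Longrightarrow> z \<in> cube R" and t: "side R / 32 \<le> t"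
  shows "intrinsic_sup \<alpha> f y t \<le> ennreal (\<sigma> * (pair_const CARD('n) \<alpha>
      * osc (2 powr - \<alpha>) (cube_avg f1) (cube_avg (\<lambda>z. \<bar>f1 z\<bar>)) h R))"
  unfolding intrinsic_sup_def
proof (rule SUP_least)
  fix \<gamma> :: "real^'n \<Rightarrow> real" assume \<gamma>: "\<gamma> \<in> holder_class \<alpha>"
  have t0: "0 < t" using R t by linarith
  let ?n = "CARD('n)"
  let ?b = "osc (2 powr - \<alpha>) (cube_avg f1) (cube_avg (\<lambda>z. \<bar>f1 z\<bar>)) h R"
  define \<phi> where "\<phi> z = dilate t \<gamma> (y - z)" for z
  have \<gamma>m[measurable]: "\<gamma> \<in> borel_measurable borel" using \<gamma> \<alpha> by (rule holder_class_borel)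
  have \<phi>m: "\<phi> \<in> borel_measurable borel" unfolding \<phi>_def dilate_def by measurable
  then have \<phi>m'[measurable]: "\<phi> \<in> borel_measurable lebesgue" by (intro measurable_completion) simp
  have \<phi>0: "\<phi> z = 0" if "z \<notin> cube R" for z
  proof -
    have "t < norm (y - z)" using sub[of z] that by force
    moreover have "norm ((y - z) /\<^sub>R t) = norm (y - z) / t" using t0 by (simp add: divide_inverse mult.commute)
    ultimately have "1 < norm ((y - z) /\<^sub>R t)" using t0 by simp
    then show ?thesis using \<gamma> by (simp add: \<phi>_def dilate_def holder_class_def)
  qed
  define H where "H = t powr - \<alpha> / t ^ ?n"
  have H0: "0 \<le> H" using t0 by (simp add: H_def)
  have hol: "\<bar>\<phi> z - \<phi> z'\<bar> \<le> H * norm (z - z') powr \<alpha>" for z z'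
  proof -
    have "\<phi> z - \<phi> z' = (\<gamma> ((y - z) /\<^sub>R t) - \<gamma> ((y - z') /\<^sub>R t)) / t ^ ?n"
      by (simp add: \<phi>_def dilate_def diff_divide_distrib)
    then have "\<bar>\<phi> z - \<phi> z'\<bar> = \<bar>\<gamma> ((y - z) /\<^sub>R t) - \<gamma> ((y - z') /\<^sub>R t)\<bar> / t ^ ?n"
      using t0 by simp
    also have "\<dots> \<le> norm ((y - z) /\<^sub>R t - (y - z') /\<^sub>R t) powr \<alpha> / t ^ ?n"
      using \<gamma> t0 by (intro divide_right_mono) (auto simp: holder_class_def)
    also have "(y - z) /\<^sub>R t - (y - z') /\<^sub>R t = (z' - z) /\<^sub>R t" by (simp flip: scaleR_diff_right)
    also have "norm ((z' - z) /\<^sub>R t) = norm (z - z') / t" using t0 by (simp add: norm_minus_commute divide_inverse mult.commute)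
    also have "(norm (z - z') / t) powr \<alpha> / t ^ ?n = H * norm (z - z') powr \<alpha>"
      using t0 by (simp add: H_def powr_divide powr_minus_divide)
    finally show ?thesis .
  qed
  have J: "(cube_integral \<phi> R) = 0"
  proof -
    have "(\<lambda>z. indicator (cube R) z * \<phi> z) = \<phi>" using \<phi>0 by (auto simp: indicator_def fun_eq_iff)
    moreover have "(\<integral>z. \<phi> z \<partial>lebesgue) = 0"
      unfolding \<phi>_def using \<gamma> t0 by (intro dilate_reflect_integral) (auto simp: holder_class_def)
    ultimately show ?thesis by simp
  qed
  have conv: "convolve f (dilate t \<gamma>) y = \<sigma> * (cube_integral (\<lambda>z. f1 z * \<phi> z) R)"
  proof -
    have "(\<lambda>z. f z * dilate t \<gamma> (y - z)) = (\<lambda>z. \<sigma> * (indicator (cube R) z * (f1 z * \<phi> z)))"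
      using \<phi>0 f_f1 by (auto simp: \<phi>_def[symmetric] indicator_def fun_eq_iff)
    then show ?thesis by (simp add: convolve_def)
  qed
  have "\<bar>cube_integral (\<lambda>z. f1 z * \<phi> z) R\<bar> \<le> H * (sqrt ?n * side R) powr \<alpha> * side R ^ ?n * ?b"
    using osc_controls_pairing[OF f1 \<phi>m' \<alpha> H0 hol R, of h] J by simp
  also have "\<dots> \<le> pair_const ?n \<alpha> * ?b"
  proof (rule mult_right_mono)
    have "H \<le> (side R / 32) powr - \<alpha> / (side R / 32) ^ ?n"
      unfolding H_def using t R \<alpha> t0 by (intro frac_le powr_mono2' power_mono) auto
    then have "H * (sqrt ?n * side R) powr \<alpha> * side R ^ ?n
        \<le> (side R / 32) powr - \<alpha> / (side R / 32) ^ ?n * (sqrt ?n * side R) powr \<alpha> * side R ^ ?n"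
      using R by (intro mult_right_mono) auto
    also have "\<dots> = pair_const ?n \<alpha>"
      using R by (simp add: pair_const_def powr_minus_divide powr_divide powr_mult power_divide)
    finally show "H * (sqrt ?n * side R) powr \<alpha> * side R ^ ?n \<le> pair_const ?n \<alpha>" .
    have "2 powr - \<alpha> < 1" using \<alpha> powr_less_mono[of "- \<alpha>" 0 "2::real"] by simp
    then show "0 \<le> ?b" using f1 by (intro osc_nonneg cube_avg_child cube_avg_abs) auto
  qed
  finally show "ennreal \<bar>convolve f (dilate t \<gamma>) y\<bar> \<le> ennreal (\<sigma> * (pair_const ?n \<alpha> * ?b))"
    unfolding conv using \<sigma> by (intro ennreal_leI) (simp add: abs_mult)
qed

text \<open>No measurability of \<open>g\<close> is needed, because \<open>nn_integral\<close> is a supremum over simple minorants.\<close>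

lemma nn_integral_le_SUP_indicator:
  assumes A: "\<And>N. A N \<in> sets M" "incseq A" and g: "\<And>z. g z \<noteq> 0 \<Longrightarrow> \<exists>N. z \<in> A N"
  shows "(\<integral>\<^sup>+z. g z \<partial>M) \<le> (SUP N. \<integral>\<^sup>+z. g z * indicator (A N) z \<partial>M)"
  unfolding nn_integral_def[of M g]
proof (rule SUP_least)
  fix s assume s: "s \<in> {s. simple_function M s \<and> s \<le> g}"
  then have sf: "simple_function M s" and sg: "\<And>z. s z \<le> g z" by (auto simp: le_fun_def)
  have [measurable]: "s \<in> borel_measurable M" using sf by (rule borel_measurable_simple_function)
  have [measurable]: "A N \<in> sets M" for N by (rule A)
  have "integral\<^sup>S M s = (\<integral>\<^sup>+z. s z \<partial>M)" using sf by (simp add: nn_integral_eq_simple_integral)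
  also have "\<dots> = (\<integral>\<^sup>+z. (SUP N. s z * indicator (A N) z) \<partial>M)"
  proof (intro nn_integral_cong)
    fix z
    show "s z = (SUP N. s z * indicator (A N) z)"
    proof (cases "s z = 0")
      case False
      then have "g z \<noteq> 0" using sg[of z] by (cases "g z = 0") auto
      then obtain N where "z \<in> A N" using g by blast
      then have "s z \<le> (SUP N. s z * indicator (A N) z)" by (intro SUP_upper2[of N]) auto
      moreover have "(SUP N. s z * indicator (A N) z) \<le> s z" by (intro SUP_least) (auto simp: indicator_def)
      ultimately show ?thesis by simp
    qed simp
  qed
  also have "\<dots> = (SUP N. \<integral>\<^sup>+z. s z * indicator (A N) z \<partial>M)"
  proof (rule nn_integral_monotone_convergence_SUP)
    show "incseq (\<lambda>N z. s z * indicator (A N) z)"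
    proof (intro incseq_SucI le_funI mult_left_mono)
      fix N z
      show "indicator (A N) z \<le> (indicator (A (Suc N)) z :: ennreal)"
        using incseq_SucD[OF A(2), of N] by (auto simp: indicator_def)
    qed simp
  qed measurable
  also have "\<dots> \<le> (SUP N. \<integral>\<^sup>+z. g z * indicator (A N) z \<partial>M)"
    using sg by (intro SUP_mono') (auto intro!: nn_integral_mono mult_right_mono)
  finally show "integral\<^sup>S M s \<le> (SUP N. \<integral>\<^sup>+z. g z * indicator (A N) z \<partial>M)" .
qed

section \<open>Splitting the cone by height\<close>

lemma emeasure_cbox_Times:
  fixes Q :: "'n::finite node"
  assumes "0 \<le> side Q" "u \<le> v"
  shows "emeasure lborel (closed_cube Q \<times> {u..v})
    = ennreal (side Q ^ CARD('n) * (v - u))"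
proof -
  have "emeasure (lborel \<Otimes>\<^sub>M lborel) (closed_cube Q \<times> {u..v})
      = emeasure lborel (closed_cube Q) * emeasure lborel {u..v}"
    by (intro lborel.emeasure_pair_measure_Times) auto
  then show ?thesis using assms emeasure_cbox_side(1)[OF assms(1)] by (simp add: lborel_prod ennreal_mult)
qed

lemma ex_scale:
  fixes t B :: real
  assumes "B / 2 ^ h / 2 \<le> t" "t < B" "0 < B"
  obtains j where "j \<le> h" "B / 2 ^ j / 2 \<le> t" "t < B / 2 ^ j"
proof -
  define j where "j = (LEAST j. B / 2 ^ j / 2 \<le> t)"
  have 1: "B / 2 ^ j / 2 \<le> t" unfolding j_def using assms(1) by (rule LeastI)
  have 2: "j \<le> h" unfolding j_def using assms(1) by (rule Least_le)
  have 3: "t < B / 2 ^ j"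
  proof (cases j)
    case 0
    then show ?thesis using assms by simp
  next
    case (Suc i)
    then have "\<not> B / 2 ^ i / 2 \<le> t" using not_less_Least[of i "\<lambda>j. B / 2 ^ j / 2 \<le> t"] by (simp add: j_def)
    then show ?thesis using Suc by (simp add: mult.commute)
  qed
  show ?thesis using 1 2 3 that by blast
qed

text \<open>Cubes of side \<open>l\<close> serve the heights from \<open>l / 32\<close> to
  \<open>l / 16\<close>. The sides \<open>2 ^ N / 2 ^ j\<close> with \<open>j \<le> 2 * N\<close>
  then cover exactly this range.\<close>

definition slab :: "nat \<Rightarrow> ((real^'n::finite) \<times> real) set" where
  "slab N = {z. 1 / 32 / 2 ^ N \<le> snd z \<and> snd z < 2 ^ N / 16}"

lemma slab_borel: "slab N \<in> sets lebesgue"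
proof -
  have S: "slab N = {z :: (real^'n) \<times> real. 1 / 32 / 2 ^ N \<le> snd z} \<inter> {z. snd z < 2 ^ N / 16}"
    unfolding slab_def by auto
  have "slab N \<in> sets (borel :: ((real^'n) \<times> real) measure)"
    unfolding S by (intro sets.Int borel_closed borel_open closed_Collect_le open_Collect_less continuous_intros)
  then show ?thesis by (intro sets_completionI_sets) (simp only: sets_lborel)
qed

lemma slab_incseq: "incseq (slab :: nat \<Rightarrow> ((real^'n::finite) \<times> real) set)"
proof (rule incseq_SucI, rule subsetI)
  fix N and z :: "(real^'n) \<times> real" assume "z \<in> slab N"
  then have z: "1 / 32 / 2 ^ N \<le> snd z" "snd z < 2 ^ N / 16"
    unfolding slab_def by auto
  have "1 / 32 / 2 ^ Suc N \<le> (1 / 32 / 2 ^ N :: real)" "2 ^ N / 16 \<le> (2 ^ Suc N / 16 :: real)"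
    by (auto simp: field_simps)
  then show "z \<in> slab (Suc N)" using z unfolding slab_def by auto
qed

lemma slab_exhaust:
  fixes z :: "(real^'n::finite) \<times> real"
  assumes "0 < snd z" shows "\<exists>N. z \<in> slab N"
proof -
  obtain n1 where n1: "16 * snd z < 2 ^ n1" using real_arch_pow[of 2 "16 * snd z"] by auto
  obtain n2 where n2: "1 / (32 * snd z) < 2 ^ n2" using real_arch_pow[of 2 "1 / (32 * snd z)"] by auto
  define N where "N = max n1 n2"
  have "(2::real) ^ n1 \<le> 2 ^ N" "(2::real) ^ n2 \<le> 2 ^ N" by (auto simp: N_def intro: power_increasing)
  then have "16 * snd z < 2 ^ N" "1 / (32 * snd z) < 2 ^ N" using n1 n2 by linarith+
  then have "1 / 32 / 2 ^ N \<le> snd z" "snd z < 2 ^ N / 16" using assms by (auto simp: field_simps)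
  then show ?thesis unfolding slab_def by blast
qed

text \<open>The part of the cone at heights between \<open>l / 32\<close> and \<open>l / 16\<close>
  fits into the box \<open>B j\<close> of base side \<open>l / 8\<close>. Its volume against
  \<open>(l / 32) ^ (n + 1)\<close> leaves \<open>4 ^ n\<close>. The integrand is first bounded
  pointwise by a step function, so no measurability of \<open>g\<close> is involved.\<close>

lemma truncated_cone_integral_le:
  fixes x :: "real^'n" and g :: "(real^'n) \<times> real \<Rightarrow> ennreal" and v :: "nat \<Rightarrow> real"
  assumes v: "\<And>j. 0 \<le> v j"
    and g: "\<And>j y t. j \<le> 2 * N \<Longrightarrow> norm (x - y) < t \<Longrightarrow> 2 ^ N / 2 ^ j / 32 \<le> t \<Longrightarrow> t < 2 ^ N / 2 ^ j / 16 \<Longrightarrow>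
      g (y, t) \<le> ennreal (v j)"
  shows "(\<integral>\<^sup>+z. (case z of (y, t) \<Rightarrow> g (y, t) / ennreal (t ^ (CARD('n) + 1))) * indicator (cone x) z * indicator (slab N) z \<partial>lebesgue)
    \<le> ennreal (4 ^ CARD('n) * (\<Sum>j\<le>2 * N. v j))"
proof -
  let ?n = "CARD('n)"
  define l where "l j = (2 ^ N / 2 ^ j :: real)" for j :: nat
  have l: "0 < l j" for j by (simp add: l_def)
  define Q where "Q j = Node (\<chi> i. x $ i - l j / 16) (l j / 8)" for j
  define B where "B j = closed_cube (Q j) \<times> {l j / 32..l j / 16}" for j
  have Bm: "B j \<in> sets borel" for j unfolding B_def by (intro borel_closed closed_Times) auto
  have Bl: "B j \<in> sets lebesgue" for j using Bm[of j] by (intro sets_completionI_sets) (simp only: sets_lborel)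
  have vol: "emeasure lebesgue (B j) = ennreal ((l j / 8) ^ ?n * (l j / 32))" for j
    using l[of j] Bm[of j] emeasure_cbox_Times[of "Q j" "l j / 32" "l j / 16"] by (simp add: Q_def B_def)
  have pt: "(case z of (y, t) \<Rightarrow> g (y, t) / ennreal (t ^ (?n + 1))) * indicator (cone x) z * indicator (slab N) z
      \<le> (\<Sum>j\<le>2 * N. ennreal (v j / (l j / 32) ^ (?n + 1)) * indicator (B j) z)" for z
  proof (cases "z \<in> cone x \<and> z \<in> slab N")
    case False
    then show ?thesis by (auto simp: indicator_def)
  next
    case True
    obtain y t where z: "z = (y, t)" by (cases z)
    have yt: "0 < t" "norm (x - y) < t" using True by (auto simp: z cone_def)
    obtain j where j: "j \<le> 2 * N" "l j / 32 \<le> t" "t < l j / 16"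
    proof (rule ex_scale[of "2 ^ N / 16" "2 * N" t])
      have "2 ^ N / 16 / 2 ^ (2 * N) / 2 = (1 / 32 / 2 ^ N :: real)"
        by (simp add: power_mult power2_eq_square power_mult_distrib mult_2 power_add)
      then show "2 ^ N / 16 / 2 ^ (2 * N) / 2 \<le> t" "t < 2 ^ N / 16" using True unfolding z slab_def by auto
    qed (auto simp: l_def)
    have zB: "z \<in> B j"
    proof -
      have near: "\<bar>x $ i - y $ i\<bar> < l j / 16" for i
        using component_le_norm_cart[of "x - y" i] yt j by simp
      have "x $ i - l j / 16 \<le> y $ i \<and> y $ i \<le> x $ i - l j / 16 + l j / 8" for i
        using near[of i] by linarith
      then show ?thesis using j by (auto simp: z B_def Q_def mem_box_cart)
    qed
    have pw: "(l j / 32) ^ (?n + 1) \<le> t ^ (?n + 1)" using j l[of j] by (intro power_mono) auto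
    have "g (y, t) / ennreal (t ^ (?n + 1)) \<le> ennreal (v j) / ennreal (t ^ (?n + 1))"
      using g[OF j(1) yt(2)] j by (intro divide_right_mono_ennreal) (auto simp: l_def)
    also have "\<dots> = ennreal (v j / t ^ (?n + 1))" using v yt by (intro divide_ennreal) auto
    also have "\<dots> \<le> ennreal (v j / (l j / 32) ^ (?n + 1))"
      using pw v l[of j] yt by (intro ennreal_leI divide_left_mono) auto
    also have "\<dots> = (\<Sum>j\<in>{j}. ennreal (v j / (l j / 32) ^ (?n + 1)) * indicator (B j) z)" using zB by simp
    also have "\<dots> \<le> (\<Sum>j\<le>2 * N. ennreal (v j / (l j / 32) ^ (?n + 1)) * indicator (B j) z)"
      using j by (intro sum_mono2) auto
    finally show ?thesis using True by (simp add: z)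
  qed
  have "(\<integral>\<^sup>+z. (case z of (y, t) \<Rightarrow> g (y, t) / ennreal (t ^ (?n + 1))) * indicator (cone x) z * indicator (slab N) z \<partial>lebesgue)
      \<le> (\<integral>\<^sup>+z. (\<Sum>j\<le>2 * N. ennreal (v j / (l j / 32) ^ (?n + 1)) * indicator (B j) z) \<partial>lebesgue)"
    by (intro nn_integral_mono pt)
  also have "\<dots> = (\<Sum>j\<le>2 * N. ennreal (v j / (l j / 32) ^ (?n + 1)) * emeasure lebesgue (B j))"
    using Bl by (subst nn_integral_sum)
      (auto simp: nn_integral_cmult_indicator simp del: emeasure_completion
        intro!: borel_measurable_times_ennreal borel_measurable_indicator)
  also have "\<dots> = (\<Sum>j\<le>2 * N. ennreal (4 ^ ?n * v j))"
  proof (intro sum.cong refl)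
    fix j
    have "v j / (l j / 32) ^ (?n + 1) * ((l j / 8) ^ ?n * (l j / 32)) = 4 ^ ?n * v j"
    proof -
      have "(l j / 8) ^ ?n = 4 ^ ?n * (l j / 32) ^ ?n" by (simp flip: power_mult_distrib)
      then show ?thesis using l[of j] by simp
    qed
    then show "ennreal (v j / (l j / 32) ^ (?n + 1)) * emeasure lebesgue (B j) = ennreal (4 ^ ?n * v j)"
      unfolding vol using v l[of j] by (subst ennreal_mult[symmetric]) auto
  qed
  also have "\<dots> = ennreal (4 ^ ?n * (\<Sum>j\<le>2 * N. v j))"
    using v by (subst sum_ennreal) (auto simp: sum_distrib_left)
  finally show ?thesis .
qed

section \<open>The weak-type bound for the intrinsic square function\<close>

lemma ennpowr_pos:
  assumes "0 < r" "0 \<le> y"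
  shows "ennpowr (ennreal y) r = ennreal (y powr r)"
  using assms by (simp add: ennpowr_def)

lemma ennpowr_mono:
  assumes r: "0 < r" and "x \<le> y"
  shows "ennpowr x r \<le> ennpowr y r"
proof (cases "y = \<infinity>")
  case True
  then show ?thesis using r by (simp add: ennpowr_def)
next
  case False
  then obtain b where b: "y = ennreal b" "0 \<le> b" by (cases y) auto
  then obtain a where a: "x = ennreal a" "0 \<le> a" using assms(2) by (cases x) (auto simp: top_unique)
  have "a \<le> b" using assms(2) a b by simp
  then show ?thesis unfolding a b using a b r by (simp add: ennpowr_pos powr_mono2 ennreal_leI)
qed

text \<open>Scaling by \<open>\<sigma> = s / \<kappa>\<close> moves the level \<open>s\<close> to
  level 1 of the square sums. The factor \<open>8 ^ n\<close> in \<open>\<kappa>\<close> is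
  \<open>4 ^ n\<close> from the boxes of the cone times \<open>2 ^ n\<close> from the grids.\<close>

lemma weak_type_transfer:
  fixes f w :: "real^'n \<Rightarrow> real" and p \<alpha> \<Phi> s :: real
  assumes \<alpha>: "0 < \<alpha>" and p: "1 \<le> p" and s: "0 < s" and \<Phi>: "0 \<le> \<Phi>"
    and w0: "\<And>x. 0 \<le> w x" and wm[measurable]: "w \<in> borel_measurable lebesgue"
    and fm[measurable]: "f \<in> borel_measurable lebesgue"
    and tree: "\<And>g Q h. integrable lebesgue g \<Longrightarrow> 0 < side Q \<Longrightarrow>
       emeasure (weight_measure w)
         {x \<in> cube Q. 1 < square_sum (2 powr - \<alpha>) g h Q x}
       \<le> ennreal \<Phi> * power_mass p w g (cube Q)"
    and int: "\<And>Q. 0 < side Q \<Longrightarrow> wmeasure w (cube Q) \<noteq> 0 \<Longrightarrow> integrable lebesgue (\<lambda>x. indicator (cube Q) x * f x)"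
  defines "\<kappa> \<equiv> sqrt (8 ^ CARD('n)) * pair_const CARD('n) \<alpha>"
  shows "wmeasure w {x. intrinsic_square \<alpha> f x > ennreal s}
    \<le> ennreal (2 ^ CARD('n) * \<Phi> * (\<kappa> / s) powr p) * (\<integral>\<^sup>+x. ennreal (\<bar>f x\<bar> powr p * w x) \<partial>lebesgue)"
proof -
  let ?n = "CARD('n)"
  let ?C = "pair_const ?n \<alpha>"
  let ?nu = "weight_measure w"
  let ?I = "\<integral>\<^sup>+x. ennreal (\<bar>f x\<bar> powr p * w x) \<partial>lebesgue"
  have C: "0 < ?C" by (simp add: pair_const_def)
  have \<kappa>: "0 < \<kappa>" using C by (simp add: \<kappa>_def)
  define \<sigma> where "\<sigma> = s / \<kappa>"
  have \<sigma>: "0 < \<sigma>" using s \<kappa> by (simp add: \<sigma>_def)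
  have s2: "4 ^ ?n * ((\<sigma> * ?C)\<^sup>2 * 2 ^ ?n) = s\<^sup>2"
  proof -
    have "s = \<kappa> * \<sigma>" using \<kappa> by (simp add: \<sigma>_def)
    then have "s\<^sup>2 = 8 ^ ?n * (\<sigma> * ?C)\<^sup>2" by (simp add: \<kappa>_def power_mult_distrib)
    moreover have "(8::real) ^ ?n = 4 ^ ?n * 2 ^ ?n" by (simp flip: power_mult_distrib)
    ultimately show ?thesis by simp
  qed
  define F where "F N S z = indicator (cube (top_cube N S)) z * f z / \<sigma>" for N :: nat and S :: "'n set" and z
  \<comment> \<open>Where \<open>f\<close> is not integrable on the top cube, that cube has weight 0
    by \<open>int\<close>, and \<open>E\<close> may be the whole cube at no cost.\<close>
  define ok where "ok N S \<longleftrightarrow> integrable lebesgue (\<lambda>x. indicator (cube (top_cube N S)) x * f x)" for N :: nat and S :: "'n set"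
  define b where "b N S = osc (2 powr - \<alpha>) (cube_avg (F N S)) (cube_avg (\<lambda>z. \<bar>F N S z\<bar>))" for N and S :: "'n set"
  define sq where "sq N S = tree_sum (\<lambda>h Q. (b N S h Q)\<^sup>2) (2 * N) (top_cube N S)" for N and S :: "'n set"
  have F_int: "integrable lebesgue (F N S)" if "ok N S" for N S
    using that unfolding F_def[abs_def] ok_def by (rule integrable_divide)
  define E where "E N S = (if ok N S then {x \<in> cube (top_cube N S). 1 < sq N S x} else cube (top_cube N S))" for N S
  have E_meas[measurable]: "E N S \<in> sets lebesgue" for N S
  proof -
    have [measurable]: "sq N S \<in> borel_measurable lebesgue" unfolding sq_def by measurable
    have "{x \<in> cube (top_cube N S). 1 < sq N S x} \<in> sets lebesgue" by (intro sets_cube_Collect) measurable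
    then show ?thesis by (simp add: E_def)
  qed
  have nuE: "emeasure ?nu (E N S) \<le> ennreal (\<Phi> * (1 / \<sigma>) powr p) * ?I" for N S
  proof (cases "ok N S")
    case True
    have "emeasure ?nu (E N S) \<le> ennreal \<Phi> * power_mass p w (F N S) (cube (top_cube N S))"
      using tree[OF F_int[OF True], of "top_cube N S" "2 * N"] True by (simp add: E_def sq_def b_def)
    also have "\<dots> \<le> ennreal \<Phi> * (\<integral>\<^sup>+x. ennreal ((1 / \<sigma>) powr p) * ennreal (\<bar>f x\<bar> powr p * w x) \<partial>lebesgue)"
    proof (intro mult_left_mono nn_integral_mono)
      fix x
      show "ennreal (\<bar>F N S x\<bar> powr p * w x) * indicator (cube (top_cube N S)) x
          \<le> ennreal ((1 / \<sigma>) powr p) * ennreal (\<bar>f x\<bar> powr p * w x)"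
      proof (cases "x \<in> cube (top_cube N S)")
        case True
        then have "\<bar>F N S x\<bar> powr p = (1 / \<sigma>) powr p * \<bar>f x\<bar> powr p"
          using \<sigma> by (simp add: F_def powr_divide)
        then show ?thesis using True by (simp add: ennreal_mult' mult.assoc)
      qed simp
    qed simp
    also have "\<dots> = ennreal (\<Phi> * (1 / \<sigma>) powr p) * ?I"
      using \<Phi> by (subst nn_integral_cmult) (auto simp: ennreal_mult' mult.assoc)
    finally show ?thesis .
  next
    case False
    then have "wmeasure w (cube (top_cube N S)) = 0" using int[of "top_cube N S"] by (auto simp: ok_def)
    then have "emeasure ?nu (E N S) = 0" using False by (simp add: E_def emeasure_density wmeasure_def)
    then show ?thesis by simp
  qed
  define EE where "EE N = (\<Union>S. E N S)" for N
  have EE_meas[measurable]: "EE N \<in> sets lebesgue" for N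
    unfolding EE_def by (intro sets.countable_UN') (auto simp: countable_finite)
  let ?bd = "ennreal (2 ^ ?n * \<Phi> * (\<kappa> / s) powr p) * ?I"
  have nuEE: "emeasure ?nu (EE N) \<le> ?bd" for N
  proof -
    have "emeasure ?nu (EE N) \<le> (\<Sum>S\<in>UNIV. emeasure ?nu (E N S))"
      unfolding EE_def by (intro emeasure_subadditive_finite) auto
    also have "\<dots> \<le> (\<Sum>S\<in>(UNIV :: 'n set set). ennreal (\<Phi> * (1 / \<sigma>) powr p) * ?I)"
      by (intro sum_mono nuE)
    also have "\<dots> = ennreal (2 ^ ?n) * (ennreal (\<Phi> * (1 / \<sigma>) powr p) * ?I)"
      by (simp add: card_UNIV_set_finite ennreal_power[symmetric])
    also have "\<dots> = ennreal (2 ^ ?n * (\<Phi> * (1 / \<sigma>) powr p)) * ?I"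
      by (subst ennreal_mult') (auto simp: mult.assoc)
    also have "2 ^ ?n * (\<Phi> * (1 / \<sigma>) powr p) = 2 ^ ?n * \<Phi> * (\<kappa> / s) powr p" by (simp add: \<sigma>_def)
    finally show ?thesis .
  qed
  \<comment> \<open>By contraposition: outside \<open>EE N\<close>, with \<open>x\<close> in every
    top cube, all square sums at \<open>x\<close> are at most 1, which keeps the integral over
    \<open>slab N\<close> below \<open>s\<^sup>2\<close>. The slabs exhaust the cone, so this fails
    for all large \<open>N\<close>.\<close>
  have ev: "\<forall>\<^sub>F N in sequentially. x \<in> EE N" if x: "ennreal s < intrinsic_square \<alpha> f x" for x
  proof -
    define g where "g z = (case z of (y, t) \<Rightarrow> (intrinsic_sup \<alpha> f y t)\<^sup>2)" for z :: "(real^'n) \<times> real"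
    define u where "u z = (case z of (y, t) \<Rightarrow> g (y, t) / ennreal (t ^ (?n + 1))) * indicator (cone x) z" for z :: "(real^'n) \<times> real"
    have iq: "intrinsic_square \<alpha> f x = ennpowr (\<integral>\<^sup>+z. u z \<partial>lebesgue) (1 / 2)"
      by (simp add: intrinsic_square_def u_def g_def case_prod_beta)
    have T: "ennreal (s\<^sup>2) < (\<integral>\<^sup>+z. u z \<partial>lebesgue)"
    proof (rule ccontr)
      assume "\<not> ?thesis"
      then have "intrinsic_square \<alpha> f x \<le> ennpowr (ennreal (s\<^sup>2)) (1 / 2)"
        unfolding iq by (intro ennpowr_mono) auto
      also have "\<dots> = ennreal s" using s by (simp add: ennpowr_pos powr_half_sqrt)
      finally show False using x by simp
    qed
    have "(\<integral>\<^sup>+z. u z \<partial>lebesgue) \<le> (SUP N. \<integral>\<^sup>+z. u z * indicator (slab N) z \<partial>lebesgue)"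
    proof (rule nn_integral_le_SUP_indicator)
      fix z assume "u z \<noteq> 0"
      then have "0 < snd z" by (auto simp: u_def cone_def indicator_def split: if_splits prod.splits)
      then show "\<exists>N. z \<in> slab N" by (rule slab_exhaust)
    qed (rule slab_borel slab_incseq)+
    then have "ennreal (s\<^sup>2) < (SUP N. \<integral>\<^sup>+z. u z * indicator (slab N) z \<partial>lebesgue)" using T by (rule order.strict_trans2[rotated])
    then obtain N1 where N1: "ennreal (s\<^sup>2) < (\<integral>\<^sup>+z. u z * indicator (slab N1) z \<partial>lebesgue)"
      by (auto simp: less_SUP_iff)
    obtain N2 where N2: "6 * norm x < 2 ^ N2" using real_arch_pow[of 2 "6 * norm x"] by auto
    show ?thesis
    proof (rule eventually_sequentiallyI)
      fix N assume N: "max N1 N2 \<le> N"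
      have "(2::real) ^ N2 \<le> 2 ^ N" using N by (intro power_increasing) auto
      then have xi: "\<bar>x $ i\<bar> < 2 ^ N / 6" for i using N2 component_le_norm_cart[of x i] by linarith
      have x_top: "x \<in> cube (top_cube N S)" for S using xi by (rule mem_top_cube)
      show "x \<in> EE N"
      proof (rule ccontr)
        assume nE: "x \<notin> EE N"
        then have nES: "x \<notin> E N S" for S by (auto simp: EE_def)
        have okS: "ok N S" for S using nES[of S] x_top[of S] by (auto simp: E_def split: if_splits)
        have sqS: "sq N S x \<le> 1" for S using nES[of S] x_top[of S] okS[of S] by (auto simp: E_def)
        define v where "v j = (\<sigma> * ?C)\<^sup>2 * (\<Sum>S\<in>UNIV. (b N S (2 * N - j) (node_at j (top_cube N S) x))\<^sup>2)" for j
        have v0: "0 \<le> v j" for j unfolding v_def by (intro mult_nonneg_nonneg sum_nonneg) auto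
        have "(\<integral>\<^sup>+z. u z * indicator (slab N1) z \<partial>lebesgue) \<le> (\<integral>\<^sup>+z. u z * indicator (slab N) z \<partial>lebesgue)"
          using N incseqD[OF slab_incseq, of N1 N] by (intro nn_integral_mono mult_left_mono) (auto simp: indicator_def)
        also have "\<dots> \<le> ennreal (4 ^ ?n * (\<Sum>j\<le>2 * N. v j))"
          unfolding u_def
        proof (rule truncated_cone_integral_le[OF v0])
          fix j and y :: "real^'n" and t :: real
          assume j: "j \<le> 2 * N" and yt: "norm (x - y) < t" and t: "2 ^ N / 2 ^ j / 32 \<le> t" "t < 2 ^ N / 2 ^ j / 16"
          \<comment> \<open>The support of the dilate around \<open>y\<close> stays within
            \<open>2 * t < l / 8\<close> of \<open>x\<close>, and the radius \<open>l / 8\<close>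
            satisfies the one-third condition \<open>2 * (l / 8) \<le> l / 3\<close>.\<close>
          define l :: real where "l = 2 ^ N / 2 ^ j"
          have l: "0 < l" by (simp add: l_def)
          have t': "l / 32 \<le> t" "t < l / 16" using t by (auto simp: l_def)
          obtain S where S: "\<And>z. norm (z - x) < l / 8 \<Longrightarrow> z \<in> cube (node_at j (top_cube N S) x)"
          proof (rule shifted_cube_contains[of "l / 8" N j x])
            show "2 * (l / 8) \<le> 2 ^ N / 2 ^ j / 3" using l by (simp add: l_def[symmetric])
          qed (use l x_top in auto)
          let ?R = "node_at j (top_cube N S) x"
          have "intrinsic_sup \<alpha> f y t \<le> ennreal (\<sigma> * (?C * b N S (2 * N - j) ?R))"
            unfolding b_def
          proof (rule intrinsic_sup_le_osc[OF \<alpha> \<sigma> F_int[OF okS]])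
            fix z assume "z \<in> cube ?R"
            then have "z \<in> cube (top_cube N S)" using cube_node_at_subset by blast
            then show "f z = \<sigma> * F N S z" using \<sigma> by (simp add: F_def)
          next
            fix z assume z: "norm (y - z) \<le> t"
            have "norm (z - x) \<le> norm (z - y) + norm (y - x)" using norm_triangle_ineq[of "z - y" "y - x"] by simp
            also have "\<dots> < t + t" using z yt by (simp add: norm_minus_commute)
            finally show "z \<in> cube ?R" using t' by (intro S) auto
          qed (use l t' in \<open>auto simp: l_def[symmetric]\<close>)
          then have "(intrinsic_sup \<alpha> f y t)\<^sup>2 \<le> (ennreal (\<sigma> * (?C * b N S (2 * N - j) ?R)))\<^sup>2"
            by (rule power_mono) simp
          also have "\<dots> \<le> ennreal ((\<sigma> * (?C * b N S (2 * N - j) ?R))\<^sup>2)"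
          proof (cases "0 \<le> \<sigma> * (?C * b N S (2 * N - j) ?R)")
            case True
            then show ?thesis by (simp add: ennreal_power)
          qed (simp add: ennreal_neg)
          also have "\<dots> \<le> ennreal (v j)"
          proof (rule ennreal_leI)
            have "(b N S (2 * N - j) ?R)\<^sup>2 \<le> (\<Sum>S\<in>UNIV. (b N S (2 * N - j) (node_at j (top_cube N S) x))\<^sup>2)"
              by (rule member_le_sum) auto
            then have "(\<sigma> * ?C)\<^sup>2 * (b N S (2 * N - j) ?R)\<^sup>2 \<le> v j" unfolding v_def by (intro mult_left_mono) auto
            then show "(\<sigma> * (?C * b N S (2 * N - j) ?R))\<^sup>2 \<le> v j" by (simp add: power_mult_distrib mult.assoc)
          qed
          finally show "g (y, t) \<le> ennreal (v j)" by (simp add: g_def)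
        qed
        also have "\<dots> \<le> ennreal (s\<^sup>2)"
        proof (rule ennreal_leI)
          have "(\<Sum>j\<le>2 * N. v j) = (\<sigma> * ?C)\<^sup>2 * (\<Sum>S\<in>UNIV. sq N S x)"
            unfolding v_def sum_distrib_left[symmetric]
            by (subst sum.swap) (simp add: sq_def tree_sum_node_at[OF x_top])
          also have "\<dots> \<le> (\<sigma> * ?C)\<^sup>2 * (\<Sum>S\<in>(UNIV :: 'n set set). 1)"
            using sqS by (intro mult_left_mono sum_mono) auto
          also have "\<dots> = (\<sigma> * ?C)\<^sup>2 * 2 ^ ?n" by (simp add: card_UNIV_set_finite)
          finally have "4 ^ ?n * (\<Sum>j\<le>2 * N. v j) \<le> 4 ^ ?n * ((\<sigma> * ?C)\<^sup>2 * 2 ^ ?n)" by simp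
          then show "4 ^ ?n * (\<Sum>j\<le>2 * N. v j) \<le> s\<^sup>2" using s2 by simp
        qed
        finally show False using N1 by simp
      qed
    qed
  qed
  let ?S = "{x. intrinsic_square \<alpha> f x > ennreal s}"
  \<comment> \<open>The sets \<open>EE N\<close> come from grids that are not nested, so monotone
    convergence is not at hand; eventual membership and Fatou's lemma suffice.\<close>
  have "wmeasure w ?S \<le> (\<integral>\<^sup>+x. liminf (\<lambda>N. ennreal (w x) * indicator (EE N) x) \<partial>lebesgue)"
    unfolding wmeasure_def
  proof (rule nn_integral_mono)
    fix x
    show "ennreal (w x) * indicator ?S x \<le> liminf (\<lambda>N. ennreal (w x) * indicator (EE N) x)"
    proof (rule Liminf_bounded, cases "x \<in> ?S")
      case True
      then have "\<forall>\<^sub>F N in sequentially. x \<in> EE N" by (intro ev) simp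
      then show "\<forall>\<^sub>F N in sequentially. ennreal (w x) * indicator ?S x \<le> ennreal (w x) * indicator (EE N) x"
        by eventually_elim (auto simp: indicator_def)
    qed simp
  qed
  also have "\<dots> \<le> liminf (\<lambda>N. \<integral>\<^sup>+x. ennreal (w x) * indicator (EE N) x \<partial>lebesgue)"
    by (intro nn_integral_liminf) measurable
  also have "\<dots> = liminf (\<lambda>N. emeasure ?nu (EE N))" by (simp add: emeasure_density)
  also have "\<dots> \<le> liminf (\<lambda>N. ?bd)" using nuEE by (intro Liminf_mono always_eventually) blast
  also have "\<dots> = ?bd" by (simp add: Liminf_const)
  finally show ?thesis .
qed

section \<open>Consequences of the \<open>A_p\<close> condition and assembly of the
  constants\<close>

lemma weighted_tree_Ap:
  fixes w g :: "real^'n \<Rightarrow> real"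
  assumes "w \<in> Ap p" "1 \<le> p" "0 < \<theta>" "\<theta> < 1" "Ap_const p w = ennreal A" "1 \<le> A" "integrable lebesgue g"
  shows "weighted_tree g w p \<theta> A"
proof
  show "w \<in> borel_measurable lebesgue" "\<And>x. 0 \<le> w x"
    using assms(1) by (auto simp: Ap_def weight_def intro: weight_measurable)
  fix Q :: "'n node" and F and g :: "real^'n \<Rightarrow> real" and c :: real
  assume "0 < side Q" "F \<in> sets lebesgue" "F \<subseteq> cube Q" "g \<in> borel_measurable lebesgue" "0 < c"
    "ennreal (c * side Q ^ CARD('n)) \<le> (\<integral>\<^sup>+x\<in>F. ennreal \<bar>g x\<bar> \<partial>lebesgue)"
  then show "ennreal (c powr p) * wmeasure w (cube Q)
         \<le> ennreal A * power_mass p w g F"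
    using Ap_testing[OF assms(1,2), of Q F g c] assms(5) by simp
qed (use assms in auto)

text \<open>If \<open>|f|\<close> had infinite integral over the cube, testing would hold for every
  \<open>c\<close>, which is impossible when the cube has positive weight.\<close>

lemma integrable_cube_of_Lp:
  fixes w f :: "real^'n \<Rightarrow> real"
  assumes w: "w \<in> Ap p" and p: "1 \<le> p" and f[measurable]: "f \<in> borel_measurable lebesgue"
    and fin: "(\<integral>\<^sup>+x. ennreal (\<bar>f x\<bar> powr p * w x) \<partial>lebesgue) < \<infinity>"
    and Q: "0 < side Q" and W: "wmeasure w (cube Q) \<noteq> 0"
  shows "integrable lebesgue (\<lambda>x. indicator (cube Q) x * f x)"
proof (rule ccontr)
  assume ni: "\<not> ?thesis"
  have "(\<integral>\<^sup>+x. ennreal (norm (indicator (cube Q) x * f x)) \<partial>lebesgue) = (\<integral>\<^sup>+x\<in>cube Q. ennreal \<bar>f x\<bar> \<partial>lebesgue)"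
    by (intro nn_integral_cong) (auto simp: indicator_def)
  then have top: "(\<integral>\<^sup>+x\<in>cube Q. ennreal \<bar>f x\<bar> \<partial>lebesgue) = \<infinity>"
    using ni by (auto simp: integrable_iff_bounded less_top[symmetric])
  have wt: "weight w" using w by (simp add: Ap_def)
  let ?I = "power_mass p w f (cube Q)"
  have "?I \<le> (\<integral>\<^sup>+x. ennreal (\<bar>f x\<bar> powr p * w x) \<partial>lebesgue)" by (intro nn_integral_mono) (auto simp: indicator_def)
  then have "Ap_const p w * ?I < \<infinity>" using fin w by (auto simp: Ap_def ennreal_mult_less_top)
  then obtain r where r: "Ap_const p w * ?I = ennreal r" "0 \<le> r" by (cases "Ap_const p w * ?I") auto
  obtain m where m: "wmeasure w (cube Q) = ennreal m" "0 < m"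
    using wmeasure_cube_finite[OF wt Q] W by (cases "wmeasure w (cube Q)") auto
  \<comment> \<open>Chosen so that \<open>c powr p * m = r + 1\<close>, one more than the right-hand
    side of the testing inequality.\<close>
  define c where "c = ((r + 1) / m) powr (1 / p)"
  have c: "0 < c" using r m by (simp add: c_def)
  have "ennreal (c powr p) * wmeasure w (cube Q) \<le> Ap_const p w * ?I"
    using top c Q by (intro Ap_testing[OF w p]) auto
  moreover have "c powr p = (r + 1) / m" using r m p by (simp add: c_def powr_powr)
  moreover have "ennreal ((r + 1) / m) * ennreal m = ennreal (r + 1)"
    using r m by (subst ennreal_mult[symmetric]) auto
  ultimately have "ennreal (r + 1) \<le> ennreal r" unfolding m r by simp
  then show False using r by (simp add: ennreal_le_iff)
qed

text \<open>Testing the cube with the constant function 1.\<close>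

lemma Ap_const_ge_1:
  assumes w: "w \<in> Ap p" and p: "1 \<le> p" and Q: "0 < side Q" and nz: "wmeasure w (cube Q) \<noteq> 0"
  shows "1 \<le> Ap_const p w"
proof -
  have wt: "weight w" using w by (simp add: Ap_def)
  obtain m where m: "wmeasure w (cube Q) = ennreal m" "0 < m"
    using wmeasure_cube_finite[OF wt Q] nz by (cases "wmeasure w (cube Q)") auto
  have "ennreal (1 powr p) * wmeasure w (cube Q) \<le> Ap_const p w * power_mass p w (\<lambda>_. 1) (cube Q)"
    using Q by (intro Ap_testing[OF w p]) (auto simp del: emeasure_completion)
  then have "1 * ennreal m \<le> Ap_const p w * ennreal m" using m by (simp add: wmeasure_def)
  then show ?thesis using m ennreal_mult_le_mult_iff[of "ennreal m" 1 "Ap_const p w"]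
    by (simp add: mult.commute ennreal_eq_0_iff)
qed

text \<open>The two bounds on \<open>L\<close> are spent differently: the one by \<open>A\<close> in
  the power, where \<open>A * A powr ((p - 2) / 2) = A powr (p / 2)\<close>, and the one by
  \<open>D\<close> in the logarithm.\<close>

lemma growth_factor_le:
  fixes A D L c1 c2 p :: real
  assumes p: "2 \<le> p" and A: "1 \<le> A" and c1: "1 \<le> c1" and c2: "1 \<le> c2" and D: "0 \<le> D"
    and L: "1 \<le> L" "L \<le> c1 * A" "L \<le> max 1 (c2 * D)"
  shows "A * (L powr ((p - 2) / 2) * (1 + ln L))
    \<le> c1 powr ((p - 2) / 2) * (1 + ln c2) * (A powr (p / 2) * (1 + max (ln D) 0))"
proof -
  define e where "e = 1 + max (ln D) 0"
  have e1: "1 \<le> e" by (simp add: e_def)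
  have lnL: "1 + ln L \<le> (1 + ln c2) * e"
  proof -
    have "ln L \<le> ln (max 1 (c2 * D))" using L by (intro ln_mono) auto
    also have "\<dots> \<le> ln c2 + max (ln D) 0"
    proof (cases "1 \<le> c2 * D")
      case True
      then have "0 < D" using D by (cases "D = 0") auto
      then have "ln (c2 * D) = ln c2 + ln D" using c2 by (simp add: ln_mult)
      then show ?thesis using True by (simp add: max_def)
    next
      case False
      then show ?thesis using c2 by (simp add: max_def)
    qed
    finally have "1 + ln L \<le> ln c2 * 1 + e" by (simp add: e_def)
    also have "\<dots> \<le> ln c2 * e + e" using e1 c2 by (intro add_right_mono mult_left_mono) auto
    finally show ?thesis by (simp add: distrib_right)
  qed
  have Lp: "L powr ((p - 2) / 2) \<le> c1 powr ((p - 2) / 2) * A powr ((p - 2) / 2)"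
    using L p c1 A by (subst powr_mult[symmetric]) (auto intro!: powr_mono2)
  have "A * A powr ((p - 2) / 2) = A powr (1 + (p - 2) / 2)" using A by (subst powr_add) simp
  then have A_eq: "A * A powr ((p - 2) / 2) = A powr (p / 2)" by (simp add: diff_divide_distrib)
  have "A * (L powr ((p - 2) / 2) * (1 + ln L))
      \<le> A * ((c1 powr ((p - 2) / 2) * A powr ((p - 2) / 2)) * ((1 + ln c2) * e))"
    using Lp lnL A L by (intro mult_left_mono mult_mono) auto
  also have "\<dots> = c1 powr ((p - 2) / 2) * (1 + ln c2) * ((A * A powr ((p - 2) / 2)) * e)" by (simp only: mult_ac)
  finally show ?thesis unfolding A_eq e_def .
qed

definition tree_const_lt2 :: "nat \<Rightarrow> real \<Rightarrow> real \<Rightarrow> real" where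
  "tree_const_lt2 n \<theta> p = 1 + 4 * energy_const n \<theta> * 4 powr p / (1 - 2 powr ((p - 2) / 2))\<^sup>2"

definition tree_const_ge2 :: "nat \<Rightarrow> real \<Rightarrow> real \<Rightarrow> real" where
  "tree_const_ge2 n \<theta> p = 1 + 4 powr ((p - 2) / 2) * (4 * energy_const n \<theta> * 4 powr p)
     * (2 + 2 * fact (Suc (nat \<lceil>p\<rceil>)) * 4 ^ Suc (nat \<lceil>p\<rceil>))"

lemma weak_norm_le:
  assumes p: "1 \<le> p" and K: "0 \<le> K" and J: "0 \<le> J"
    and bd: "\<And>s. 0 < s \<Longrightarrow> wmeasure w {x. g x > ennreal s} \<le> ennreal (K / s powr p) * ennreal J"
  shows "weak_Lp_norm p w g \<le> ennreal (K powr (1 / p) * J powr (1 / p))"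
  unfolding weak_Lp_norm_def
proof (rule SUP_least)
  fix s :: real assume "s \<in> {0<..}"
  then have s: "0 < s" by simp
  have "ennreal (K / s powr p) * ennreal J = ennreal (K / s powr p * J)"
    using J K by (intro ennreal_mult[symmetric]) auto
  then have "ennpowr (wmeasure w {x. g x > ennreal s}) (1 / p) \<le> ennpowr (ennreal (K / s powr p * J)) (1 / p)"
    using bd[OF s] p by (intro ennpowr_mono) simp_all
  also have "\<dots> = ennreal ((K / s powr p * J) powr (1 / p))"
    using p J s K by (intro ennpowr_pos) auto
  also have "(K / s powr p * J) powr (1 / p) = K powr (1 / p) * J powr (1 / p) / s"
    using p s K J by (simp add: powr_mult powr_divide powr_powr)
  finally have "ennreal s * ennpowr (wmeasure w {x. g x > ennreal s}) (1 / p) \<le> ennreal s * ennreal (K powr (1 / p) * J powr (1 / p) / s)"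
    by (intro mult_left_mono) auto
  also have "\<dots> = ennreal (K powr (1 / p) * J powr (1 / p))"
    using s by (simp flip: ennreal_mult')
  finally show "ennreal s * ennpowr (wmeasure w {x. ennreal s < g x}) (1 / p) \<le> ennreal (K powr (1 / p) * J powr (1 / p))" .
qed

text \<open>\<open>\<Phi>\<close> carries the whole dependence on the weight constants, and only its
  p-th root reaches the norm inequality.\<close>

lemma weak_bound_of_tree_bound:
  fixes f w :: "real^'n \<Rightarrow> real"
  assumes \<alpha>: "0 < \<alpha>" and p: "1 \<le> p" and w: "w \<in> Ap p" and f: "f \<in> Lp p w" and \<Phi>: "0 \<le> \<Phi>"
    and tree: "\<And>g Q h. integrable lebesgue g \<Longrightarrow> 0 < side Q \<Longrightarrow>
       emeasure (weight_measure w)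
         {x \<in> cube Q. 1 < square_sum (2 powr - \<alpha>) g h Q x}
       \<le> ennreal \<Phi> * power_mass p w g (cube Q)"
  shows "weak_Lp_norm p w (intrinsic_square \<alpha> f)
    \<le> ennreal (sqrt (8 ^ CARD('n)) * pair_const CARD('n) \<alpha> * (2 ^ CARD('n) * \<Phi>) powr (1 / p)) * Lp_norm p w f"
proof -
  define \<kappa> where "\<kappa> = sqrt (8 ^ CARD('n)) * pair_const CARD('n) \<alpha>"
  have \<kappa>: "0 < \<kappa>" by (simp add: \<kappa>_def pair_const_def)
  have fm[measurable]: "f \<in> borel_measurable lebesgue" and ffin: "Lp_norm p w f < \<infinity>" using f by (auto simp: Lp_def)
  let ?I = "\<integral>\<^sup>+x. ennreal (\<bar>f x\<bar> powr p * w x) \<partial>lebesgue"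
  have Ifin: "?I < \<infinity>" using ffin p by (auto simp: Lp_norm_def ennpowr_def less_top[symmetric] split: if_splits)
  then obtain J where J: "?I = ennreal J" "0 \<le> J" by (cases ?I) auto
  have Lp: "Lp_norm p w f = ennreal (J powr (1 / p))" unfolding Lp_norm_def J using p J by (intro ennpowr_pos) auto
  have wt: "weight w" using w by (simp add: Ap_def)
  have "weak_Lp_norm p w (intrinsic_square \<alpha> f) \<le> ennreal ((2 ^ CARD('n) * \<Phi> * \<kappa> powr p) powr (1 / p) * J powr (1 / p))"
  proof (rule weak_norm_le[OF p _ J(2)])
    fix s :: real assume s: "0 < s"
    have "wmeasure w {x. intrinsic_square \<alpha> f x > ennreal s} \<le> ennreal (2 ^ CARD('n) * \<Phi> * (\<kappa> / s) powr p) * ?I"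
      unfolding \<kappa>_def
      using wt integrable_cube_of_Lp[OF w p fm Ifin] weight_measurable[OF wt]
      by (intro weak_type_transfer[OF \<alpha> p s \<Phi> _ _ fm tree]) (auto simp: weight_def)
    also have "2 ^ CARD('n) * \<Phi> * (\<kappa> / s) powr p = 2 ^ CARD('n) * \<Phi> * \<kappa> powr p / s powr p"
      using \<kappa> s by (simp add: powr_divide)
    finally show "wmeasure w {x. intrinsic_square \<alpha> f x > ennreal s} \<le> ennreal (2 ^ CARD('n) * \<Phi> * \<kappa> powr p / s powr p) * ennreal J"
      unfolding J .
  qed (use \<Phi> in simp)
  also have "(2 ^ CARD('n) * \<Phi> * \<kappa> powr p) powr (1 / p) = \<kappa> * (2 ^ CARD('n) * \<Phi>) powr (1 / p)"
    using \<kappa> \<Phi> p by (simp add: powr_mult powr_powr)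
  also have "ennreal (\<kappa> * (2 ^ CARD('n) * \<Phi>) powr (1 / p) * J powr (1 / p))
      = ennreal (\<kappa> * (2 ^ CARD('n) * \<Phi>) powr (1 / p)) * Lp_norm p w f"
    unfolding Lp using \<kappa> by (intro ennreal_mult) auto
  finally show ?thesis by (simp add: \<kappa>_def)
qed

theorem theorem1p11:
  fixes \<alpha> p :: real
  assumes "0 < \<alpha>" and "\<alpha> < 1" and "1 \<le> p"
  shows "\<exists>C::real. C > 0 \<and>
    (\<forall>w :: real^'n \<Rightarrow> real. \<forall>f. w \<in> Ap p \<longrightarrow> f \<in> Lp p w \<longrightarrow>
      weak_Lp_norm p w (intrinsic_square \<alpha> f) \<le> ennreal C * weight_factor p w * Lp_norm p w f)"
proof -
  let ?n = "CARD('n)"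
  define \<theta> where "\<theta> = 2 powr - \<alpha>"
  have \<theta>: "0 < \<theta>" "\<theta> < 1" using assms(1) powr_less_mono[of "- \<alpha>" 0 "2::real"] by (auto simp: \<theta>_def)
  define G where "G = energy_const ?n \<theta>"
  have G: "1 \<le> G" unfolding G_def using \<theta> by (rule energy_const_ge_1)
  define K where "K = (if p < 2 then tree_const_lt2 ?n \<theta> p
    else tree_const_ge2 ?n \<theta> p * (4 * G * (4 / 3) powr p) powr ((p - 2) / 2) * (1 + ln (16 / 3 * G)))"
  have K1: "0 < tree_const_lt2 ?n \<theta> p" and K2: "0 < tree_const_ge2 ?n \<theta> p"
    unfolding tree_const_lt2_def tree_const_ge2_def G_def[symmetric] using G
    by (auto intro!: add_pos_nonneg mult_nonneg_nonneg divide_nonneg_nonneg add_nonneg_nonneg)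
  have lnG: "0 \<le> ln (16 / 3 * G)" using G by simp
  have K: "0 < K" unfolding K_def using K1 K2 G lnG by (auto intro!: mult_pos_pos add_pos_nonneg)
  define \<kappa> where "\<kappa> = sqrt (8 ^ ?n) * pair_const ?n \<alpha>"
  have \<kappa>: "0 < \<kappa>" by (simp add: \<kappa>_def pair_const_def)
  define C where "C = \<kappa> * (2 ^ ?n * K) powr (1 / p)"
  have C: "0 < C" using \<kappa> K by (simp add: C_def)
  have main: "weak_Lp_norm p w (intrinsic_square \<alpha> f) \<le> ennreal C * weight_factor p w * Lp_norm p w f"
    if w: "w \<in> Ap p" and f: "f \<in> Lp p w" for w f :: "real^'n \<Rightarrow> real"
  proof -
    let ?W = "weak_Lp_norm p w (intrinsic_square \<alpha> f)" and ?F = "Lp_norm p w f"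
    let ?B = "\<lambda>X. ennreal (\<kappa> * (2 ^ ?n * X) powr (1 / p)) * ?F"
    have wt: "weight w" and "Ap_const p w < \<infinity>" using w by (auto simp: Ap_def)
    then obtain A where A: "Ap_const p w = ennreal A" "0 \<le> A" by (cases "Ap_const p w") auto
    note transfer = weak_bound_of_tree_bound[OF assms(1,3) w f, folded \<kappa>_def \<theta>_def]
    show ?thesis
    proof (cases "1 \<le> A")
      \<comment> \<open>A characteristic below 1 forces every cube to have weight 0, so the tree
        bound holds with \<open>\<Phi> = 0\<close>.\<close>
      case False
      then have null: "wmeasure w (cube Q) = 0" if "0 < side Q" for Q
        using Ap_const_ge_1[OF w assms(3) that] A ennreal_le_iff[of A 1] by auto
      have "?W \<le> ?B 0"
      proof (rule transfer)
        fix g :: "real^'n \<Rightarrow> real" and Q :: "'n node" and h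
        assume Q: "0 < side Q"
        let ?E = "{x \<in> cube Q. 1 < square_sum \<theta> g h Q x}"
        have [measurable]: "w \<in> borel_measurable lebesgue" using wt by (rule weight_measurable)
        have "emeasure (weight_measure w) ?E \<le> emeasure (weight_measure w) (cube Q)"
          by (intro emeasure_mono) auto
        also have "\<dots> = 0" using null[OF Q] by (simp add: emeasure_density wmeasure_def)
        finally show "emeasure (weight_measure w) ?E
            \<le> ennreal 0 * power_mass p w g (cube Q)" by simp
      qed simp
      then show ?thesis by simp
    next
      case A1: True
      have wtree: "weighted_tree g w p \<theta> A" if "integrable lebesgue g" for g
        using weighted_tree_Ap[OF w assms(3) \<theta> A(1) A1 that] .
      show ?thesis
      proof (cases "p < 2")
        case True
        have "?W \<le> ?B (K * A)"
        proof (rule transfer)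
          fix g :: "real^'n \<Rightarrow> real" and Q :: "'n node" and h
          assume g: "integrable lebesgue g" and Q: "0 < side Q"
          interpret T: weighted_tree g w p \<theta> A using g by (rule wtree)
          show "emeasure (weight_measure w) {x \<in> cube Q. 1 < square_sum \<theta> g h Q x}
            \<le> ennreal (K * A) * power_mass p w g (cube Q)"
            using T.weak_type_lt2[OF True Q, of h]
            unfolding T.N_def T.b_def T.a_def T.I_def T.G_def K_def tree_const_lt2_def using True by simp
        qed (use K A in simp)
        also have "\<kappa> * (2 ^ ?n * (K * A)) powr (1 / p) = C * A powr (1 / p)"
          using K A by (simp add: C_def powr_mult)
        also have "ennreal (C * A powr (1 / p)) = ennreal C * weight_factor p w"
          using C A True assms by (simp add: weight_factor_def ennpowr_pos ennreal_mult')
        finally show ?thesis .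
      next
        case False
        then have p2: "2 \<le> p" by simp
        let ?T = "\<lambda>L. tree_const_ge2 ?n \<theta> p * A * (L powr ((p - 2) / 2) * (1 + ln L))"
        define c1 where "c1 = 4 * G * (4 / 3) powr p"
        define c2 where "c2 = 16 / 3 * G"
        have "(1::real) \<le> (4 / 3) powr p" using assms(3) by (intro ge_one_powr_ge_zero) auto
        then have c1: "1 \<le> c1" unfolding c1_def using G mult_mono[of 1 "4 * G" 1 "(4/3) powr p"] by simp
        have c2: "1 \<le> c2" unfolding c2_def using G by simp
        have carA: "tree_int (weighted_tree.N w) (scale_coeff (weighted_tree.b g \<theta>) (weighted_tree.a g) \<tau>) h P
            \<le> ennreal (c1 * A) * emeasure (weighted_tree.N w) (cube P)"
          if "integrable lebesgue g" "0 < \<tau>" "0 < side P" for g \<tau> h P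
        proof -
          interpret T: weighted_tree g w p \<theta> A using that(1) by (rule wtree)
          show ?thesis using T.tree_sum_N_le_A[OF that(2,3), of h] unfolding T.G_def c1_def G_def by (simp add: mult_ac)
        qed
        have bound: "?W \<le> ?B (?T L)"
          if L: "1 \<le> L" and car: "\<And>g \<tau> h P. integrable lebesgue g \<Longrightarrow> 0 < \<tau> \<Longrightarrow> 0 < side P \<Longrightarrow>
            tree_int (weighted_tree.N w) (scale_coeff (weighted_tree.b g \<theta>) (weighted_tree.a g) \<tau>) h P
            \<le> ennreal L * emeasure (weighted_tree.N w) (cube P)" for L
        proof (rule transfer)
          fix g :: "real^'n \<Rightarrow> real" and Q :: "'n node" and h
          assume g: "integrable lebesgue g" and Q: "0 < side Q"
          interpret T: weighted_tree g w p \<theta> A using g by (rule wtree)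
          show "emeasure (weight_measure w) {x \<in> cube Q. 1 < square_sum \<theta> g h Q x}
            \<le> ennreal (?T L)
              * power_mass p w g (cube Q)"
            using T.weak_type_ge2[OF p2 Q L car[OF g], of h]
            unfolding T.N_def T.b_def T.a_def T.I_def T.G_def tree_const_ge2_def by simp
        qed (use K2 A L in simp)
        show ?thesis
        proof (cases "Ainf_const w = \<infinity>")
          \<comment> \<open>An infinite A-infinity constant makes the right-hand side infinite
            unless the norm of \<open>f\<close> is 0. In that case the bound with
            \<open>L = c1 * A\<close> already gives 0 on the left.\<close>
          case True
          show ?thesis
          proof (cases "?F = 0")
            case True
            then show ?thesis using bound[OF _ carA] c1 A1 mult_mono[of 1 c1 1 A] by simp
          next
            case False
            have "weight_factor p w = \<infinity>"
              using True p2 A1 A by (simp add: weight_factor_def log1_def ennpowr_pos ennpowr_def[of top] ennreal_mult_eq_top_iff)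
            then show ?thesis using C False by (simp add: ennreal_mult_eq_top_iff)
          qed
        next
          case False
          then obtain D where D: "Ainf_const w = ennreal D" "0 \<le> D" by (cases "Ainf_const w") auto
          \<comment> \<open>Both Carleson constants at once, so that \<open>growth_factor_le\<close>
            can use either; the maximum with 1 secures \<open>1 \<le> L\<close>.\<close>
          define L where "L = min (c1 * A) (max 1 (c2 * D))"
          define e where "e = 1 + max (ln D) 0"
          have cA: "1 \<le> c1 * A" using c1 A1 mult_mono[of 1 c1 1 A] by simp
          have L1: "1 \<le> L" using cA by (simp add: L_def)
          have e1: "1 \<le> e" by (simp add: e_def)
          have "?W \<le> ?B (?T L)"
          proof (rule bound[OF L1])
            fix g :: "real^'n \<Rightarrow> real" and \<tau> :: real and h and P :: "'n node"
            assume g: "integrable lebesgue g" and \<tau>: "0 < \<tau>" and P: "0 < side P"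
            interpret T: weighted_tree g w p \<theta> A using g by (rule wtree)
            have "tree_int T.N (T.coef \<tau>) h P \<le> ennreal (c2 * D) * emeasure T.N (cube P)"
              using T.tree_sum_N_le_Ainf[OF \<tau> P wt _ D(2), of h] D unfolding T.G_def c2_def G_def by simp
            also have "\<dots> \<le> ennreal (max 1 (c2 * D)) * emeasure T.N (cube P)"
              by (intro mult_right_mono ennreal_leI) auto
            finally show "tree_int T.N (T.coef \<tau>) h P \<le> ennreal L * emeasure T.N (cube P)"
              using carA[OF g \<tau> P, of h] unfolding L_def by (simp add: min_def)
          qed
          also have "\<dots> \<le> ennreal (C * (A powr (1 / 2) * e powr (1 / 2))) * ?F"
          proof (intro mult_right_mono ennreal_leI)
            have "K = tree_const_ge2 ?n \<theta> p * (c1 powr ((p - 2) / 2) * (1 + ln c2))"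
              using p2 by (simp add: K_def c1_def c2_def)
            moreover have "A * (L powr ((p - 2) / 2) * (1 + ln L)) \<le> c1 powr ((p - 2) / 2) * (1 + ln c2) * (A powr (p / 2) * e)"
              unfolding e_def using L1 by (intro growth_factor_le p2 A1 c1 c2 D) (auto simp: L_def)
            ultimately have "?T L \<le> K * (A powr (p / 2) * e)"
              using K2 by (simp only: mult.assoc mult_le_cancel_left_pos)
            then have "(2 ^ ?n * ?T L) powr (1 / p)
                \<le> (2 ^ ?n * (K * (A powr (p / 2) * e))) powr (1 / p)"
              using K2 A L1 p2 by (intro powr_mono2 mult_left_mono mult_nonneg_nonneg) auto
            also have "\<dots> = (2 ^ ?n * K) powr (1 / p) * (A powr (1 / 2) * e powr (1 / p))"
              using K A e1 p2 by (simp add: powr_mult powr_powr)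
            \<comment> \<open>The p-th root leaves the logarithm with exponent \<open>1 / p\<close>,
              which \<open>e \<ge> 1\<close> and \<open>p \<ge> 2\<close> allow to be raised to
              \<open>1 / 2\<close>.\<close>
            also have "\<dots> \<le> (2 ^ ?n * K) powr (1 / p) * (A powr (1 / 2) * e powr (1 / 2))"
              using e1 p2 by (intro mult_left_mono powr_mono) (auto simp: field_simps)
            finally have "\<kappa> * (2 ^ ?n * ?T L) powr (1 / p)
                \<le> \<kappa> * ((2 ^ ?n * K) powr (1 / p) * (A powr (1 / 2) * e powr (1 / 2)))"
              using \<kappa> by (intro mult_left_mono) auto
            then show "\<kappa> * (2 ^ ?n * ?T L) powr (1 / p)
                \<le> C * (A powr (1 / 2) * e powr (1 / 2))" by (simp add: C_def mult.assoc)
          qed simp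
          also have "ennreal (C * (A powr (1 / 2) * e powr (1 / 2))) = ennreal C * weight_factor p w"
          proof -
            have "log1 (Ainf_const w) = ennreal e" using D by (simp add: log1_def e_def)
            then have "weight_factor p w = ennreal (A powr (1 / 2)) * ennreal (e powr (1 / 2))"
              using p2 A e1 by (simp add: weight_factor_def ennpowr_pos)
            then show ?thesis using C by (simp add: ennreal_mult')
          qed
          finally show ?thesis .
        qed
      qed
    qed
  qed
  show ?thesis using C main by blast
qed

end
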